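(* Let $m,d,d_1,d_2,n$ be non-negative integers. There are the following isomorphisms of moduli spaces of semistable quiver representations: (1) $M_{m,d}^L\simeq M_{m,m-d}^L$ if $m$, $d$ are coprime and $m-d>0$; (2) $M_{m,d}^C\simeq M_{m,2m-d}^C$ if $m$, $d$ are coprime and $2m-d>0$; (3) $M_{m,d_1,d_2}^{F_0}\simeq M_{m,m-d_1,m-d_2}^{F_0}$ if $m>\max\{d_1,d_2\}$ and $m$, $d_1+d_2$ are coprime; (4) $M_{(1-n)d_1+d_2+1,\,d_1,\,d_2}^{F_n}\simeq M_{(1-n)d_1+d_2+1,\,d_1+1,\,d_2+n+1}^{F_n}$ if $n>0$ and $(1-n)d_1+d_2\geq 0$.
   Context: All representations are over $\mathbb{C}$. For a quiver $Q$ with finite vertex set $Q_0$ and arrow set $Q_1$, the Euler form on $\mathbb{Z}Q_0$ is $\langle \underline a,\underline b\rangle=\sum_{i\in Q_0}a_ib_i-\sum_{(\alpha:i\to j)\in Q_1}a_ib_j$, and the antisymmetrized Euler form is $\{\underline a,\underline b\}=\langle \underline a,\underline b\rangle-\langle \underline b,\underline a\rangle$. A stability condition is a linear form $\theta$ on $\mathbb{Z}Q_0$, with slope $\mu(\underline e)=\theta(\underline e)/|\underline e|$, $|\underline e|=\sum_i e_i$. A representation $V$ is $\theta$-semistable if $\mu(\underline{\dim}\,U)\le\mu(\underline{\dim}\,V)$ for all nonzero proper subrepresentations $U\subset V$. For a dimension vector $\underline d$, the moduli space of $\theta$-semistable representations is the GIT quotient $R_{\underline d}^{\theta\text{-}sst}/\!/G_{\underline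 d}$, where $R_{\underline d}^{\theta\text{-}sst}\subset\bigoplus_{\alpha:i\to j}\mathrm{Hom}(\mathbb{C}^{d_i},\mathbb{C}^{d_j})$ is the semistable locus and $G_{\underline d}=\prod_i GL_{d_i}(\mathbb{C})$ acts by base change. The quivers: - type $L$: vertices $i_1,\dots,i_m,j$, with exactly one arrow $i_k\to j$ for each $k$; - type $C$: vertices $i_1,\dots,i_m,j$, with exactly two arrows $i_k\to j$ for each $k$; - type $F_n$: vertices $i_1,\dots,i_m,j_1,j_2$, with exactly one arrow $i_k\to j_1$ and one arrow $i_k\to j_2$ for each $k$, and exactly $n$ arrows $j_1\to j_2$. $M^L_{m,d}$ (resp. $M^C_{m,d}$) is the moduli space of $\theta$-semistable representations of the type $L$ (resp. type $C$) quiver with dimension $1$ at every $i_k$ and dimension $d$ at $j$. $M^{F_n}_{m,d_1,d_2}$ is the moduli space of $\theta$-semistable representations of the type $F_n$ quiver with dimension $1$ at every $i_k$, $d_1$ at $j_1$ and $d_2$ at $j_2$. In each case the stability condition is $\theta(\cdot)=\{\underline d,\cdot\}$, where $\underline d$ is the full dimension vector of the moduli space in question. *)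

theory Defs
  imports
    "HOL-Analysis.Abstract_Topology"
    "HOL-Algebra.Group_Action"
    "HOL-Algebra.Product_Groups"
    "Graph_Theory.Digraph"
    "Jordan_Normal_Form.VS_Connect"
begin

section \<open>Quivers and stability\<close>

text \<open>A quiver is a finite directed multigraph, i.e. a \<^type>\<open>pre_digraph\<close>
  satisfying \<^locale>\<open>fin_digraph\<close>; an arrow \<open>a\<close> goes from \<open>tail Q a\<close> to \<open>head Q a\<close>.
  Only the values of (dimension) vectors on \<open>verts Q\<close> are relevant.\<close>

definition euler_form :: "('v,'a) pre_digraph \<Rightarrow> ('v \<Rightarrow> int) \<Rightarrow> ('v \<Rightarrow> int) \<Rightarrow> int" where
  "euler_form Q a b =
     (\<Sum>i\<in>verts Q. a i * b i) - (\<Sum>\<alpha>\<in>arcs Q. a (tail Q \<alpha>) * b (head Q \<alpha>))"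

definition antisym_euler_form :: "('v,'a) pre_digraph \<Rightarrow> ('v \<Rightarrow> int) \<Rightarrow> ('v \<Rightarrow> int) \<Rightarrow> int" where
  "antisym_euler_form Q a b = euler_form Q a b - euler_form Q b a"

definition slope :: "('v,'a) pre_digraph \<Rightarrow> (('v \<Rightarrow> int) \<Rightarrow> int) \<Rightarrow> ('v \<Rightarrow> nat) \<Rightarrow> rat" where
  "slope Q \<theta> e = of_int (\<theta> (\<lambda>i. int (e i))) / of_nat (\<Sum>i\<in>verts Q. e i)"


section \<open>Representations\<close>

definition rep_space :: "('v,'a) pre_digraph \<Rightarrow> ('v \<Rightarrow> nat) \<Rightarrow> ('a \<Rightarrow> complex mat) set" where
  "rep_space Q d = (\<Pi>\<^sub>E \<alpha>\<in>arcs Q. carrier_mat (d (head Q \<alpha>)) (d (tail Q \<alpha>)))"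

definition subrep ::
  "('v,'a) pre_digraph \<Rightarrow> ('v \<Rightarrow> nat) \<Rightarrow> ('a \<Rightarrow> complex mat) \<Rightarrow> ('v \<Rightarrow> complex vec set) \<Rightarrow> bool" where
  "subrep Q d V U \<longleftrightarrow>
     (\<forall>i\<in>verts Q. VectorSpace.subspace class_ring (U i) (module_vec TYPE(complex) (d i))) \<and>
     (\<forall>\<alpha>\<in>arcs Q. \<forall>u\<in>U (tail Q \<alpha>). V \<alpha> *\<^sub>v u \<in> U (head Q \<alpha>))"

definition subrep_dim :: "('v \<Rightarrow> nat) \<Rightarrow> ('v \<Rightarrow> complex vec set) \<Rightarrow> 'v \<Rightarrow> nat" where
  "subrep_dim d U i =
     vectorspace.dim class_ring ((module_vec TYPE(complex) (d i))\<lparr>carrier := U i\<rparr>)"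

definition semistable ::
  "('v,'a) pre_digraph \<Rightarrow> (('v \<Rightarrow> int) \<Rightarrow> int) \<Rightarrow> ('v \<Rightarrow> nat) \<Rightarrow> ('a \<Rightarrow> complex mat) \<Rightarrow> bool" where
  "semistable Q \<theta> d V \<longleftrightarrow>
     (\<forall>U. subrep Q d V U \<and>
          (\<exists>i\<in>verts Q. U i \<noteq> {0\<^sub>v (d i)}) \<and>
          (\<exists>i\<in>verts Q. U i \<noteq> carrier_vec (d i)) \<longrightarrow>
          slope Q \<theta> (subrep_dim d U) \<le> slope Q \<theta> d)"

definition semistable_locus ::
  "('v,'a) pre_digraph \<Rightarrow> (('v \<Rightarrow> int) \<Rightarrow> int) \<Rightarrow> ('v \<Rightarrow> nat) \<Rightarrow> ('a \<Rightarrow> complex mat) set" where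
  "semistable_locus Q \<theta> d = {V \<in> rep_space Q d. semistable Q \<theta> d V}"

definition GL_mat :: "nat \<Rightarrow> complex mat monoid" where
  "GL_mat n = units_of (ring_mat TYPE(complex) n ())"

definition base_change_group :: "('v,'a) pre_digraph \<Rightarrow> ('v \<Rightarrow> nat) \<Rightarrow> ('v \<Rightarrow> complex mat) monoid" where
  "base_change_group Q d = product_group (verts Q) (\<lambda>i. GL_mat (d i))"

definition base_change ::
  "('v,'a) pre_digraph \<Rightarrow> ('v \<Rightarrow> nat) \<Rightarrow> ('v \<Rightarrow> complex mat)
    \<Rightarrow> ('a \<Rightarrow> complex mat) \<Rightarrow> ('a \<Rightarrow> complex mat)" where
  "base_change Q d g V =
     (\<lambda>\<alpha>\<in>arcs Q. g (head Q \<alpha>) * V \<alpha> * inv\<^bsub>GL_mat (d (tail Q \<alpha>))\<^esub> g (tail Q \<alpha>))"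


section \<open>Varieties as spaces with functions\<close>

text \<open>A complex variety is represented by its set of closed points with the Zariski
  topology, together with the sheaf of complex-valued regular functions. Whether a
  function belongs to \<open>reg_sections X U\<close> depends only on its values on \<open>U\<close>.\<close>

record 'x space_with_functions =
  space_top :: "'x topology"
  reg_sections :: "'x set \<Rightarrow> ('x \<Rightarrow> complex) set"

definition isomorphic_spaces ::
  "'x space_with_functions \<Rightarrow> 'y space_with_functions \<Rightarrow> bool" (infix "\<simeq>\<^sub>v" 50) where
  "X \<simeq>\<^sub>v Y \<longleftrightarrow>
     (\<exists>\<phi>. homeomorphic_map (space_top X) (space_top Y) \<phi> \<and>
          (\<forall>U f. openin (space_top Y) U \<longrightarrow>
             (f \<in> reg_sections Y U \<longleftrightarrow>
              f \<circ> \<phi> \<in> reg_sections X {x \<in> topspace (space_top X). \<phi> x \<in> U})))"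

definition quotient_topology :: "'x topology \<Rightarrow> ('x \<Rightarrow> 'y) \<Rightarrow> 'y topology" where
  "quotient_topology X p =
     topology (\<lambda>U. U \<subseteq> p ` topspace X \<and> openin X {x \<in> topspace X. p x \<in> U})"

lemma openin_quotient_topology:
  "openin (quotient_topology X p) U \<longleftrightarrow>
     U \<subseteq> p ` topspace X \<and> openin X {x \<in> topspace X. p x \<in> U}"
proof -
  have "istopology (\<lambda>U. U \<subseteq> p ` topspace X \<and> openin X {x \<in> topspace X. p x \<in> U})"
    unfolding istopology_def
  proof (intro conjI allI impI; (elim conjE)?)
    fix S T assume "openin X {x \<in> topspace X. p x \<in> S}" "openin X {x \<in> topspace X. p x \<in> T}"
    then have "openin X ({x \<in> topspace X. p x \<in> S} \<inter> {x \<in> topspace X. p x \<in> T})" by blast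
    then show "openin X {x \<in> topspace X. p x \<in> S \<inter> T}"
      by (simp add: Int_def conj_ac cong: conj_cong)
  next
    fix K assume K: "\<forall>S\<in>K. S \<subseteq> p ` topspace X \<and> openin X {x \<in> topspace X. p x \<in> S}"
    have "{x \<in> topspace X. p x \<in> \<Union>K} = (\<Union>S\<in>K. {x \<in> topspace X. p x \<in> S})" by blast
    with K show "openin X {x \<in> topspace X. p x \<in> \<Union>K}" by auto
  qed auto
  then show ?thesis by (simp add: quotient_topology_def)
qed

text \<open>The coordinate ring of the affine space \<open>rep_space Q d\<close>: the algebra of functions
  generated by the constants and the matrix entries.\<close>

inductive_set poly_functions ::
  "('v,'a) pre_digraph \<Rightarrow> ('v \<Rightarrow> nat) \<Rightarrow> (('a \<Rightarrow> complex mat) \<Rightarrow> complex) set"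
  for Q :: "('v,'a) pre_digraph" and d :: "'v \<Rightarrow> nat" where
  const: "(\<lambda>V. c) \<in> poly_functions Q d"
| coord: "\<alpha> \<in> arcs Q \<Longrightarrow> r < d (head Q \<alpha>) \<Longrightarrow> s < d (tail Q \<alpha>) \<Longrightarrow>
    (\<lambda>V. V \<alpha> $$ (r, s)) \<in> poly_functions Q d"
| add: "p \<in> poly_functions Q d \<Longrightarrow> q \<in> poly_functions Q d \<Longrightarrow>
    (\<lambda>V. p V + q V) \<in> poly_functions Q d"
| mult: "p \<in> poly_functions Q d \<Longrightarrow> q \<in> poly_functions Q d \<Longrightarrow>
    (\<lambda>V. p V * q V) \<in> poly_functions Q d"

definition zariski :: "('v,'a) pre_digraph \<Rightarrow> ('v \<Rightarrow> nat) \<Rightarrow> ('a \<Rightarrow> complex mat) topology" where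
  "zariski Q d = topology_generated_by
     {{V \<in> rep_space Q d. p V \<noteq> 0} | p. p \<in> poly_functions Q d}"

text \<open>Functions on a locally closed subset \<open>W\<close> of the affine space which are, locally on
  \<open>W\<close>, quotients of polynomials.\<close>

definition regular_functions ::
  "('v,'a) pre_digraph \<Rightarrow> ('v \<Rightarrow> nat) \<Rightarrow> ('a \<Rightarrow> complex mat) set
    \<Rightarrow> (('a \<Rightarrow> complex mat) \<Rightarrow> complex) set" where
  "regular_functions Q d W =
     {f. \<forall>x\<in>W. \<exists>N. openin (subtopology (zariski Q d) W) N \<and> x \<in> N \<and>
           (\<exists>p\<in>poly_functions Q d. \<exists>q\<in>poly_functions Q d.
              \<forall>y\<in>N. q y \<noteq> 0 \<and> f y = p y / q y)}"


section \<open>The GIT quotient\<close>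

text \<open>The GIT quotient of an invariant open subset \<open>X\<close> of the affine space, as a good
  quotient: two points of \<open>X\<close> are identified iff the closures in \<open>X\<close> of their orbits
  meet, the topology is the quotient topology, and a function on an open subset is regular
  iff its pullback to \<open>X\<close>, an invariant function, is regular.\<close>

definition git_class ::
  "('v,'a) pre_digraph \<Rightarrow> ('v \<Rightarrow> nat) \<Rightarrow> ('a \<Rightarrow> complex mat) set
    \<Rightarrow> ('a \<Rightarrow> complex mat) \<Rightarrow> ('a \<Rightarrow> complex mat) set" where
  "git_class Q d X V =
     {W \<in> X.
        (subtopology (zariski Q d) X closure_of orbit (base_change_group Q d) (base_change Q d) V) \<inter>
        (subtopology (zariski Q d) X closure_of orbit (base_change_group Q d) (base_change Q d) W)
        \<noteq> {}}"

definition git_quotient ::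
  "('v,'a) pre_digraph \<Rightarrow> ('v \<Rightarrow> nat) \<Rightarrow> ('a \<Rightarrow> complex mat) set
    \<Rightarrow> ('a \<Rightarrow> complex mat) set space_with_functions" where
  "git_quotient Q d X =
     \<lparr>space_top = quotient_topology (subtopology (zariski Q d) X) (git_class Q d X),
      reg_sections = (\<lambda>U. {f. f \<circ> git_class Q d X \<in>
                            regular_functions Q d {V \<in> X. git_class Q d X V \<in> U}})\<rparr>"

definition moduli_space ::
  "('v,'a) pre_digraph \<Rightarrow> (('v \<Rightarrow> int) \<Rightarrow> int) \<Rightarrow> ('v \<Rightarrow> nat)
    \<Rightarrow> ('a \<Rightarrow> complex mat) set space_with_functions" where
  "moduli_space Q \<theta> d = git_quotient Q d (semistable_locus Q \<theta> d)"

definition self_stability :: "('v,'a) pre_digraph \<Rightarrow> ('v \<Rightarrow> nat) \<Rightarrow> ('v \<Rightarrow> int) \<Rightarrow> int" where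
  "self_stability Q d e = antisym_euler_form Q (\<lambda>i. int (d i)) e"


section \<open>The quivers of type L, C and F\<close>

text \<open>The quiver on \<open>N\<close> with exactly \<open>a x y\<close> arrows \<open>(x, y, 0), \<dots>, (x, y, a x y - 1)\<close>
  from \<open>x\<close> to \<open>y\<close>.\<close>

definition quiver_of :: "'v set \<Rightarrow> ('v \<Rightarrow> 'v \<Rightarrow> nat) \<Rightarrow> ('v, 'v \<times> 'v \<times> nat) pre_digraph" where
  "quiver_of N a =
     \<lparr>verts = N, arcs = {(x, y, k). x \<in> N \<and> y \<in> N \<and> k < a x y},
      tail = (\<lambda>(x, y, k). x), head = (\<lambda>(x, y, k). y)\<rparr>"

lemma fin_digraph_quiver_of:
  assumes "finite N"
  shows "fin_digraph (quiver_of N a)"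
proof
  have "arcs (quiver_of N a) = (SIGMA x:N. SIGMA y:N. {..<a x y})"
    by (auto simp: quiver_of_def)
  with assms show "finite (arcs (quiver_of N a))" by simp
qed (use assms in \<open>auto simp: quiver_of_def\<close>)

datatype vertex_LC = I nat | J

fun arrows_LC :: "nat \<Rightarrow> vertex_LC \<Rightarrow> vertex_LC \<Rightarrow> nat" where
  "arrows_LC r (I k) J = r"
| "arrows_LC r _ _ = 0"

definition quiver_L :: "nat \<Rightarrow> (vertex_LC, vertex_LC \<times> vertex_LC \<times> nat) pre_digraph" where
  "quiver_L m = quiver_of (I ` {1..m} \<union> {J}) (arrows_LC 1)"

definition quiver_C :: "nat \<Rightarrow> (vertex_LC, vertex_LC \<times> vertex_LC \<times> nat) pre_digraph" where
  "quiver_C m = quiver_of (I ` {1..m} \<union> {J}) (arrows_LC 2)"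

fun dim_LC :: "nat \<Rightarrow> vertex_LC \<Rightarrow> nat" where
  "dim_LC d (I k) = 1"
| "dim_LC d J = d"

datatype vertex_F = IF nat | J1 | J2

fun arrows_F :: "nat \<Rightarrow> vertex_F \<Rightarrow> vertex_F \<Rightarrow> nat" where
  "arrows_F n (IF k) J1 = 1"
| "arrows_F n (IF k) J2 = 1"
| "arrows_F n J1 J2 = n"
| "arrows_F n _ _ = 0"

definition quiver_F :: "nat \<Rightarrow> nat \<Rightarrow> (vertex_F, vertex_F \<times> vertex_F \<times> nat) pre_digraph" where
  "quiver_F n m = quiver_of (IF ` {1..m} \<union> {J1, J2}) (arrows_F n)"

fun dim_F :: "nat \<Rightarrow> nat \<Rightarrow> vertex_F \<Rightarrow> nat" where
  "dim_F d1 d2 (IF k) = 1"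
| "dim_F d1 d2 J1 = d1"
| "dim_F d1 d2 J2 = d2"

definition M_L ::
  "nat \<Rightarrow> nat \<Rightarrow> (vertex_LC \<times> vertex_LC \<times> nat \<Rightarrow> complex mat) set space_with_functions" where
  "M_L m d = moduli_space (quiver_L m) (self_stability (quiver_L m) (dim_LC d)) (dim_LC d)"

definition M_C ::
  "nat \<Rightarrow> nat \<Rightarrow> (vertex_LC \<times> vertex_LC \<times> nat \<Rightarrow> complex mat) set space_with_functions" where
  "M_C m d = moduli_space (quiver_C m) (self_stability (quiver_C m) (dim_LC d)) (dim_LC d)"

definition M_F ::
  "nat \<Rightarrow> nat \<Rightarrow> nat \<Rightarrow> nat
    \<Rightarrow> (vertex_F \<times> vertex_F \<times> nat \<Rightarrow> complex mat) set space_with_functions" where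
  "M_F n m d1 d2 =
     moduli_space (quiver_F n m) (self_stability (quiver_F n m) (dim_F d1 d2)) (dim_F d1 d2)"

end

theory Submission
  imports Defs "Jordan_Normal_Form.DL_Rank"
begin

text \<open>
  Every one of the four isomorphisms is a composition of two kinds of isomorphism between moduli
  spaces with the stability condition \<open>{d, _}\<close>: reflection at a sink, and passage to the opposite
  quiver.

  For the reflection, let \<open>j\<close> be a sink of \<open>Q\<close> and let \<open>N\<close> be the sum of the dimensions at the tails of the
  arrows into \<open>j\<close>. These arrows of a representation \<open>V\<close> form a single block matrix
  \<open>\<Phi> : \<complex>\<^sup>N \<rightarrow> \<complex>\<^sup>d\<close> with \<open>d\<close> the dimension at \<open>j\<close>. If \<open>V\<close> is semistable, \<open>\<Phi>\<close> is surjective, for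
  otherwise the image of \<open>\<Phi>\<close> at \<open>j\<close> and the whole space elsewhere destabilise \<open>V\<close>. A basis
  \<open>\<Psi> : \<complex>\<^sup>e \<rightarrow> \<complex>\<^sup>N\<close>, \<open>e = N - d\<close>, of the kernel of \<open>\<Phi>\<close> consists of blocks going out of \<open>j\<close>; together
  with the arrows away from \<open>j\<close> it is a representation \<open>W\<close> of the quiver with the arrows at \<open>j\<close>
  reversed. Conversely \<open>\<Phi>\<close> is a cokernel of \<open>\<Psi>\<close>. (For the quiver of type L this is Gale duality of
  point configurations.) Reflection preserves the antisymmetrised Euler form and turns
  subrepresentations that matter for stability into each other, so \<open>V\<close> is semistable iff \<open>W\<close> is
  (\<open>semistable_reflect\<close>).

  The kernel has no canonical basis, so \<open>V\<close> and \<open>W\<close> are linked by the relation \<open>\<Phi> \<Psi> = 0\<close> and not by a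
  map. Such a relation induces an isomorphism of good quotients as soon as it is total on both
  sides, matches orbits with orbits, and has rational local sections through each of its points
  (\<open>git_quotient_isomorphic\<close>): the sections carry neighbourhoods, hence closures of orbits and the
  quotient topology, and also regular functions from one side to the other. For the reflection,
  Cramer's rule provides the sections (\<open>kernel_section\<close>, \<open>cokernel_section\<close>).

  As for the opposite quiver, transposing all matrices reverses all arrows, replaces
  subrepresentations by their annihilators and changes the sign of the antisymmetrised Euler form
  (\<open>moduli_space_opposite\<close>).

  It remains to combine the two. For types L and C all arrows end at \<open>j\<close>, so after the reflection
  at \<open>j\<close> the quiver is the opposite of the original one, and \<open>d\<close> has become \<open>m - d\<close> or \<open>2 m - d\<close>. For
  \<open>F\<^sub>0\<close> the same is done at \<open>j\<^sub>1\<close> and at \<open>j\<^sub>2\<close>. For \<open>F\<^sub>n\<close> the reflection at \<open>j\<^sub>2\<close> makes \<open>j\<^sub>1\<close> a sink, and the reflection at \<open>j\<^sub>1\<close>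
  then produces the opposite of \<open>F\<^sub>n\<close> with the roles of \<open>j\<^sub>1\<close> and \<open>j\<^sub>2\<close> interchanged. The dimensions
  become \<open>m + n d\<^sub>1 - d\<^sub>2\<close> at \<open>j\<^sub>2\<close> and then \<open>m + n (m + n d\<^sub>1 - d\<^sub>2) - d\<^sub>1\<close> at \<open>j\<^sub>1\<close>, which are \<open>d\<^sub>1 + 1\<close> and
  \<open>d\<^sub>2 + n + 1\<close> for \<open>m = (1 - n) d\<^sub>1 + d\<^sub>2 + 1\<close>.
\<close>

section \<open>Subspaces of coordinate space\<close>

abbreviation lin_sub :: "nat \<Rightarrow> complex vec set \<Rightarrow> bool" where
  "lin_sub n U \<equiv> VectorSpace.subspace class_ring U (module_vec TYPE(complex) n)"

abbreviation sdim :: "nat \<Rightarrow> complex vec set \<Rightarrow> nat" where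
  "sdim n U \<equiv> vectorspace.dim class_ring ((module_vec TYPE(complex) n)\<lparr>carrier := U\<rparr>)"

lemma lin_sub_iff:
  "lin_sub n U \<longleftrightarrow> U \<subseteq> carrier_vec n \<and> 0\<^sub>v n \<in> U \<and> (\<forall>u\<in>U. \<forall>v\<in>U. u + v \<in> U) \<and> (\<forall>c. \<forall>u\<in>U. c \<cdot>\<^sub>v u \<in> U)"
  unfolding VectorSpace.subspace_def submodule_def
  using vec_vs[of n] vec_module[of n]
  by (auto simp: module_vec_simps class_ring_simps)

lemma fin_dim_lin_sub:
  assumes U: "lin_sub n U"
  shows "vectorspace.fin_dim class_ring ((module_vec TYPE(complex) n)\<lparr>carrier := U\<rparr>)"
proof -
  interpret V: vectorspace class_ring "module_vec TYPE(complex) n" by (rule vec_vs)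
  have vs: "vectorspace class_ring (V.vs U)" by (rule V.subspace_is_vs[OF U])
  interpret W: vectorspace class_ring "V.vs U" by (rule vs)
  have sm: "submodule class_ring U (module_vec TYPE(complex) n)" using U by (rule V.is_module)
  have UC: "U \<subseteq> carrier (module_vec TYPE(complex) n)" using sm by (simp add: submodule_def)
  have small: "finite A \<and> card A \<le> V.dim" if "A \<subseteq> carrier (V.vs U) \<and> W.lin_indpt A" for A
  proof -
    have A: "A \<subseteq> U" "A \<subseteq> carrier (module_vec TYPE(complex) n)" "V.lin_indpt A"
      using that UC V.span_li_not_depend(2)[OF _ sm, of A] by auto
    show ?thesis using V.li_le_dim[OF vec_space.fin_dim A(2,3)] by simp
  qed
  have "\<exists>A. finite A \<and> maximal A (\<lambda>S. S \<subseteq> carrier (V.vs U) \<and> W.lin_indpt S)"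
    by (rule maximal_exists[where N="V.dim" and B="{}"], rule small) (auto simp: W.lin_dep_def)
  then obtain A where A: "finite A" "maximal A (\<lambda>S. S \<subseteq> carrier (V.vs U) \<and> W.lin_indpt S)" by blast
  from W.max_li_is_basis[OF A(2)] A(1) show ?thesis unfolding W.fin_dim_def W.basis_def by blast
qed

text \<open>All dimension counts below are reduced to this form of the rank-nullity theorem, in which the
  matrix is restricted to a subspace: products, images and kernels then need no bases.\<close>

lemma rank_nullity_mat:
  assumes A: "A \<in> carrier_mat r c" and U: "lin_sub c U"
  shows "sdim r ((\<lambda>u. A *\<^sub>v u) ` U) + sdim c {u \<in> U. A *\<^sub>v u = 0\<^sub>v r} = sdim c U"
proof -
  interpret V: vectorspace class_ring "module_vec TYPE(complex) c" by (rule vec_vs)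
  interpret W: vectorspace class_ring "module_vec TYPE(complex) r" by (rule vec_vs)
  have vs: "vectorspace class_ring (V.vs U)" by (rule V.subspace_is_vs[OF U])
  have UC: "U \<subseteq> carrier_vec c" using U by (simp add: lin_sub_iff)
  interpret T: linear_map class_ring "V.vs U" "module_vec TYPE(complex) r" "\<lambda>u. A *\<^sub>v u"
    unfolding linear_map_def mod_hom_def mod_hom_axioms_def module_hom_def
    using vs W.vectorspace_axioms A UC
    by (auto simp: vectorspace_def module_vec_simps mult_add_distrib_mat_vec[OF A] subset_iff mult_mat_vec[OF A])
  show ?thesis using T.rank_nullity[OF fin_dim_lin_sub[OF U]]
    by (simp add: T.im_def T.ker_def module_vec_simps cong: conj_cong)
qed

lemma sdim_carrier [simp]: "sdim n (carrier_vec n) = n"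
proof -
  interpret V: vectorspace class_ring "module_vec TYPE(complex) n" by (rule vec_vs)
  have "V.vs (carrier_vec n) = module_vec TYPE(complex) n" by (simp add: module_vec_def)
  then show ?thesis using vec_space.dim_is_n[where ?'a = complex, of n] by simp
qed

lemma lin_sub_carrier [simp]: "lin_sub n (carrier_vec n)" by (auto simp: lin_sub_iff)

lemma lin_sub_zero [simp]: "lin_sub n {0\<^sub>v n}" by (auto simp: lin_sub_iff)

lemma sdim_zero [simp]: "sdim n {0\<^sub>v n} = 0"
proof -
  have "(\<lambda>u. 1\<^sub>m n *\<^sub>v u) ` {0\<^sub>v n} = {0\<^sub>v n}" "{u \<in> {0\<^sub>v n}. 1\<^sub>m n *\<^sub>v u = 0\<^sub>v n} = {0\<^sub>v n :: complex vec}" by auto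
  note eqs = this
  from rank_nullity_mat[OF one_carrier_mat[of n] lin_sub_zero[of n]]
  show ?thesis unfolding eqs by linarith
qed

lemma sdim_mono:
  assumes U: "lin_sub n U" and W: "lin_sub n W" and "U \<subseteq> W"
  shows "sdim n U \<le> sdim n W"
proof -
  interpret V: vectorspace class_ring "module_vec TYPE(complex) n" by (rule vec_vs)
  interpret W: vectorspace class_ring "V.vs W" by (rule V.subspace_is_vs[OF W])
  have "subspace class_ring U (V.vs W)" by (rule V.nested_subspaces[OF W U assms(3)])
  from W.subspace_dim[OF this fin_dim_lin_sub[OF W]] fin_dim_lin_sub[OF U] show ?thesis by simp
qed


lemma mat_eq_by_vec:
  fixes A B :: "complex mat"
  assumes "A \<in> carrier_mat r c" "B \<in> carrier_mat r c"
    and "\<And>v. v \<in> carrier_vec c \<Longrightarrow> A *\<^sub>v v = B *\<^sub>v v"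
  shows "A = B"
proof (rule eq_matI)
  fix i j assume ij: "i < dim_row B" "j < dim_col B"
  have "(A *\<^sub>v unit_vec c j) $ i = (B *\<^sub>v unit_vec c j) $ i" using assms(3) by simp
  then show "A $$ (i, j) = B $$ (i, j)" using ij assms(1,2) by simp
qed (use assms in auto)

text \<open>Over the complex numbers \<open>B\<^sup>* B\<close> is invertible for injective \<open>B\<close>, since
  \<open>B\<^sup>* B x = 0\<close> gives \<open>|B x|\<^sup>2 = 0\<close>; so \<open>(B\<^sup>* B)\<^sup>-\<^sup>1 B\<^sup>*\<close> is a left inverse.\<close>

lemma left_inverse_of_injective:
  fixes B :: "complex mat"
  assumes B: "B \<in> carrier_mat n k"
    and inj: "\<And>x. x \<in> carrier_vec k \<Longrightarrow> B *\<^sub>v x = 0\<^sub>v n \<Longrightarrow> x = 0\<^sub>v k"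
  shows "\<exists>L\<in>carrier_mat k n. L * B = 1\<^sub>m k"
proof -
  define C where "C = transpose_mat (map_mat cnj B)"
  have C: "C \<in> carrier_mat k n" using B by (simp add: C_def)
  have CB: "C * B \<in> carrier_mat k k" using B C by simp
  have "det (C * B) \<noteq> 0"
  proof
    assume "det (C * B) = 0"
    then obtain x where x: "x \<in> carrier_vec k" "x \<noteq> 0\<^sub>v k" "C * B *\<^sub>v x = 0\<^sub>v k"
      using det_0_iff_vec_prod_zero_field[OF CB] by blast
    define y where "y = B *\<^sub>v x"
    have y: "y \<in> carrier_vec n" using B x by (simp add: y_def)
    have Cy: "C *\<^sub>v y = 0\<^sub>v k" using x B C by (simp add: y_def)
    have "conjugate y = map_mat cnj B *\<^sub>v conjugate x"
      using B x by (intro eq_vecI) (auto simp: y_def scalar_prod_def)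
    then have "y \<bullet>c y = y \<bullet> (map_mat cnj B *\<^sub>v conjugate x)" by simp
    also have "\<dots> = (C *\<^sub>v y) \<bullet> conjugate x"
      unfolding C_def
      by (rule transpose_vec_mult_scalar[symmetric, of _ n k]) (use B x y in auto)
    also have "\<dots> = 0" using Cy x by simp
    finally have "y = 0\<^sub>v n" using y conjugate_square_eq_0_vec by blast
    with inj x show False by (simp add: y_def)
  qed
  then have "(1 / det (C * B)) \<cdot>\<^sub>m adj_mat (C * B) * C * B = 1\<^sub>m k"
    using adj_mat[OF CB] B C
    by (simp add: assoc_mult_mat[of _ k k C n B k] mult_smult_assoc_mat[of _ k k _ k])
       (auto intro!: eq_matI)
  moreover have "(1 / det (C * B)) \<cdot>\<^sub>m adj_mat (C * B) * C \<in> carrier_mat k n"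
    using adj_mat(1)[OF CB] C by (intro mult_carrier_mat[of _ k k] smult_carrier_mat)
  ultimately show ?thesis by blast
qed

lemma injective_of_left_inverse:
  fixes B :: "complex mat"
  assumes "B \<in> carrier_mat n k" "L \<in> carrier_mat k n" "L * B = 1\<^sub>m k" "x \<in> carrier_vec k" "B *\<^sub>v x = 0\<^sub>v n"
  shows "x = 0\<^sub>v k"
proof -
  have "x = L * B *\<^sub>v x" using assms by simp
  also have "\<dots> = L *\<^sub>v (B *\<^sub>v x)" using assms(1,2,4) by simp
  also have "\<dots> = 0\<^sub>v k" using assms by auto
  finally show ?thesis .
qed

lemma lin_sub_image:
  assumes A: "A \<in> carrier_mat r c" and U: "lin_sub c U"
  shows "lin_sub r ((\<lambda>u. A *\<^sub>v u) ` U)"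
proof -
  have UC: "U \<subseteq> carrier_vec c" and U0: "0\<^sub>v c \<in> U"
    and Ua: "\<And>u v. u \<in> U \<Longrightarrow> v \<in> U \<Longrightarrow> u + v \<in> U" and Um: "\<And>a u. u \<in> U \<Longrightarrow> a \<cdot>\<^sub>v u \<in> U"
    using U by (auto simp: lin_sub_iff)
  show ?thesis unfolding lin_sub_iff
  proof (intro conjI ballI allI)
    show "(\<lambda>u. A *\<^sub>v u) ` U \<subseteq> carrier_vec r" using A UC by auto
    have "A *\<^sub>v 0\<^sub>v c = 0\<^sub>v r" using A by auto
    then show "0\<^sub>v r \<in> (\<lambda>u. A *\<^sub>v u) ` U" using U0 by (metis imageI)
    fix u assume "u \<in> (\<lambda>u. A *\<^sub>v u) ` U"
    then obtain x where x: "x \<in> U" "u = A *\<^sub>v x" by blast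
    show "a \<cdot>\<^sub>v u \<in> (\<lambda>u. A *\<^sub>v u) ` U" for a
    proof
      show "a \<cdot>\<^sub>v u = A *\<^sub>v (a \<cdot>\<^sub>v x)" using x UC by (metis A mult_mat_vec subsetD)
    qed (use x Um in blast)
    fix v assume "v \<in> (\<lambda>u. A *\<^sub>v u) ` U"
    then obtain y where y: "y \<in> U" "v = A *\<^sub>v y" by blast
    show "u + v \<in> (\<lambda>u. A *\<^sub>v u) ` U"
    proof
      show "u + v = A *\<^sub>v (x + y)" using x y UC by (metis A mult_add_distrib_mat_vec subsetD)
    qed (use x y Ua in blast)
  qed
qed

lemma lin_sub_kernel:
  assumes A: "A \<in> carrier_mat r c" and U: "lin_sub c U"
  shows "lin_sub c {u \<in> U. A *\<^sub>v u = 0\<^sub>v r}"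
  using assms unfolding lin_sub_iff
  by (auto simp: mult_add_distrib_mat_vec[OF A] mult_mat_vec[OF A] subset_iff)

lemma sdim_image_injective:
  assumes A: "A \<in> carrier_mat r c" and U: "lin_sub c U"
    and inj: "\<And>u. u \<in> U \<Longrightarrow> A *\<^sub>v u = 0\<^sub>v r \<Longrightarrow> u = 0\<^sub>v c"
  shows "sdim r ((\<lambda>u. A *\<^sub>v u) ` U) = sdim c U"
proof -
  have "{u \<in> U. A *\<^sub>v u = 0\<^sub>v r} = {0\<^sub>v c}" using inj A U by (auto simp: lin_sub_iff)
  then show ?thesis using rank_nullity_mat[OF A U] by simp
qed

text \<open>A basis of a subspace, packed into the columns of a matrix: take an injective matrix with columns
  in \<open>U\<close> and as many columns as possible; a vector of \<open>U\<close> outside its range could be appended.\<close>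

lemma lin_sub_frame:
  assumes U: "lin_sub n U"
  obtains B L where "B \<in> carrier_mat n (sdim n U)" "L \<in> carrier_mat (sdim n U) n"
    "L * B = 1\<^sub>m (sdim n U)" "U = (\<lambda>x. B *\<^sub>v x) ` carrier_vec (sdim n U)"
proof -
  define good where "good k B \<longleftrightarrow> B \<in> carrier_mat n k \<and>
    (\<forall>x\<in>carrier_vec k. B *\<^sub>v x \<in> U) \<and> (\<forall>x\<in>carrier_vec k. B *\<^sub>v x = 0\<^sub>v n \<longrightarrow> x = 0\<^sub>v k)" for k B
  have dim: "sdim n ((\<lambda>x. B *\<^sub>v x) ` carrier_vec k) = k" if "good k B" for k B
    using that sdim_image_injective[of B n k "carrier_vec k"] by (auto simp: good_def)
  have bound: "k \<le> sdim n U" if "\<exists>B. good k B" for k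
  proof -
    from that obtain B where B: "good k B" by blast
    have "sdim n ((\<lambda>x. B *\<^sub>v x) ` carrier_vec k) \<le> sdim n U"
      using B by (intro sdim_mono[OF _ U] lin_sub_image[of B n k]) (auto simp: good_def)
    then show ?thesis using dim[OF B] by simp
  qed
  have "0\<^sub>m n 0 *\<^sub>v x = 0\<^sub>v n" if "x \<in> carrier_vec 0" for x :: "complex vec"
    using that by (intro eq_vecI) (auto simp: scalar_prod_def)
  then have "good 0 (0\<^sub>m n 0)"
    using U by (auto simp: good_def lin_sub_iff intro: eq_vecI)
  then have ex: "\<exists>k B. good k B" by blast
  define k where "k = (GREATEST k. \<exists>B. good k B)"
  have k: "\<exists>B. good k B" unfolding k_def by (rule GreatestI_ex_nat[OF ex]) (use bound in blast)
  have kmax: "j \<le> k" if "\<exists>B. good j B" for j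
    unfolding k_def by (rule Greatest_le_nat[where P="\<lambda>k. \<exists>B. good k B", OF that]) (use bound in blast)
  from k obtain B where B: "good k B" by blast
  then have Bc: "B \<in> carrier_mat n k" by (simp add: good_def)
  have sub: "(\<lambda>x. B *\<^sub>v x) ` carrier_vec k = U"
  proof (rule ccontr)
    assume "\<not> ?thesis"
    then obtain u where u: "u \<in> U" "u \<notin> (\<lambda>x. B *\<^sub>v x) ` carrier_vec k"
      using B by (auto simp: good_def)
    then have uc: "u \<in> carrier_vec n" using U by (auto simp: lin_sub_iff)
    define B' where "B' = mat n (Suc k) (\<lambda>(r, c). if c < k then B $$ (r, c) else u $ r)"
    have B'x: "B' *\<^sub>v x = B *\<^sub>v vec k (\<lambda>i. x $ i) + x $ k \<cdot>\<^sub>v u" if "x \<in> carrier_vec (Suc k)" for x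
      using that Bc uc
      by (intro eq_vecI) (auto simp: B'_def scalar_prod_def mult.commute)
    have "good (Suc k) B'" unfolding good_def
    proof (intro conjI ballI impI)
      show "B' \<in> carrier_mat n (Suc k)" by (simp add: B'_def)
      fix x :: "complex vec" assume x: "x \<in> carrier_vec (Suc k)"
      have "B *\<^sub>v vec k (\<lambda>i. x $ i) \<in> U" using B by (auto simp: good_def)
      then show "B' *\<^sub>v x \<in> U" using B'x[OF x] u(1) U by (auto simp: lin_sub_iff)
      assume z: "B' *\<^sub>v x = 0\<^sub>v n"
      have xk: "x $ k = 0"
      proof (rule ccontr)
        assume nz: "x $ k \<noteq> 0"
        have "u = B *\<^sub>v ((- 1 / x $ k) \<cdot>\<^sub>v vec k (\<lambda>i. x $ i))"
        proof (rule eq_vecI)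
          fix i assume "i < dim_vec (B *\<^sub>v ((- 1 / x $ k) \<cdot>\<^sub>v vec k (\<lambda>i. x $ i)))"
          then have i: "i < n" using Bc by simp
          have "(B' *\<^sub>v x) $ i = 0" using z i by simp
          then have "(B *\<^sub>v vec k (\<lambda>i. x $ i)) $ i + x $ k * u $ i = 0"
            using B'x[OF x] i uc Bc by simp
          then show "u $ i = (B *\<^sub>v ((- 1 / x $ k) \<cdot>\<^sub>v vec k (\<lambda>i. x $ i))) $ i"
            using nz i Bc by (simp add: mult_mat_vec[OF Bc] field_simps add_eq_0_iff)
        qed (use uc Bc in auto)
        then show False using u(2) by (metis imageI smult_carrier_vec vec_carrier)
      qed
      have "0 \<cdot>\<^sub>v u = 0\<^sub>v n" using uc by (intro eq_vecI) auto
      then have "B *\<^sub>v vec k (\<lambda>i. x $ i) + 0\<^sub>v n = 0\<^sub>v n"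
        using z B'x[OF x] xk by simp
      then have "B *\<^sub>v vec k (\<lambda>i. x $ i) = 0\<^sub>v n"
        using right_zero_vec[OF mult_mat_vec_carrier[OF Bc vec_carrier]] by metis
      then have "vec k (\<lambda>i. x $ i) = 0\<^sub>v k" using B by (auto simp: good_def)
      then have "x $ i = 0" if "i < k" for i using that by (metis index_vec index_zero_vec(1))
      with xk x show "x = 0\<^sub>v (Suc k)" by (intro eq_vecI) (auto simp: less_Suc_eq)
    qed
    then show False using kmax[of "Suc k"] by auto
  qed
  have kd: "k = sdim n U" using dim[OF B] sub by simp
  obtain L where "L \<in> carrier_mat k n" "L * B = 1\<^sub>m k"
    using left_inverse_of_injective[OF Bc] B by (auto simp: good_def)
  then show ?thesis using that[of B L] Bc sub unfolding kd by simp
qed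

lemma sdim_eq_full:
  assumes U: "lin_sub n U" and "sdim n U = n"
  shows "U = carrier_vec n"
proof -
  obtain B L where BL: "B \<in> carrier_mat n n" "L \<in> carrier_mat n n" "L * B = 1\<^sub>m n"
      "U = (\<lambda>x. B *\<^sub>v x) ` carrier_vec n"
    using lin_sub_frame[OF U] unfolding assms(2) by metis
  have BL1: "B * L = 1\<^sub>m n" by (rule mat_mult_left_right_inverse[OF BL(2,1,3)])
  have "v \<in> U" if v: "v \<in> carrier_vec n" for v
  proof -
    have "v = B * L *\<^sub>v v" using BL1 v by simp
    also have "\<dots> = B *\<^sub>v (L *\<^sub>v v)" using BL v by simp
    finally show ?thesis using BL(2,4) v by (metis imageI mult_mat_vec_carrier)
  qed
  then show ?thesis using U by (auto simp: lin_sub_iff)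
qed

lemma sdim_eq_zero:
  assumes U: "lin_sub n U" and "sdim n U = 0"
  shows "U = {0\<^sub>v n}"
proof -
  obtain B L where B: "B \<in> carrier_mat n 0" and "U = (\<lambda>x. B *\<^sub>v x) ` carrier_vec 0"
    using lin_sub_frame[OF U] unfolding assms(2) by metis
  moreover have "B *\<^sub>v x = 0\<^sub>v n" if "x \<in> carrier_vec 0" for x
    using that B by (intro eq_vecI) (auto simp: scalar_prod_def)
  ultimately have "U \<subseteq> {0\<^sub>v n}" by auto
  then show ?thesis using U by (auto simp: lin_sub_iff)
qed

text \<open>The pairing is bilinear, not Hermitian, so that transposed matrices are adjoint.\<close>

definition annihilator :: "nat \<Rightarrow> complex vec set \<Rightarrow> complex vec set" where
  "annihilator n U = {v \<in> carrier_vec n. \<forall>u\<in>U. u \<bullet> v = 0}"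

lemma annihilator:
  assumes U: "lin_sub n U"
  shows "lin_sub n (annihilator n U)" and "sdim n (annihilator n U) + sdim n U = n"
proof -
  define k where "k = sdim n U"
  obtain B L where BL: "B \<in> carrier_mat n k" "L \<in> carrier_mat k n" "L * B = 1\<^sub>m k"
      "U = (\<lambda>x. B *\<^sub>v x) ` carrier_vec k"
    using lin_sub_frame[OF U] unfolding k_def by metis
  have Bt: "transpose_mat B \<in> carrier_mat k n" and Lt: "transpose_mat L \<in> carrier_mat n k" using BL by auto
  have ann: "annihilator n U = {v \<in> carrier_vec n. transpose_mat B *\<^sub>v v = 0\<^sub>v k}"
  proof -
    have "(\<forall>u\<in>U. u \<bullet> v = 0) \<longleftrightarrow> transpose_mat B *\<^sub>v v = 0\<^sub>v k" if v: "v \<in> carrier_vec n" for v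
    proof -
      have eq: "(B *\<^sub>v x) \<bullet> v = (transpose_mat B *\<^sub>v v) \<bullet> x" if x: "x \<in> carrier_vec k" for x
      proof -
        have "(B *\<^sub>v x) \<bullet> v = v \<bullet> (B *\<^sub>v x)" using BL(1) x v by (intro comm_scalar_prod) auto
        then show ?thesis using transpose_vec_mult_scalar[OF BL(1) x v] by simp
      qed
      show ?thesis
      proof
        assume *: "\<forall>u\<in>U. u \<bullet> v = 0"
        show "transpose_mat B *\<^sub>v v = 0\<^sub>v k"
        proof (rule eq_vecI)
          fix i assume "i < dim_vec (0\<^sub>v k :: complex vec)"
          then have i: "i < k" by simp
          have "(transpose_mat B *\<^sub>v v) \<bullet> unit_vec k i = 0"
            using * eq[of "unit_vec k i"] BL(4) by auto
          moreover have "(transpose_mat B *\<^sub>v v) \<bullet> unit_vec k i = (transpose_mat B *\<^sub>v v) $ i"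
            using i Bt v by (intro scalar_prod_right_unit)
          ultimately show "(transpose_mat B *\<^sub>v v) $ i = 0\<^sub>v k $ i" using i by simp
        qed (use BL in auto)
      next
        assume "transpose_mat B *\<^sub>v v = 0\<^sub>v k"
        then show "\<forall>u\<in>U. u \<bullet> v = 0" using eq BL(4) by auto
      qed
    qed
    then show ?thesis by (auto simp: annihilator_def)
  qed
  show "lin_sub n (annihilator n U)" unfolding ann by (rule lin_sub_kernel[OF Bt lin_sub_carrier])
  have "(\<lambda>v. transpose_mat B *\<^sub>v v) ` carrier_vec n = carrier_vec k"
  proof -
    have tr: "transpose_mat B * transpose_mat L = 1\<^sub>m k"
      using BL by (metis transpose_mult transpose_one)
    have "y \<in> (\<lambda>v. transpose_mat B *\<^sub>v v) ` carrier_vec n" if y: "y \<in> carrier_vec k" for y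
    proof
      show "y = transpose_mat B *\<^sub>v (transpose_mat L *\<^sub>v y)"
        using assoc_mult_mat_vec[OF Bt Lt y] tr y by simp
    qed (use Lt y in auto)
    then show ?thesis using Bt by auto
  qed
  then show "sdim n (annihilator n U) + sdim n U = n"
    using rank_nullity_mat[OF Bt lin_sub_carrier] unfolding ann k_def[symmetric] by simp
qed

lemma right_inverse_of_surjective:
  fixes A :: "complex mat"
  assumes A: "A \<in> carrier_mat d n" and surj: "(\<lambda>v. A *\<^sub>v v) ` carrier_vec n = carrier_vec d"
  shows "\<exists>P\<in>carrier_mat n d. A * P = 1\<^sub>m d"
proof -
  have "\<forall>i. \<exists>v\<in>carrier_vec n. A *\<^sub>v v = unit_vec d i" using surj by (metis imageE unit_vec_carrier)
  then obtain f where f: "\<And>i. f i \<in> carrier_vec n" "\<And>i. A *\<^sub>v f i = unit_vec d i" by metis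
  define P where "P = mat n d (\<lambda>(r, c). f c $ r)"
  have "A * P = 1\<^sub>m d"
  proof (rule eq_matI)
    fix i j assume ij: "i < dim_row (1\<^sub>m d :: complex mat)" "j < dim_col (1\<^sub>m d :: complex mat)"
    have "col P j = f j" using f(1)[of j] ij by (intro eq_vecI) (auto simp: P_def)
    then have "(A * P) $$ (i, j) = (A *\<^sub>v f j) $ i" using ij A by (simp add: P_def)
    then show "(A * P) $$ (i, j) = 1\<^sub>m d $$ (i, j)" using f(2) ij by simp
  qed (use A in \<open>auto simp: P_def\<close>)
  then show ?thesis by (intro bexI[of _ P]) (auto simp: P_def)
qed


section \<open>Kernels and cokernels of matrices\<close>

lemma sum_atLeastLessThan_add:
  "(\<Sum>k = 0..<d + e. f k) = (\<Sum>k = 0..<d. f k) + (\<Sum>k = 0..<e. f (d + k :: nat))"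
  for f :: "nat \<Rightarrow> 'a :: comm_monoid_add"
  using sum.atLeastLessThan_concat[of 0 d "d + e" f] sum.shift_bounds_nat_ivl[of f 0 d e]
  by (simp add: add.commute)

definition stack_rows :: "complex mat \<Rightarrow> complex mat \<Rightarrow> complex mat" where
  "stack_rows A B = mat (dim_row A + dim_row B) (dim_col A)
     (\<lambda>(i, j). if i < dim_row A then A $$ (i, j) else B $$ (i - dim_row A, j))"

lemma stack_rows_carrier [simp]:
  "A \<in> carrier_mat d N \<Longrightarrow> B \<in> carrier_mat e N \<Longrightarrow> stack_rows A B \<in> carrier_mat (d + e) N"
  by (simp add: stack_rows_def)

lemma stack_rows_mult:
  assumes "A \<in> carrier_mat d N" "B \<in> carrier_mat e N" "X \<in> carrier_mat N c"
  shows "stack_rows A B * X = stack_rows (A * X) (B * X)"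
  using assms by (intro eq_matI) (auto simp: stack_rows_def scalar_prod_def)

text \<open>A right inverse \<open>P\<close> of \<open>\<Phi>\<close> can be corrected by the projection \<open>\<Psi> L\<close> so that \<open>L P' = 0\<close>. Then the
  square matrices \<open>(\<Phi>; L)\<close> and \<open>(P', \<Psi>)\<close> are inverse to each other, which is both the splitting of
  the sequence and the invertibility behind Cramer's rule below.\<close>

lemma split_exact:
  fixes \<Phi> P \<Psi> L :: "complex mat"
  assumes N: "N = d + e"
    and \<Phi>: "\<Phi> \<in> carrier_mat d N" and P: "P \<in> carrier_mat N d" and \<Phi>P: "\<Phi> * P = 1\<^sub>m d"
    and \<Psi>: "\<Psi> \<in> carrier_mat N e" and L: "L \<in> carrier_mat e N" and L\<Psi>: "L * \<Psi> = 1\<^sub>m e"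
    and \<Phi>\<Psi>: "\<Phi> * \<Psi> = 0\<^sub>m d e"
  obtains P' where "P' \<in> carrier_mat N d" "P' * \<Phi> + \<Psi> * L = 1\<^sub>m N" "det (stack_rows \<Phi> L) \<noteq> 0"
proof -
  define P' where "P' = P - \<Psi> * (L * P)"
  have P': "P' \<in> carrier_mat N d" unfolding P'_def using P \<Psi> L by (intro minus_carrier_mat mult_carrier_mat)
  have LP: "L * P \<in> carrier_mat e d" using L P by simp
  have \<Psi>LP: "\<Psi> * (L * P) \<in> carrier_mat N d" using \<Psi> LP by simp
  have "\<Phi> * (\<Psi> * (L * P)) = 0\<^sub>m d d"
    using assoc_mult_mat[OF \<Phi> \<Psi> LP] left_mult_zero_mat[OF LP, of d] unfolding \<Phi>\<Psi> by simp
  then have \<Phi>P': "\<Phi> * P' = 1\<^sub>m d"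
    unfolding P'_def mult_minus_distrib_mat[OF \<Phi> P \<Psi>LP] using \<Phi>P by (auto intro!: eq_matI)
  have "L * (\<Psi> * (L * P)) = L * P"
    using assoc_mult_mat[OF L \<Psi> LP] left_mult_one_mat[OF LP] unfolding L\<Psi> by simp
  then have LP': "L * P' = 0\<^sub>m e d"
    unfolding P'_def mult_minus_distrib_mat[OF L P \<Psi>LP] using LP by auto
  define M where "M = stack_rows \<Phi> L"
  define M' where "M' = mat N N (\<lambda>(i, j). if j < d then P' $$ (i, j) else \<Psi> $$ (i, j - d))"
  have M: "M \<in> carrier_mat N N" using \<Phi> L N by (simp add: M_def)
  have M': "M' \<in> carrier_mat N N" by (simp add: M'_def)
  have MM': "M * M' = 1\<^sub>m N"
  proof (rule eq_matI)
    fix i j assume ij: "i < dim_row (1\<^sub>m N :: complex mat)" "j < dim_col (1\<^sub>m N :: complex mat)"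
    have prod: "(M * M') $$ (i, j) =
      (if i < d then if j < d then (\<Phi> * P') $$ (i, j) else (\<Phi> * \<Psi>) $$ (i, j - d)
       else if j < d then (L * P') $$ (i - d, j) else (L * \<Psi>) $$ (i - d, j - d))"
      using ij \<Phi> L P' \<Psi> N by (auto simp: M_def M'_def stack_rows_def scalar_prod_def)
    show "(M * M') $$ (i, j) = 1\<^sub>m N $$ (i, j)"
      unfolding prod \<Phi>P' \<Phi>\<Psi> LP' L\<Psi> using ij N by auto
  qed (use M M' in auto)
  have M'M: "M' * M = 1\<^sub>m N" by (rule mat_mult_left_right_inverse[OF M M' MM'])
  have "P' * \<Phi> + \<Psi> * L = M' * M"
  proof (rule eq_matI)
    fix i j assume "i < dim_row (M' * M)" "j < dim_col (M' * M)"
    then have ij: "i < N" "j < N" using M M' by auto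
    have "(M' * M) $$ (i, j) = (\<Sum>k = 0..<d + e. M' $$ (i, k) * M $$ (k, j))"
      using ij M M' N by (auto simp: scalar_prod_def)
    also have "\<dots> = (\<Sum>k = 0..<d. P' $$ (i, k) * \<Phi> $$ (k, j)) + (\<Sum>k = 0..<e. \<Psi> $$ (i, k) * L $$ (k, j))"
      unfolding sum_atLeastLessThan_add
      using ij \<Phi> L N by (intro arg_cong2[where f="(+)"] sum.cong) (auto simp: M_def M'_def stack_rows_def)
    also have "\<dots> = (P' * \<Phi> + \<Psi> * L) $$ (i, j)"
      using ij \<Phi> L P' \<Psi> by (auto simp: scalar_prod_def)
    finally show "(P' * \<Phi> + \<Psi> * L) $$ (i, j) = (M' * M) $$ (i, j)" by simp
  qed (use M M' \<Phi> L P' \<Psi> in auto)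
  moreover have "det M \<noteq> 0" using det_mult[OF M M'] MM' by auto
  ultimately show ?thesis using that P' M'M unfolding M_def by metis
qed

lemma kernel_matrix_factors:
  fixes \<Phi> P \<Psi> L :: "complex mat"
  assumes N: "N = d + e"
    and \<Phi>: "\<Phi> \<in> carrier_mat d N" and P: "P \<in> carrier_mat N d" and \<Phi>P: "\<Phi> * P = 1\<^sub>m d"
    and \<Psi>: "\<Psi> \<in> carrier_mat N e" and L: "L \<in> carrier_mat e N" and L\<Psi>: "L * \<Psi> = 1\<^sub>m e"
    and \<Phi>\<Psi>: "\<Phi> * \<Psi> = 0\<^sub>m d e"
    and X: "X \<in> carrier_mat N c" and \<Phi>X: "\<Phi> * X = 0\<^sub>m d c"
  shows "X = \<Psi> * (L * X)"
proof -
  obtain P' where P': "P' \<in> carrier_mat N d" and eq: "P' * \<Phi> + \<Psi> * L = 1\<^sub>m N"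
    using split_exact[OF assms(1-8)] by blast
  have "X = (P' * \<Phi> + \<Psi> * L) * X" using eq X by simp
  also have "\<dots> = P' * \<Phi> * X + \<Psi> * L * X"
    using P' \<Phi> \<Psi> L X by (intro add_mult_distrib_mat) auto
  also have "P' * \<Phi> * X = 0\<^sub>m N c" using assoc_mult_mat[OF P' \<Phi> X] \<Phi>X P' by simp
  also have "\<Psi> * L * X = \<Psi> * (L * X)" by (rule assoc_mult_mat[OF \<Psi> L X])
  also have "0\<^sub>m N c + \<Psi> * (L * X) = \<Psi> * (L * X)" using \<Psi> L X by (intro left_add_zero_mat) auto
  finally show ?thesis .
qed

lemma kernel_vector_factors:
  fixes \<Phi> P \<Psi> L :: "complex mat"
  assumes N: "N = d + e"
    and \<Phi>: "\<Phi> \<in> carrier_mat d N" and P: "P \<in> carrier_mat N d" and \<Phi>P: "\<Phi> * P = 1\<^sub>m d"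
    and \<Psi>: "\<Psi> \<in> carrier_mat N e" and L: "L \<in> carrier_mat e N" and L\<Psi>: "L * \<Psi> = 1\<^sub>m e"
    and \<Phi>\<Psi>: "\<Phi> * \<Psi> = 0\<^sub>m d e"
    and x: "x \<in> carrier_vec N" and \<Phi>x: "\<Phi> *\<^sub>v x = 0\<^sub>v d"
  shows "x = \<Psi> *\<^sub>v (L *\<^sub>v x)"
proof -
  obtain P' where P': "P' \<in> carrier_mat N d" and eq: "P' * \<Phi> + \<Psi> * L = 1\<^sub>m N"
    using split_exact[OF assms(1-8)] by blast
  have "x = (P' * \<Phi> + \<Psi> * L) *\<^sub>v x" using eq x by simp
  also have "\<dots> = P' * \<Phi> *\<^sub>v x + \<Psi> * L *\<^sub>v x"
    using P' \<Phi> \<Psi> L x by (intro add_mult_distrib_mat_vec[of _ N N]) auto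
  also have "P' * \<Phi> *\<^sub>v x = 0\<^sub>v N" using assoc_mult_mat_vec[OF P' \<Phi> x] \<Phi>x P' by auto
  also have "\<Psi> * L *\<^sub>v x = \<Psi> *\<^sub>v (L *\<^sub>v x)" by (rule assoc_mult_mat_vec[OF \<Psi> L x])
  also have "0\<^sub>v N + \<Psi> *\<^sub>v (L *\<^sub>v x) = \<Psi> *\<^sub>v (L *\<^sub>v x)" using \<Psi> L x by (intro left_zero_vec) auto
  finally show ?thesis .
qed

text \<open>Two bases of the same kernel differ by an invertible matrix, so the reflections of one
  representation form a single orbit of base changes at the sink.\<close>

lemma kernel_matrix_unique:
  fixes \<Phi> P \<Psi> L :: "complex mat"
  assumes N: "N = d + e"
    and \<Phi>: "\<Phi> \<in> carrier_mat d N" and P: "P \<in> carrier_mat N d" and \<Phi>P: "\<Phi> * P = 1\<^sub>m d"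
    and \<Psi>: "\<Psi> \<in> carrier_mat N e" and L: "L \<in> carrier_mat e N" and L\<Psi>: "L * \<Psi> = 1\<^sub>m e"
    and \<Phi>\<Psi>: "\<Phi> * \<Psi> = 0\<^sub>m d e"
    and \<Psi>': "\<Psi>' \<in> carrier_mat N e" and L': "L' \<in> carrier_mat e N" and L\<Psi>': "L' * \<Psi>' = 1\<^sub>m e"
    and \<Phi>\<Psi>': "\<Phi> * \<Psi>' = 0\<^sub>m d e"
  shows "\<exists>g\<in>carrier_mat e e. \<exists>h\<in>carrier_mat e e. g * h = 1\<^sub>m e \<and> h * g = 1\<^sub>m e \<and> \<Psi>' = \<Psi> * g"
proof -
  have g: "L * \<Psi>' \<in> carrier_mat e e" and h: "L' * \<Psi> \<in> carrier_mat e e" using L L' \<Psi> \<Psi>' by auto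
  have 1: "\<Psi>' = \<Psi> * (L * \<Psi>')" by (rule kernel_matrix_factors[OF assms(1-8) \<Psi>' \<Phi>\<Psi>'])
  have 2: "\<Psi> = \<Psi>' * (L' * \<Psi>)" by (rule kernel_matrix_factors[OF assms(1-4) \<Psi>' L' L\<Psi>' \<Phi>\<Psi>' \<Psi> \<Phi>\<Psi>])
  have "L' * \<Psi> * (L * \<Psi>') = L' * (\<Psi> * (L * \<Psi>'))" by (rule assoc_mult_mat[OF L' \<Psi> g])
  then have hg: "L' * \<Psi> * (L * \<Psi>') = 1\<^sub>m e" using 1 L\<Psi>' by simp
  then have "L * \<Psi>' * (L' * \<Psi>) = 1\<^sub>m e" by (rule mat_mult_left_right_inverse[OF h g])
  with hg 1 g h show ?thesis by blast
qed

lemma kernel_matrix_exists: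
  fixes \<Phi> P :: "complex mat"
  assumes N: "N = d + e"
    and \<Phi>: "\<Phi> \<in> carrier_mat d N" and P: "P \<in> carrier_mat N d" and \<Phi>P: "\<Phi> * P = 1\<^sub>m d"
  obtains \<Psi> L where "\<Psi> \<in> carrier_mat N e" "L \<in> carrier_mat e N" "L * \<Psi> = 1\<^sub>m e" "\<Phi> * \<Psi> = 0\<^sub>m d e"
proof -
  define K where "K = {u \<in> carrier_vec N. \<Phi> *\<^sub>v u = 0\<^sub>v d}"
  have K: "lin_sub N K" unfolding K_def by (rule lin_sub_kernel[OF \<Phi> lin_sub_carrier])
  have "v \<in> (\<lambda>u. \<Phi> *\<^sub>v u) ` carrier_vec N" if v: "v \<in> carrier_vec d" for v
  proof
    show "v = \<Phi> *\<^sub>v (P *\<^sub>v v)" using assoc_mult_mat_vec[OF \<Phi> P v] \<Phi>P v by simp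
  qed (use P v in auto)
  then have im: "(\<lambda>u. \<Phi> *\<^sub>v u) ` carrier_vec N = carrier_vec d" using \<Phi> by auto
  have dK: "sdim N K = e"
    using rank_nullity_mat[OF \<Phi> lin_sub_carrier] unfolding K_def im by (simp add: N)
  obtain B L where B: "B \<in> carrier_mat N e" and L: "L \<in> carrier_mat e N" "L * B = 1\<^sub>m e"
    and KB: "K = (\<lambda>x. B *\<^sub>v x) ` carrier_vec e"
    using lin_sub_frame[OF K] unfolding dK by metis
  have "\<Phi> * B = 0\<^sub>m d e"
  proof (rule mat_eq_by_vec[of _ d e])
    fix v :: "complex vec" assume v: "v \<in> carrier_vec e"
    then have "B *\<^sub>v v \<in> K" using KB by blast
    then show "\<Phi> * B *\<^sub>v v = 0\<^sub>m d e *\<^sub>v v"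
      using v assoc_mult_mat_vec[OF \<Phi> B v] by (auto simp: K_def)
  qed (use \<Phi> B in auto)
  then show ?thesis using that B L by blast
qed


lemma transpose_eq_one: "A * B = 1\<^sub>m k \<Longrightarrow> A \<in> carrier_mat k n \<Longrightarrow> B \<in> carrier_mat n k \<Longrightarrow>
    transpose_mat B * transpose_mat A = 1\<^sub>m k" for A B :: "complex mat"
  by (metis transpose_mult transpose_one)

lemma transpose_eq_zero: "A * B = 0\<^sub>m r c \<Longrightarrow> A \<in> carrier_mat r n \<Longrightarrow> B \<in> carrier_mat n c \<Longrightarrow>
    transpose_mat B * transpose_mat A = 0\<^sub>m c r" for A B :: "complex mat"
  by (metis transpose_mult zero_transpose_mat)

text \<open>Cokernels are kernels of transposed matrices.\<close>

lemma cokernel_matrix_unique: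
  fixes \<Phi> \<Phi>' P P' \<Psi> L :: "complex mat"
  assumes N: "N = d + e"
    and \<Psi>: "\<Psi> \<in> carrier_mat N e" and L: "L \<in> carrier_mat e N" and L\<Psi>: "L * \<Psi> = 1\<^sub>m e"
    and \<Phi>: "\<Phi> \<in> carrier_mat d N" and P: "P \<in> carrier_mat N d" and \<Phi>P: "\<Phi> * P = 1\<^sub>m d"
    and \<Phi>\<Psi>: "\<Phi> * \<Psi> = 0\<^sub>m d e"
    and \<Phi>': "\<Phi>' \<in> carrier_mat d N" and P': "P' \<in> carrier_mat N d" and \<Phi>P': "\<Phi>' * P' = 1\<^sub>m d"
    and \<Phi>\<Psi>': "\<Phi>' * \<Psi> = 0\<^sub>m d e"
  shows "\<exists>g\<in>carrier_mat d d. \<exists>h\<in>carrier_mat d d. g * h = 1\<^sub>m d \<and> h * g = 1\<^sub>m d \<and> \<Phi>' = g * \<Phi>"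
proof -
  have N': "N = e + d" using N by simp
  obtain g h where gh: "g \<in> carrier_mat d d" "h \<in> carrier_mat d d" "g * h = 1\<^sub>m d" "h * g = 1\<^sub>m d"
      "transpose_mat \<Phi>' = transpose_mat \<Phi> * g"
    using kernel_matrix_unique[OF N', of "transpose_mat \<Psi>" "transpose_mat L" "transpose_mat \<Phi>" "transpose_mat P"
        "transpose_mat \<Phi>'" "transpose_mat P'"] assms
      transpose_eq_one[OF L\<Psi> L \<Psi>] transpose_eq_one[OF \<Phi>P \<Phi> P] transpose_eq_one[OF \<Phi>P' \<Phi>' P']
      transpose_eq_zero[OF \<Phi>\<Psi> \<Phi> \<Psi>] transpose_eq_zero[OF \<Phi>\<Psi>' \<Phi>' \<Psi>]
    by (auto simp: transpose_carrier_mat)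
  have "\<Phi>' = transpose_mat (transpose_mat \<Phi> * g)" using gh(5) by (metis transpose_transpose)
  also have "\<dots> = transpose_mat g * \<Phi>" using transpose_mult[of "transpose_mat \<Phi>" N d g d] \<Phi> gh(1) by simp
  finally have "\<Phi>' = transpose_mat g * \<Phi>" .
  moreover have "transpose_mat g \<in> carrier_mat d d" "transpose_mat h \<in> carrier_mat d d" using gh by auto
  moreover have "transpose_mat g * transpose_mat h = 1\<^sub>m d" "transpose_mat h * transpose_mat g = 1\<^sub>m d"
    using transpose_eq_one gh by blast+
  ultimately show ?thesis by blast
qed

lemma cokernel_matrix_exists:
  fixes \<Psi> L :: "complex mat"
  assumes N: "N = d + e"
    and \<Psi>: "\<Psi> \<in> carrier_mat N e" and L: "L \<in> carrier_mat e N" and L\<Psi>: "L * \<Psi> = 1\<^sub>m e"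
  obtains \<Phi> P where "\<Phi> \<in> carrier_mat d N" "P \<in> carrier_mat N d" "\<Phi> * P = 1\<^sub>m d" "\<Phi> * \<Psi> = 0\<^sub>m d e"
proof -
  have N': "N = e + d" using N by simp
  have t: "transpose_mat \<Psi> \<in> carrier_mat e N" "transpose_mat L \<in> carrier_mat N e" using \<Psi> L by auto
  obtain B C where B: "B \<in> carrier_mat N d" and C: "C \<in> carrier_mat d N" and CB: "C * B = 1\<^sub>m d"
    and BP: "transpose_mat \<Psi> * B = 0\<^sub>m e d"
    by (rule kernel_matrix_exists[OF N' t transpose_eq_one[OF L\<Psi> L \<Psi>]])
  have "transpose_mat B * \<Psi> = 0\<^sub>m d e" using transpose_eq_zero[OF BP t(1) B] by simp
  then show ?thesis
    using that[of "transpose_mat B" "transpose_mat C"] B C transpose_eq_one[OF CB C B] by simp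
qed


section \<open>Kernels of matrices of functions\<close>

locale function_algebra =
  fixes A :: "('t \<Rightarrow> complex) set"
  assumes const: "(\<lambda>_. c) \<in> A"
    and add: "f \<in> A \<Longrightarrow> g \<in> A \<Longrightarrow> (\<lambda>t. f t + g t) \<in> A"
    and mult: "f \<in> A \<Longrightarrow> g \<in> A \<Longrightarrow> (\<lambda>t. f t * g t) \<in> A"
begin

lemma sum: "(\<And>i. i \<in> K \<Longrightarrow> f i \<in> A) \<Longrightarrow> (\<lambda>t. \<Sum>i\<in>K. f i t) \<in> A"
  by (induction K rule: infinite_finite_induct) (auto intro: const add)

lemma prod: "(\<And>i. i \<in> K \<Longrightarrow> f i \<in> A) \<Longrightarrow> (\<lambda>t. \<Prod>i\<in>K. f i t) \<in> A"
  by (induction K rule: infinite_finite_induct) (auto intro: const mult)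

lemma det:
  assumes "\<And>t. M t \<in> carrier_mat n n" "\<And>i j. i < n \<Longrightarrow> j < n \<Longrightarrow> (\<lambda>t. M t $$ (i, j)) \<in> A"
  shows "(\<lambda>t. det (M t)) \<in> A"
  unfolding det_def'[OF assms(1)]
  by (intro sum mult const prod assms(2)) (auto dest: permutes_in_image)

lemma adj_mat:
  assumes M: "\<And>t. M t \<in> carrier_mat n n" and MA: "\<And>i j. i < n \<Longrightarrow> j < n \<Longrightarrow> (\<lambda>t. M t $$ (i, j)) \<in> A"
    and ij: "i < n" "j < n"
  shows "(\<lambda>t. adj_mat (M t) $$ (i, j)) \<in> A"
proof -
  have "(\<lambda>t. adj_mat (M t) $$ (i, j)) = (\<lambda>t. (- 1) ^ (j + i) * det (mat_delete (M t) j i))"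
    using M ij by (auto simp: adj_mat_def cofactor_def carrier_matD[OF M])
  also have "\<dots> \<in> A"
  proof (intro mult const det[where n="n - 1"])
    show "mat_delete (M t) j i \<in> carrier_mat (n - 1) (n - 1)" for t
      using M by (intro mat_delete_carrier)
    fix a b assume ab: "a < n - 1" "b < n - 1"
    have "(\<lambda>t. mat_delete (M t) j i $$ (a, b)) =
        (\<lambda>t. M t $$ (if a < j then a else Suc a, if b < i then b else Suc b))"
      using ab by (auto simp: mat_delete_def carrier_matD[OF M])
    also have "\<dots> \<in> A" using ab by (intro MA) auto
    finally show "(\<lambda>t. mat_delete (M t) j i $$ (a, b)) \<in> A" .
  qed
  finally show ?thesis .
qed

text \<open>A kernel basis \<open>\<Psi>\<close> at one parameter \<open>t0\<close> extends to nearby parameters: normalise by the left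
  inverse \<open>L\<close> of \<open>\<Psi>\<close> and solve \<open>\<Phi> S = 0\<close>, \<open>L S = 1\<close> by Cramer's rule. The common denominator is the
  determinant of \<open>(\<Phi>; L)\<close>.\<close>

lemma kernel_section:
  assumes N: "N = d + e"
    and \<Phi>: "\<And>t. \<Phi> t \<in> carrier_mat d N"
    and \<Phi>A: "\<And>i j. i < d \<Longrightarrow> j < N \<Longrightarrow> (\<lambda>t. \<Phi> t $$ (i, j)) \<in> A"
    and P: "P \<in> carrier_mat N d" and \<Phi>P: "\<Phi> t0 * P = 1\<^sub>m d"
    and \<Psi>: "\<Psi> \<in> carrier_mat N e" and L: "L \<in> carrier_mat e N" and L\<Psi>: "L * \<Psi> = 1\<^sub>m e"
    and \<Phi>\<Psi>: "\<Phi> t0 * \<Psi> = 0\<^sub>m d e"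
  obtains D S where "D \<in> A" "D t0 \<noteq> 0" "S t0 = \<Psi>" "\<And>t. S t \<in> carrier_mat N e"
    "\<And>t. D t \<noteq> 0 \<Longrightarrow> \<Phi> t * S t = 0\<^sub>m d e" "\<And>t. D t \<noteq> 0 \<Longrightarrow> L * S t = 1\<^sub>m e"
    "\<And>i j. i < N \<Longrightarrow> j < e \<Longrightarrow> \<exists>a\<in>A. \<forall>t. S t $$ (i, j) = a t / D t"
proof -
  define M where "M t = stack_rows (\<Phi> t) L" for t
  define D where "D t = det (M t)" for t
  \<comment> \<open>the last \<open>e\<close> columns of the inverse of \<open>M t\<close>\<close>
  define S where "S t = mat N e (\<lambda>(i, j). adj_mat (M t) $$ (i, d + j) / D t)" for t
  have M: "M t \<in> carrier_mat N N" for t using \<Phi> L N by (simp add: M_def)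
  have S: "S t \<in> carrier_mat N e" for t by (simp add: S_def)
  have MA: "(\<lambda>t. M t $$ (i, j)) \<in> A" if "i < N" "j < N" for i j
  proof (cases "i < d")
    case True
    then have "(\<lambda>t. M t $$ (i, j)) = (\<lambda>t. \<Phi> t $$ (i, j))"
      using that L N by (auto simp: M_def stack_rows_def carrier_matD[OF \<Phi>])
    then show ?thesis using \<Phi>A True that by simp
  next
    case False
    then have "(\<lambda>t. M t $$ (i, j)) = (\<lambda>t. L $$ (i - d, j))"
      using that L N by (auto simp: M_def stack_rows_def carrier_matD[OF \<Phi>])
    then show ?thesis using const by simp
  qed
  have DA: "D \<in> A" unfolding D_def by (rule det[OF M MA])
  have D0: "D t0 \<noteq> 0"
    unfolding D_def M_def by (rule split_exact[OF N \<Phi> P \<Phi>P \<Psi> L L\<Psi> \<Phi>\<Psi>])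
  have MS: "(M t * S t) $$ (i, j) = (if i = d + j then 1 else 0)" if "D t \<noteq> 0" "i < N" "j < e" for t i j
  proof -
    have "(M t * S t) $$ (i, j) = (M t * adj_mat (M t)) $$ (i, d + j) / D t"
      using that N M[of t] Determinant.adj_mat(1)[OF M[of t]]
      by (auto simp: S_def scalar_prod_def sum_divide_distrib)
    also have "\<dots> = (if i = d + j then 1 else 0)"
      unfolding Determinant.adj_mat(2)[OF M] using that N by (auto simp: D_def)
    finally show ?thesis .
  qed
  have st: "M t * S t = stack_rows (\<Phi> t * S t) (L * S t)" for t
    unfolding M_def by (rule stack_rows_mult[OF \<Phi> L S])
  have \<Phi>S: "\<Phi> t * S t = 0\<^sub>m d e" if "D t \<noteq> 0" for t
  proof (rule eq_matI)
    fix i j assume "i < dim_row (0\<^sub>m d e :: complex mat)" "j < dim_col (0\<^sub>m d e :: complex mat)"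
    then have ij: "i < d" "j < e" by auto
    have "(\<Phi> t * S t) $$ (i, j) = (M t * S t) $$ (i, j)"
      unfolding st using ij L by (auto simp: stack_rows_def carrier_matD[OF \<Phi>] carrier_matD[OF S])
    then show "(\<Phi> t * S t) $$ (i, j) = 0\<^sub>m d e $$ (i, j)" using MS[OF that] ij N by simp
  qed (use carrier_matD[OF \<Phi>] carrier_matD[OF S] in auto)
  have LS: "L * S t = 1\<^sub>m e" if "D t \<noteq> 0" for t
  proof (rule eq_matI)
    fix i j assume "i < dim_row (1\<^sub>m e :: complex mat)" "j < dim_col (1\<^sub>m e :: complex mat)"
    then have ij: "i < e" "j < e" by auto
    have "(L * S t) $$ (i, j) = (M t * S t) $$ (d + i, j)"
      unfolding st using ij L by (auto simp: stack_rows_def carrier_matD[OF \<Phi>] carrier_matD[OF S])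
    then show "(L * S t) $$ (i, j) = 1\<^sub>m e $$ (i, j)" using MS[OF that] ij N by simp
  qed (use L carrier_matD[OF S] in auto)
  have "S t0 = \<Psi> * (L * S t0)"
    by (rule kernel_matrix_factors[OF N \<Phi> P \<Phi>P \<Psi> L L\<Psi> \<Phi>\<Psi> S \<Phi>S[OF D0]])
  then have S0: "S t0 = \<Psi>" using LS[OF D0] \<Psi> by simp
  show ?thesis
  proof (rule that[OF DA D0 S0 S \<Phi>S LS])
    fix i j assume ij: "i < N" "j < e"
    have "(\<lambda>t. adj_mat (M t) $$ (i, d + j)) \<in> A" by (rule adj_mat[OF M MA]) (use ij N in auto)
    moreover have "\<forall>t. S t $$ (i, j) = adj_mat (M t) $$ (i, d + j) / D t" using ij by (simp add: S_def)
    ultimately show "\<exists>a\<in>A. \<forall>t. S t $$ (i, j) = a t / D t"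
      by (rule bexI[of _ "\<lambda>t. adj_mat (M t) $$ (i, d + j)", rotated])
  qed
qed

end

lemma (in function_algebra) cokernel_section:
  assumes N: "N = d + e"
    and \<Psi>: "\<And>t. \<Psi> t \<in> carrier_mat N e"
    and \<Psi>A: "\<And>i j. i < N \<Longrightarrow> j < e \<Longrightarrow> (\<lambda>t. \<Psi> t $$ (i, j)) \<in> A"
    and L: "L \<in> carrier_mat e N" and L\<Psi>: "L * \<Psi> t0 = 1\<^sub>m e"
    and \<Phi>: "\<Phi> \<in> carrier_mat d N" and P: "P \<in> carrier_mat N d" and \<Phi>P: "\<Phi> * P = 1\<^sub>m d"
    and \<Phi>\<Psi>: "\<Phi> * \<Psi> t0 = 0\<^sub>m d e"
  obtains D S where "D \<in> A" "D t0 \<noteq> 0" "S t0 = \<Phi>" "\<And>t. S t \<in> carrier_mat d N"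
    "\<And>t. D t \<noteq> 0 \<Longrightarrow> S t * \<Psi> t = 0\<^sub>m d e" "\<And>t. D t \<noteq> 0 \<Longrightarrow> S t * P = 1\<^sub>m d"
    "\<And>i j. i < d \<Longrightarrow> j < N \<Longrightarrow> \<exists>a\<in>A. \<forall>t. S t $$ (i, j) = a t / D t"
proof -
  have N': "N = e + d" using N by simp
  have t: "transpose_mat (\<Psi> t) \<in> carrier_mat e N" for t using \<Psi> by simp
  have tA: "(\<lambda>t. transpose_mat (\<Psi> t) $$ (i, j)) \<in> A" if "i < e" "j < N" for i j
  proof -
    have "(\<lambda>t. transpose_mat (\<Psi> t) $$ (i, j)) = (\<lambda>t. \<Psi> t $$ (j, i))"
      using that by (simp add: carrier_matD[OF \<Psi>])
    then show ?thesis using \<Psi>A that by simp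
  qed
  have c: "transpose_mat L \<in> carrier_mat N e" "transpose_mat \<Phi> \<in> carrier_mat N d" "transpose_mat P \<in> carrier_mat d N"
    using L \<Phi> P by auto
  obtain D S where D: "D \<in> A" "D t0 \<noteq> 0" and S0: "S t0 = transpose_mat \<Phi>" and S: "\<And>t. S t \<in> carrier_mat N d"
    and S1: "\<And>t. D t \<noteq> 0 \<Longrightarrow> transpose_mat (\<Psi> t) * S t = 0\<^sub>m e d"
    and S2: "\<And>t. D t \<noteq> 0 \<Longrightarrow> transpose_mat P * S t = 1\<^sub>m d"
    and S3: "\<And>i j. i < N \<Longrightarrow> j < d \<Longrightarrow> \<exists>a\<in>A. \<forall>t. S t $$ (i, j) = a t / D t"
    by (rule kernel_section[OF N' t tA c(1) transpose_eq_one[OF L\<Psi> L \<Psi>] c(2,3) transpose_eq_one[OF \<Phi>P \<Phi> P]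
      transpose_eq_zero[OF \<Phi>\<Psi> \<Phi> \<Psi>]]) (assumption+, rule that)
  show ?thesis
  proof (rule that[of D "\<lambda>t. transpose_mat (S t)"])
    show "transpose_mat (S t0) = \<Phi>" by (simp add: S0)
    show "transpose_mat (S t) \<in> carrier_mat d N" for t using S by simp
    show "transpose_mat (S t) * \<Psi> t = 0\<^sub>m d e" if "D t \<noteq> 0" for t
      using transpose_eq_zero[OF S1[OF that] t S] by simp
    show "transpose_mat (S t) * P = 1\<^sub>m d" if "D t \<noteq> 0" for t
      using transpose_eq_one[OF S2[OF that] c(3) S] by simp
    show "\<exists>a\<in>A. \<forall>t. transpose_mat (S t) $$ (i, j) = a t / D t" if "i < d" "j < N" for i j
      using S3[OF that(2,1)] that by (simp add: carrier_matD[OF S])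
  qed (use D in auto)
qed


section \<open>Block matrices\<close>

text \<open>The space \<open>\<complex>\<^sup>N\<close> as the direct sum of summands of dimension \<open>n a\<close> for \<open>a \<in> K\<close>.
  Matrices are indexed by natural numbers, so an arbitrary bijection \<open>idx\<close> from the coordinates
  below \<open>N\<close> to the pairs \<open>(a, s)\<close> is chosen.\<close>

locale blocks =
  fixes K :: "'a set" and n :: "'a \<Rightarrow> nat"
  assumes finite_K: "finite K"
begin

definition N :: nat where "N = (\<Sum>a\<in>K. n a)"

definition idx :: "nat \<Rightarrow> 'a \<times> nat" where
  "idx = (SOME f. bij_betw f {..<N} (SIGMA a:K. {..<n a}))"

definition pos :: "'a \<Rightarrow> nat \<Rightarrow> nat" where
  "pos a s = inv_into {..<N} idx (a, s)"

lemma bij_idx: "bij_betw idx {..<N} (SIGMA a:K. {..<n a})"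
proof -
  have "card {..<N} = card (SIGMA a:K. {..<n a})"
    using finite_K by (simp add: N_def)
  then have "\<exists>f. bij_betw f {..<N} (SIGMA a:K. {..<n a})"
    using finite_K by (intro finite_same_card_bij) auto
  then show ?thesis unfolding idx_def by (rule someI_ex)
qed

lemma idx_pos: "a \<in> K \<Longrightarrow> s < n a \<Longrightarrow> idx (pos a s) = (a, s)"
  and pos_less: "a \<in> K \<Longrightarrow> s < n a \<Longrightarrow> pos a s < N"
proof -
  assume as: "a \<in> K" "s < n a"
  then have "(a, s) \<in> idx ` {..<N}" using bij_idx unfolding bij_betw_def by simp
  then show "idx (pos a s) = (a, s)" "pos a s < N"
    unfolding pos_def using f_inv_into_f[of "(a, s)" idx "{..<N}"] inv_into_into[of "(a, s)" idx "{..<N}"]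
    by (simp_all del: inv_into_into)
qed

lemma idx_mem: "c < N \<Longrightarrow> fst (idx c) \<in> K" "c < N \<Longrightarrow> snd (idx c) < n (fst (idx c))"
  using bij_betw_apply[OF bij_idx, of c] by auto

lemma pos_idx: "c < N \<Longrightarrow> pos (fst (idx c)) (snd (idx c)) = c"
  unfolding pos_def using bij_idx by (simp add: bij_betw_def inv_into_f_f)

lemma sum_idx:
  "(\<Sum>c = 0..<N. f (fst (idx c)) (snd (idx c))) = (\<Sum>a\<in>K. \<Sum>s = 0..<n a. f a s)"
  for f :: "'a \<Rightarrow> nat \<Rightarrow> complex"
proof -
  have "(\<Sum>c\<in>{..<N}. case_prod f (idx c)) = (\<Sum>p\<in>(SIGMA a:K. {..<n a}). case_prod f p)"
    by (rule sum.reindex_bij_betw[OF bij_idx])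
  also have "\<dots> = (\<Sum>a\<in>K. \<Sum>s\<in>{..<n a}. f a s)"
    using finite_K by (subst sum.Sigma) auto
  finally show ?thesis by (simp add: case_prod_unfold lessThan_atLeast0)
qed

text \<open>The projection of \<open>\<complex>\<^sup>N\<close> onto the summand with index \<open>a\<close>; its transpose is the inclusion.\<close>

definition sel :: "'a \<Rightarrow> complex mat" where
  "sel a = mat (n a) N (\<lambda>(s, c). if c = pos a s then 1 else 0)"

definition row_blocks :: "nat \<Rightarrow> ('a \<Rightarrow> complex mat) \<Rightarrow> complex mat" where
  "row_blocks r A = mat r N (\<lambda>(i, c). A (fst (idx c)) $$ (i, snd (idx c)))"

definition col_blocks :: "nat \<Rightarrow> ('a \<Rightarrow> complex mat) \<Rightarrow> complex mat" where
  "col_blocks k B = mat N k (\<lambda>(c, j). B (fst (idx c)) $$ (snd (idx c), j))"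

lemma carriers [simp]: "sel a \<in> carrier_mat (n a) N" "row_blocks r A \<in> carrier_mat r N"
    "col_blocks k B \<in> carrier_mat N k"
  by (auto simp: sel_def row_blocks_def col_blocks_def)

lemma sel_vec: "a \<in> K \<Longrightarrow> x \<in> carrier_vec N \<Longrightarrow> s < n a \<Longrightarrow> (sel a *\<^sub>v x) $ s = x $ pos a s"
  using pos_less[of a s] by (simp add: sel_def scalar_prod_def if_distrib[of "\<lambda>x. x * _"] cong: if_cong)

lemma sel_mat: "a \<in> K \<Longrightarrow> M \<in> carrier_mat N k \<Longrightarrow> s < n a \<Longrightarrow> j < k \<Longrightarrow> (sel a * M) $$ (s, j) = M $$ (pos a s, j)"
  using pos_less[of a s] by (simp add: sel_def scalar_prod_def if_distrib[of "\<lambda>x. x * _"] cong: if_cong)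

lemma mat_sel: "a \<in> K \<Longrightarrow> M \<in> carrier_mat r N \<Longrightarrow> i < r \<Longrightarrow> s < n a \<Longrightarrow>
    (M * transpose_mat (sel a)) $$ (i, s) = M $$ (i, pos a s)"
  using pos_less[of a s] by (simp add: sel_def scalar_prod_def if_distrib[of "\<lambda>x. _ * x"] cong: if_cong)

lemma vec_eq_blocks:
  assumes x: "x \<in> carrier_vec N" and y: "y \<in> carrier_vec N"
    and eq: "\<And>a. a \<in> K \<Longrightarrow> sel a *\<^sub>v x = sel a *\<^sub>v y"
  shows "x = y"
proof (rule eq_vecI)
  fix c assume "c < dim_vec y"
  then have c: "c < N" using y by simp
  show "x $ c = y $ c"
    using sel_vec[OF idx_mem(1)[OF c] x idx_mem(2)[OF c]] sel_vec[OF idx_mem(1)[OF c] y idx_mem(2)[OF c]]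
      eq[OF idx_mem(1)[OF c]] pos_idx[OF c] by simp
qed (use x y in simp)

lemma sel_col_blocks:
  assumes "a \<in> K" "B a \<in> carrier_mat (n a) k"
  shows "sel a * col_blocks k B = B a"
proof (rule eq_matI)
  fix s j assume sj: "s < dim_row (B a)" "j < dim_col (B a)"
  then have sj': "s < n a" "j < k" using assms by auto
  have "(sel a * col_blocks k B) $$ (s, j) = col_blocks k B $$ (pos a s, j)"
    using assms sj' by (intro sel_mat) auto
  also have "\<dots> = B a $$ (s, j)"
    using sj' pos_less[OF assms(1) sj'(1)] idx_pos[OF assms(1) sj'(1)] by (simp add: col_blocks_def)
  finally show "(sel a * col_blocks k B) $$ (s, j) = B a $$ (s, j)" .
qed (use assms in \<open>auto simp: sel_def col_blocks_def\<close>)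

lemma row_blocks_sel_transpose:
  assumes "a \<in> K" "A a \<in> carrier_mat r (n a)"
  shows "row_blocks r A * transpose_mat (sel a) = A a"
proof (rule eq_matI)
  fix i s assume sj: "i < dim_row (A a)" "s < dim_col (A a)"
  then have sj': "i < r" "s < n a" using assms by auto
  have "(row_blocks r A * transpose_mat (sel a)) $$ (i, s) = row_blocks r A $$ (i, pos a s)"
    using assms sj' by (intro mat_sel) auto
  also have "\<dots> = A a $$ (i, s)"
    using sj' pos_less[OF assms(1) sj'(2)] idx_pos[OF assms(1) sj'(2)] by (simp add: row_blocks_def)
  finally show "(row_blocks r A * transpose_mat (sel a)) $$ (i, s) = A a $$ (i, s)" .
qed (use assms in \<open>auto simp: sel_def row_blocks_def\<close>)

lemma col_blocks_sel:
  assumes M: "M \<in> carrier_mat N k" and B: "\<And>a. a \<in> K \<Longrightarrow> B a = sel a * M"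
  shows "col_blocks k B = M"
proof (rule eq_matI)
  fix c j assume "c < dim_row M" "j < dim_col M"
  then have c: "c < N" "j < k" using M by auto
  show "col_blocks k B $$ (c, j) = M $$ (c, j)"
    using c B[OF idx_mem(1)[OF c(1)]] sel_mat[OF idx_mem(1)[OF c(1)] M idx_mem(2)[OF c(1)] c(2)] pos_idx[OF c(1)]
    by (simp add: col_blocks_def)
qed (use M in \<open>auto simp: col_blocks_def\<close>)

lemma row_blocks_sel:
  assumes M: "M \<in> carrier_mat r N" and A: "\<And>a. a \<in> K \<Longrightarrow> A a = M * transpose_mat (sel a)"
  shows "row_blocks r A = M"
proof (rule eq_matI)
  fix i c assume "i < dim_row M" "c < dim_col M"
  then have c: "c < N" "i < r" using M by auto
  show "row_blocks r A $$ (i, c) = M $$ (i, c)"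
    using c A[OF idx_mem(1)[OF c(1)]] mat_sel[OF idx_mem(1)[OF c(1)] M c(2) idx_mem(2)[OF c(1)]] pos_idx[OF c(1)]
    by (simp add: row_blocks_def)
qed (use M in \<open>auto simp: row_blocks_def\<close>)

lemma row_blocks_vec:
  assumes A: "\<And>a. a \<in> K \<Longrightarrow> A a \<in> carrier_mat r (n a)" and x: "x \<in> carrier_vec N" and i: "i < r"
  shows "(row_blocks r A *\<^sub>v x) $ i = (\<Sum>a\<in>K. (A a *\<^sub>v (sel a *\<^sub>v x)) $ i)"
proof -
  have "(row_blocks r A *\<^sub>v x) $ i = (\<Sum>c = 0..<N. A (fst (idx c)) $$ (i, snd (idx c)) * x $ c)"
    using x i by (simp add: row_blocks_def scalar_prod_def)
  also have "\<dots> = (\<Sum>c = 0..<N. A (fst (idx c)) $$ (i, snd (idx c)) * x $ pos (fst (idx c)) (snd (idx c)))"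
    by (intro sum.cong refl) (simp add: pos_idx)
  also have "\<dots> = (\<Sum>a\<in>K. \<Sum>s = 0..<n a. A a $$ (i, s) * x $ pos a s)"
    by (rule sum_idx[of "\<lambda>a s. A a $$ (i, s) * x $ pos a s"])
  also have "\<dots> = (\<Sum>a\<in>K. (A a *\<^sub>v (sel a *\<^sub>v x)) $ i)"
  proof (intro sum.cong refl)
    fix a assume a: "a \<in> K"
    have "(A a *\<^sub>v (sel a *\<^sub>v x)) $ i = (\<Sum>s = 0..<n a. A a $$ (i, s) * (sel a *\<^sub>v x) $ s)"
      using A[OF a] i by (auto simp: scalar_prod_def sel_def intro!: sum.cong)
    also have "\<dots> = (\<Sum>s = 0..<n a. A a $$ (i, s) * x $ pos a s)"
      by (intro sum.cong refl) (use a x sel_vec in auto)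
    finally show "(\<Sum>s = 0..<n a. A a $$ (i, s) * x $ pos a s) = (A a *\<^sub>v (sel a *\<^sub>v x)) $ i" by simp
  qed
  finally show ?thesis .
qed

lemma row_col_blocks:
  assumes A: "\<And>a. a \<in> K \<Longrightarrow> A a \<in> carrier_mat r (n a)"
    and B: "\<And>a. a \<in> K \<Longrightarrow> B a \<in> carrier_mat (n a) k" and ij: "i < r" "j < k"
  shows "(row_blocks r A * col_blocks k B) $$ (i, j) = (\<Sum>a\<in>K. (A a * B a) $$ (i, j))"
proof -
  have "(row_blocks r A * col_blocks k B) $$ (i, j)
      = (\<Sum>c = 0..<N. A (fst (idx c)) $$ (i, snd (idx c)) * B (fst (idx c)) $$ (snd (idx c), j))"
    using ij by (auto simp: row_blocks_def col_blocks_def scalar_prod_def intro!: sum.cong)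
  also have "\<dots> = (\<Sum>a\<in>K. \<Sum>s = 0..<n a. A a $$ (i, s) * B a $$ (s, j))"
    by (rule sum_idx[of "\<lambda>a s. A a $$ (i, s) * B a $$ (s, j)"])
  also have "\<dots> = (\<Sum>a\<in>K. (A a * B a) $$ (i, j))"
  proof (intro sum.cong refl)
    fix a assume a: "a \<in> K"
    show "(\<Sum>s = 0..<n a. A a $$ (i, s) * B a $$ (s, j)) = (A a * B a) $$ (i, j)"
      using A[OF a] B[OF a] ij by (auto simp: scalar_prod_def intro!: sum.cong)
  qed
  finally show ?thesis .
qed

lemma row_col_blocks_cong:
  assumes A: "\<And>a. a \<in> K \<Longrightarrow> A a \<in> carrier_mat r (n a)"
    and B: "\<And>a. a \<in> K \<Longrightarrow> B a \<in> carrier_mat (n a) k"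
    and A': "\<And>a. a \<in> K \<Longrightarrow> A' a \<in> carrier_mat r (n a)"
    and B': "\<And>a. a \<in> K \<Longrightarrow> B' a \<in> carrier_mat (n a) k"
    and eq: "\<And>a. a \<in> K \<Longrightarrow> A' a * B' a = A a * B a"
  shows "row_blocks r A' * col_blocks k B' = row_blocks r A * col_blocks k B"
proof (rule eq_matI)
  fix i j assume "i < dim_row (row_blocks r A * col_blocks k B)" "j < dim_col (row_blocks r A * col_blocks k B)"
  then have ij: "i < r" "j < k" by (auto simp: row_blocks_def col_blocks_def)
  show "(row_blocks r A' * col_blocks k B') $$ (i, j) = (row_blocks r A * col_blocks k B) $$ (i, j)"
    by (subst (1 2) row_col_blocks[OF _ _ ij]) (use A B A' B' eq in auto)
qed (auto simp: row_blocks_def col_blocks_def)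

lemma mult_row_blocks:
  assumes A: "\<And>a. a \<in> K \<Longrightarrow> A a \<in> carrier_mat r (n a)" and g: "g \<in> carrier_mat q r"
  shows "row_blocks q (\<lambda>a. g * A a) = g * row_blocks r A"
proof (rule eq_matI)
  fix i c assume "i < dim_row (g * row_blocks r A)" "c < dim_col (g * row_blocks r A)"
  then have ic: "i < q" "c < N" using g by (auto simp: row_blocks_def)
  show "row_blocks q (\<lambda>a. g * A a) $$ (i, c) = (g * row_blocks r A) $$ (i, c)"
    using ic g A[OF idx_mem(1)[OF ic(2)]] idx_mem(2)[OF ic(2)]
    by (auto simp: row_blocks_def scalar_prod_def intro!: sum.cong)
qed (use g in \<open>auto simp: row_blocks_def\<close>)

lemma col_blocks_mult:
  assumes B: "\<And>a. a \<in> K \<Longrightarrow> B a \<in> carrier_mat (n a) k" and g: "g \<in> carrier_mat k q"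
  shows "col_blocks q (\<lambda>a. B a * g) = col_blocks k B * g"
proof (rule eq_matI)
  fix c j assume "c < dim_row (col_blocks k B * g)" "j < dim_col (col_blocks k B * g)"
  then have ic: "j < q" "c < N" using g by (auto simp: col_blocks_def)
  show "col_blocks q (\<lambda>a. B a * g) $$ (c, j) = (col_blocks k B * g) $$ (c, j)"
    using ic g B[OF idx_mem(1)[OF ic(2)]] idx_mem(2)[OF ic(2)]
    by (auto simp: col_blocks_def scalar_prod_def intro!: sum.cong)
qed (use g in \<open>auto simp: col_blocks_def\<close>)

lemma sel_col_blocks_vec:
  assumes "a \<in> K" "B a \<in> carrier_mat (n a) k" "w \<in> carrier_vec k"
  shows "sel a *\<^sub>v (col_blocks k B *\<^sub>v w) = B a *\<^sub>v w"
  using assoc_mult_mat_vec[OF carriers(1)[of a] carriers(3)[of k B] assms(3)] sel_col_blocks[where B=B, OF assms(1,2)] by simp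

definition emb :: "'a \<Rightarrow> complex vec \<Rightarrow> complex vec" where
  "emb a u = vec N (\<lambda>c. if fst (idx c) = a then u $ snd (idx c) else 0)"

lemma sel_emb:
  assumes "a \<in> K" "b \<in> K" "u \<in> carrier_vec (n a)"
  shows "sel b *\<^sub>v emb a u = (if b = a then u else 0\<^sub>v (n b))"
proof (rule eq_vecI)
  fix s assume "s < dim_vec (if b = a then u else 0\<^sub>v (n b))"
  then have s: "s < n b" using assms by (auto split: if_splits)
  have "(sel b *\<^sub>v emb a u) $ s = emb a u $ pos b s" using s assms by (intro sel_vec) (auto simp: emb_def)
  then show "(sel b *\<^sub>v emb a u) $ s = (if b = a then u else 0\<^sub>v (n b)) $ s"
    using s idx_pos[OF assms(2) s] pos_less[OF assms(2) s] by (auto simp: emb_def)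
qed (use assms in \<open>auto simp: sel_def\<close>)

lemma emb_carrier [simp]: "emb a u \<in> carrier_vec N" by (simp add: emb_def)

lemma row_blocks_emb:
  assumes A: "\<And>a. a \<in> K \<Longrightarrow> A a \<in> carrier_mat r (n a)" and a: "a \<in> K" and u: "u \<in> carrier_vec (n a)"
  shows "row_blocks r A *\<^sub>v emb a u = A a *\<^sub>v u"
proof (rule eq_vecI)
  fix i assume "i < dim_vec (A a *\<^sub>v u)"
  then have i: "i < r" using A[OF a] by simp
  have "(row_blocks r A *\<^sub>v emb a u) $ i = (\<Sum>b\<in>K. (A b *\<^sub>v (sel b *\<^sub>v emb a u)) $ i)"
    by (rule row_blocks_vec[OF A _ i]) auto
  also have "\<dots> = (\<Sum>b\<in>K. if b = a then (A a *\<^sub>v u) $ i else 0)"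
  proof (intro sum.cong refl)
    fix b assume b: "b \<in> K"
    show "(A b *\<^sub>v (sel b *\<^sub>v emb a u)) $ i = (if b = a then (A a *\<^sub>v u) $ i else 0)"
      unfolding sel_emb[OF a b u] using A[OF b] i by auto
  qed
  also have "\<dots> = (A a *\<^sub>v u) $ i" using finite_K a by simp
  finally show "(row_blocks r A *\<^sub>v emb a u) $ i = (A a *\<^sub>v u) $ i" .
qed (use A[OF a] in \<open>auto simp: row_blocks_def\<close>)

definition prod_sub :: "('a \<Rightarrow> complex vec set) \<Rightarrow> complex vec set" where
  "prod_sub U = {x \<in> carrier_vec N. \<forall>a\<in>K. sel a *\<^sub>v x \<in> U a}"

lemma lin_sub_prod_sub:
  assumes "\<And>a. a \<in> K \<Longrightarrow> lin_sub (n a) (U a)"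
  shows "lin_sub N (prod_sub U)"
proof -
  have z: "sel a *\<^sub>v 0\<^sub>v N = 0\<^sub>v (n a)" for a by (auto simp: sel_def)
  show ?thesis
    using assms unfolding lin_sub_iff prod_sub_def
    by (auto simp: mult_add_distrib_mat_vec[OF carriers(1)] mult_mat_vec[OF carriers(1)] z)
qed

lemma prod_sub_restrict:
  assumes "\<And>a. a \<in> K \<Longrightarrow> lin_sub (n a) (U a)" "a \<in> K"
  shows "lin_sub (n a) (if a \<in> B then U a else {0\<^sub>v (n a)})"
  using assms by simp

text \<open>Adding one index at a time: the projection to the new summand has image \<open>U b\<close> and kernel the
  product over the old indices.\<close>

lemma sdim_prod_sub:
  assumes U: "\<And>a. a \<in> K \<Longrightarrow> lin_sub (n a) (U a)"
  shows "sdim N (prod_sub U) = (\<Sum>a\<in>K. sdim (n a) (U a))"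
proof -
  define P where "P B = prod_sub (\<lambda>a. if a \<in> B then U a else {0\<^sub>v (n a)})" for B
  have P: "lin_sub N (P B)" for B unfolding P_def by (intro lin_sub_prod_sub prod_sub_restrict U)
  have "sdim N (P B) = (\<Sum>a\<in>B. sdim (n a) (U a))" if "finite B" "B \<subseteq> K" for B
    using that
  proof (induction B rule: finite_induct)
    case empty
    have "P {} = {0\<^sub>v N}"
    proof (rule subset_antisym)
      show "P {} \<subseteq> {0\<^sub>v N}"
      proof
        fix x assume "x \<in> P {}"
        then have x: "x \<in> carrier_vec N" "\<And>a. a \<in> K \<Longrightarrow> sel a *\<^sub>v x = 0\<^sub>v (n a)" by (auto simp: P_def prod_sub_def)
        have "x = 0\<^sub>v N" by (rule vec_eq_blocks) (use x in \<open>auto simp: sel_def\<close>)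
        then show "x \<in> {0\<^sub>v N}" by simp
      qed
      show "{0\<^sub>v N} \<subseteq> P {}" using P[of "{}"] by (simp add: lin_sub_iff)
    qed
    then show ?case by simp
  next
    case (insert b B)
    then have b: "b \<in> K" "b \<notin> B" by auto
    have "(\<lambda>x. sel b *\<^sub>v x) ` P (insert b B) = U b"
    proof (rule subset_antisym)
      show "(\<lambda>x. sel b *\<^sub>v x) ` P (insert b B) \<subseteq> U b" using b by (auto simp: P_def prod_sub_def)
      show "U b \<subseteq> (\<lambda>x. sel b *\<^sub>v x) ` P (insert b B)"
      proof
        fix u assume u: "u \<in> U b"
        then have uc: "u \<in> carrier_vec (n b)" using U[OF b(1)] by (auto simp: lin_sub_iff)
        have "u = sel b *\<^sub>v emb b u" using sel_emb[OF b(1) b(1) uc] by simp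
        moreover have "emb b u \<in> P (insert b B)"
          unfolding P_def prod_sub_def using u U sel_emb[OF b(1) _ uc] by (auto simp: lin_sub_iff)
        ultimately show "u \<in> (\<lambda>x. sel b *\<^sub>v x) ` P (insert b B)" by blast
      qed
    qed
    moreover have "{x \<in> P (insert b B). sel b *\<^sub>v x = 0\<^sub>v (n b)} = P B"
      using b U by (auto simp: P_def prod_sub_def lin_sub_iff split: if_splits)
    ultimately show ?case
      using rank_nullity_mat[OF carriers(1)[of b] P[of "insert b B"]] insert by simp
  qed
  from this[OF finite_K subset_refl] have "sdim N (P K) = (\<Sum>a\<in>K. sdim (n a) (U a))" .
  moreover have "P K = prod_sub U" by (simp add: P_def prod_sub_def)
  ultimately show ?thesis by simp
qed

text \<open>Induction on the set of indices at which the blocks of \<open>x\<close> may be nonzero.\<close>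

lemma row_blocks_prod_sub:
  assumes A: "\<And>a. a \<in> K \<Longrightarrow> A a \<in> carrier_mat r (n a)"
    and U: "\<And>a. a \<in> K \<Longrightarrow> lin_sub (n a) (U a)" and T: "lin_sub r T"
    and closed: "\<And>a u. a \<in> K \<Longrightarrow> u \<in> U a \<Longrightarrow> A a *\<^sub>v u \<in> T" and x: "x \<in> prod_sub U"
  shows "row_blocks r A *\<^sub>v x \<in> T"
proof -
  define P where "P B = prod_sub (\<lambda>a. if a \<in> B then U a else {0\<^sub>v (n a)})" for B
  have "\<forall>x\<in>P B. row_blocks r A *\<^sub>v x \<in> T" if "finite B" "B \<subseteq> K" for B
    using that
  proof (induction B rule: finite_induct)
    case empty
    have "x = 0\<^sub>v N" if "x \<in> P {}" for x
      by (rule vec_eq_blocks) (use that in \<open>auto simp: P_def prod_sub_def sel_def\<close>)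
    moreover have "row_blocks r A *\<^sub>v 0\<^sub>v N = 0\<^sub>v r" by (auto simp: row_blocks_def)
    ultimately show ?case using T by (auto simp: lin_sub_iff)
  next
    case (insert b B)
    then have b: "b \<in> K" "b \<notin> B" by auto
    show ?case
    proof
      fix x assume x: "x \<in> P (insert b B)"
      define u where "u = sel b *\<^sub>v x"
      have u: "u \<in> U b" using x b by (auto simp: P_def prod_sub_def u_def)
      then have uc: "u \<in> carrier_vec (n b)" using U[OF b(1)] by (auto simp: lin_sub_iff)
      have xc: "x \<in> carrier_vec N" using x by (simp add: P_def prod_sub_def)
      define y where "y = x - emb b u"
      have yc: "y \<in> carrier_vec N" using xc by (simp add: y_def)
      have sely: "sel a *\<^sub>v y = (if a = b then 0\<^sub>v (n b) else sel a *\<^sub>v x)" if "a \<in> K" for a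
        unfolding y_def mult_minus_distrib_mat_vec[OF carriers(1) xc emb_carrier] sel_emb[OF b(1) that uc]
        using u_def uc xc mult_mat_vec_carrier[OF carriers(1) xc, of a] by auto
      have "y \<in> P B" unfolding P_def prod_sub_def
      proof (intro CollectI conjI ballI yc)
        fix a assume "a \<in> K"
        then show "sel a *\<^sub>v y \<in> (if a \<in> B then U a else {0\<^sub>v (n a)})"
          using sely[of a] x b by (auto simp: P_def prod_sub_def split: if_splits)
      qed
      then have 1: "row_blocks r A *\<^sub>v y \<in> T" using insert by blast
      have 2: "row_blocks r A *\<^sub>v emb b u \<in> T"
        using row_blocks_emb[OF A b(1) uc] closed[OF b(1) u] by simp
      have "x = y + emb b u" using xc by (intro eq_vecI) (auto simp: y_def emb_def)
      then have "row_blocks r A *\<^sub>v x = row_blocks r A *\<^sub>v y + row_blocks r A *\<^sub>v emb b u"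
        using mult_add_distrib_mat_vec[OF carriers(2) yc emb_carrier] by simp
      then show "row_blocks r A *\<^sub>v x \<in> T" using 1 2 T by (simp add: lin_sub_iff)
    qed
  qed
  from this[OF finite_K subset_refl] show ?thesis using x by (simp add: P_def prod_sub_def)
qed

end


section \<open>Isomorphisms of good quotients from correspondences of orbits\<close>

lemma topspace_zariski [simp]: "topspace (zariski Q d) = rep_space Q d"
proof -
  have "{V \<in> rep_space Q d. (1 :: complex) \<noteq> 0} \<in> {{V \<in> rep_space Q d. p V \<noteq> 0} |p. p \<in> poly_functions Q d}"
    by (intro CollectI exI[of _ "\<lambda>_. 1"] conjI poly_functions.const) simp
  then show ?thesis unfolding zariski_def by auto
qed

lemma openin_zariski_nonzero:
  "p \<in> poly_functions Q d \<Longrightarrow> openin (zariski Q d) {V \<in> rep_space Q d. p V \<noteq> 0}"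
  unfolding zariski_def by (rule topology_generated_by_Basis) blast

lemma topspace_quotient_topology [simp]: "topspace (quotient_topology X p) = p ` topspace X"
proof (rule subset_antisym)
  show "topspace (quotient_topology X p) \<subseteq> p ` topspace X"
    unfolding topspace_def[of "quotient_topology X p"] openin_quotient_topology by blast
  have "{x \<in> topspace X. p x \<in> p ` topspace X} = topspace X" by blast
  then show "p ` topspace X \<subseteq> topspace (quotient_topology X p)"
    by (intro openin_subset) (simp add: openin_quotient_topology)
qed

lemma isomorphic_spaces_trans:
  assumes "X \<simeq>\<^sub>v Y" "Y \<simeq>\<^sub>v Z"
  shows "X \<simeq>\<^sub>v Z"
proof -
  obtain \<phi> where \<phi>: "homeomorphic_map (space_top X) (space_top Y) \<phi>"
    and \<phi>r: "\<And>U f. openin (space_top Y) U \<Longrightarrow> f \<in> reg_sections Y U \<longleftrightarrow>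
        f \<circ> \<phi> \<in> reg_sections X {x \<in> topspace (space_top X). \<phi> x \<in> U}"
    using assms(1) unfolding isomorphic_spaces_def by blast
  obtain \<psi> where \<psi>: "homeomorphic_map (space_top Y) (space_top Z) \<psi>"
    and \<psi>r: "\<And>U f. openin (space_top Z) U \<Longrightarrow> f \<in> reg_sections Z U \<longleftrightarrow>
        f \<circ> \<psi> \<in> reg_sections Y {x \<in> topspace (space_top Y). \<psi> x \<in> U}"
    using assms(2) unfolding isomorphic_spaces_def by blast
  have "f \<in> reg_sections Z U \<longleftrightarrow> f \<circ> (\<psi> \<circ> \<phi>) \<in> reg_sections X {x \<in> topspace (space_top X). (\<psi> \<circ> \<phi>) x \<in> U}"
    if U: "openin (space_top Z) U" for U f
  proof -
    let ?V = "{y \<in> topspace (space_top Y). \<psi> y \<in> U}"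
    have V: "openin (space_top Y) ?V"
      using \<psi> U homeomorphic_imp_continuous_map openin_continuous_map_preimage by blast
    have "{x \<in> topspace (space_top X). \<phi> x \<in> ?V} = {x \<in> topspace (space_top X). (\<psi> \<circ> \<phi>) x \<in> U}"
      using homeomorphic_imp_surjective_map[OF \<phi>] by auto
    then show ?thesis using \<psi>r[OF U, of f] \<phi>r[OF V, of "f \<circ> \<psi>"] by (simp add: comp_assoc)
  qed
  then show ?thesis
    unfolding isomorphic_spaces_def using homeomorphic_map_compose[OF \<phi> \<psi>] by blast
qed

text \<open>A single representation as a fraction on all of \<open>Y\<close>, in contrast to the local ones in
  \<open>regular_functions\<close>.\<close>

definition fraction_on ::
  "('v, 'a) pre_digraph \<Rightarrow> ('v \<Rightarrow> nat) \<Rightarrow> ('a \<Rightarrow> complex mat) set \<Rightarrow> (('a \<Rightarrow> complex mat) \<Rightarrow> complex) \<Rightarrow> bool" where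
  "fraction_on Q d Y f \<longleftrightarrow>
     (\<exists>p\<in>poly_functions Q d. \<exists>q\<in>poly_functions Q d. \<forall>V\<in>Y. q V \<noteq> 0 \<and> f V = p V / q V)"

lemma fraction_onI:
  "p \<in> poly_functions Q d \<Longrightarrow> q \<in> poly_functions Q d \<Longrightarrow> (\<And>V. V \<in> Y \<Longrightarrow> q V \<noteq> 0 \<and> f V = p V / q V) \<Longrightarrow>
    fraction_on Q d Y f"
  unfolding fraction_on_def
  by (rule bexI[of _ p], rule bexI[of _ q]) simp_all

lemma fraction_onE:
  assumes "fraction_on Q d Y f"
  obtains p q where "p \<in> poly_functions Q d" "q \<in> poly_functions Q d"
    "\<forall>V\<in>Y. q V \<noteq> 0" "\<forall>V\<in>Y. f V = p V / q V"
proof -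
  from assms obtain p where p: "p \<in> poly_functions Q d"
    and "\<exists>q\<in>poly_functions Q d. \<forall>V\<in>Y. q V \<noteq> 0 \<and> f V = p V / q V"
    unfolding fraction_on_def by (rule bexE)
  from this(2) obtain q where "q \<in> poly_functions Q d" "\<forall>V\<in>Y. q V \<noteq> 0 \<and> f V = p V / q V" by (rule bexE)
  then show ?thesis using that[OF p, of q] by simp
qed

lemma regular_functions_iff:
  "f \<in> regular_functions Q d W \<longleftrightarrow>
    (\<forall>x\<in>W. \<exists>N. openin (subtopology (zariski Q d) W) N \<and> x \<in> N \<and> fraction_on Q d N f)"
  by (simp add: regular_functions_def fraction_on_def)

text \<open>Induction over the coordinate ring: fractions are closed under sums and products.\<close>

lemma fraction_on_pullback:
  assumes coord: "\<And>\<alpha> r s. \<alpha> \<in> arcs Q' \<Longrightarrow> r < d' (head Q' \<alpha>) \<Longrightarrow> s < d' (tail Q' \<alpha>) \<Longrightarrow>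
      fraction_on Q d Y (\<lambda>V. f V \<alpha> $$ (r, s))"
    and p: "p \<in> poly_functions Q' d'"
  shows "fraction_on Q d Y (\<lambda>V. p (f V))"
  using p
proof induction
  case (const c)
  show ?case
    by (rule fraction_onI[where p="\<lambda>_. c" and q="\<lambda>_. 1"]) (auto intro: poly_functions.const)
next
  case (coord \<alpha> r s)
  then show ?case by (rule assms(1))
next
  case (add p1 p2)
  from add.IH(1) obtain a1 b1 where 1: "a1 \<in> poly_functions Q d" "b1 \<in> poly_functions Q d"
      "\<forall>V\<in>Y. b1 V \<noteq> 0" "\<forall>V\<in>Y. p1 (f V) = a1 V / b1 V"
    by (rule fraction_onE)
  from add.IH(2) obtain a2 b2 where 2: "a2 \<in> poly_functions Q d" "b2 \<in> poly_functions Q d"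
      "\<forall>V\<in>Y. b2 V \<noteq> 0" "\<forall>V\<in>Y. p2 (f V) = a2 V / b2 V"
    by (rule fraction_onE)
  show ?case
  proof (rule fraction_onI)
    show "(\<lambda>V. a1 V * b2 V + a2 V * b1 V) \<in> poly_functions Q d" "(\<lambda>V. b1 V * b2 V) \<in> poly_functions Q d"
      by (intro poly_functions.add poly_functions.mult 1(1,2) 2(1,2))+
    fix V assume "V \<in> Y"
    then show "b1 V * b2 V \<noteq> 0 \<and> p1 (f V) + p2 (f V) = (a1 V * b2 V + a2 V * b1 V) / (b1 V * b2 V)"
      using 1(3,4) 2(3,4) by (simp add: add_frac_eq)
  qed
next
  case (mult p1 p2)
  from mult.IH(1) obtain a1 b1 where 1: "a1 \<in> poly_functions Q d" "b1 \<in> poly_functions Q d"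
      "\<forall>V\<in>Y. b1 V \<noteq> 0" "\<forall>V\<in>Y. p1 (f V) = a1 V / b1 V"
    by (rule fraction_onE)
  from mult.IH(2) obtain a2 b2 where 2: "a2 \<in> poly_functions Q d" "b2 \<in> poly_functions Q d"
      "\<forall>V\<in>Y. b2 V \<noteq> 0" "\<forall>V\<in>Y. p2 (f V) = a2 V / b2 V"
    by (rule fraction_onE)
  show ?case
  proof (rule fraction_onI)
    show "(\<lambda>V. a1 V * a2 V) \<in> poly_functions Q d" "(\<lambda>V. b1 V * b2 V) \<in> poly_functions Q d"
      by (intro poly_functions.mult 1(1,2) 2(1,2))+
    fix V assume "V \<in> Y"
    then show "b1 V * b2 V \<noteq> 0 \<and> p1 (f V) * p2 (f V) = (a1 V * a2 V) / (b1 V * b2 V)"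
      using 1(3,4) 2(3,4) by simp
  qed
qed

lemma fraction_on_divide:
  assumes "a \<in> poly_functions Q d" "D \<in> poly_functions Q d"
    and "\<And>V. V \<in> Y \<Longrightarrow> D V \<noteq> 0" "\<And>V. V \<in> Y \<Longrightarrow> f V = a V / D V"
  shows "fraction_on Q d Y f"
  using assms by (intro fraction_onI[of a Q d D]) auto

lemma fraction_on_poly:
  assumes "a \<in> poly_functions Q d" "\<And>V. V \<in> Y \<Longrightarrow> f V = a V"
  shows "fraction_on Q d Y f"
  using assms by (intro fraction_onI[of a Q d "\<lambda>_. 1"]) (auto intro: poly_functions.const)

lemma rep_carrier:
  assumes "V \<in> rep_space Q d" "\<alpha> \<in> arcs Q"
  shows "V \<alpha> \<in> carrier_mat (d (head Q \<alpha>)) (d (tail Q \<alpha>))"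
  using assms by (auto simp: rep_space_def PiE_iff)

abbreviation base_change_orbit ::
  "('v, 'a) pre_digraph \<Rightarrow> ('v \<Rightarrow> nat) \<Rightarrow> ('a \<Rightarrow> complex mat) \<Rightarrow> ('a \<Rightarrow> complex mat) set" where
  "base_change_orbit Q d V \<equiv> orbit (base_change_group Q d) (base_change Q d) V"

text \<open>A relation between two varieties with group actions that induces a morphism of the orbit spaces:
  it is total and respects orbits, and on a neighbourhood \<open>D \<noteq> 0\<close> of each point it is realised by a
  rational map that takes a prescribed value \<open>W\<close> at \<open>V\<close>. Prescribing this value makes it possible to pull
  back neighbourhoods of any given representative \<open>W\<close>.\<close>

locale orbit_correspondence =
  fixes Q :: "('v, 'a) pre_digraph" and d :: "'v \<Rightarrow> nat" and X :: "('a \<Rightarrow> complex mat) set"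
    and Q' :: "('w, 'b) pre_digraph" and d' :: "'w \<Rightarrow> nat" and X' :: "('b \<Rightarrow> complex mat) set"
    and R :: "('a \<Rightarrow> complex mat) \<Rightarrow> ('b \<Rightarrow> complex mat) \<Rightarrow> bool"
  assumes X_sub: "X \<subseteq> rep_space Q d" and X'_sub: "X' \<subseteq> rep_space Q' d'"
    and dom: "R V W \<Longrightarrow> V \<in> X" and cod: "R V W \<Longrightarrow> W \<in> X'"
    and total: "V \<in> X \<Longrightarrow> \<exists>W. R V W"
    and orbits: "R V1 W1 \<Longrightarrow> R V2 W2 \<Longrightarrow> V2 \<in> base_change_orbit Q d V1 \<Longrightarrow> W2 \<in> base_change_orbit Q' d' W1"
    and local_section: "R V W \<Longrightarrow> \<exists>D\<in>poly_functions Q d. \<exists>s. D V \<noteq> 0 \<and> s V = W \<and>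
       (\<forall>V'\<in>{V' \<in> X. D V' \<noteq> 0}. R V' (s V')) \<and>
       (\<forall>p\<in>poly_functions Q' d'. fraction_on Q d {V' \<in> X. D V' \<noteq> 0} (\<lambda>V'. p (s V')))"
begin

abbreviation "zar \<equiv> subtopology (zariski Q d) X"
abbreviation "zar' \<equiv> subtopology (zariski Q' d') X'"
abbreviation "cl \<equiv> git_class Q d X"
abbreviation "cl' \<equiv> git_class Q' d' X'"

lemma topspaces: "topspace zar = X" "topspace zar' = X'"
  using X_sub X'_sub by auto

lemma continuous_section:
  assumes "R V W"
  obtains N s where "openin zar N" "V \<in> N" "s V = W" "\<forall>V'\<in>N. R V' (s V')"
    "\<forall>T'. openin zar' T' \<longrightarrow> openin zar {V' \<in> N. s V' \<in> T'}"
    "\<forall>p\<in>poly_functions Q' d'. fraction_on Q d N (\<lambda>V'. p (s V'))"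
proof -
  from local_section[OF assms] obtain D where D1: "D \<in> poly_functions Q d" and
    "\<exists>s. D V \<noteq> 0 \<and> s V = W \<and> (\<forall>V'\<in>{V' \<in> X. D V' \<noteq> 0}. R V' (s V')) \<and>
       (\<forall>p\<in>poly_functions Q' d'. fraction_on Q d {V' \<in> X. D V' \<noteq> 0} (\<lambda>V'. p (s V')))"
    by (rule bexE)
  from this(2) obtain s where H: "D V \<noteq> 0 \<and> s V = W \<and> (\<forall>V'\<in>{V' \<in> X. D V' \<noteq> 0}. R V' (s V')) \<and>
       (\<forall>p\<in>poly_functions Q' d'. fraction_on Q d {V' \<in> X. D V' \<noteq> 0} (\<lambda>V'. p (s V')))"
    by (rule exE)
  define N where "N = {V' \<in> X. D V' \<noteq> 0}"
  have D: "D \<in> poly_functions Q d" "D V \<noteq> 0" and s: "s V = W"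
    and Rs: "\<And>V'. V' \<in> N \<Longrightarrow> R V' (s V')"
    and poly: "\<And>p. p \<in> poly_functions Q' d' \<Longrightarrow> fraction_on Q d N (\<lambda>V'. p (s V'))"
    using H D1 unfolding N_def by simp_all
  have N_eq: "N = {V' \<in> rep_space Q d. D V' \<noteq> 0} \<inter> X" using X_sub by (auto simp: N_def)
  have N: "openin zar N"
    unfolding N_eq openin_subtopology
    by (intro exI[of _ "{V' \<in> rep_space Q d. D V' \<noteq> 0}"] conjI openin_zariski_nonzero[OF D(1)] refl)
  have sub: "subtopology zar N = subtopology (zariski Q d) N"
  proof -
    have "X \<inter> N = N" by (auto simp: N_def)
    then show ?thesis by (simp add: subtopology_subtopology)
  qed
  have tsN: "topspace (subtopology zar N) = N" "topspace (subtopology (zariski Q d) N) = N"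
    using openin_subset[OF N] sub by auto
  have cont: "continuous_map (subtopology zar N) (zariski Q' d') s"
    unfolding zariski_def[of Q' d']
  proof (rule continuous_on_generated_topo)
    fix U assume "U \<in> {{V \<in> rep_space Q' d'. p V \<noteq> 0} |p. p \<in> poly_functions Q' d'}"
    then obtain p where p: "p \<in> poly_functions Q' d'" and U: "U = {V \<in> rep_space Q' d'. p V \<noteq> 0}" by blast
    from poly[OF p] obtain a b where a: "a \<in> poly_functions Q d"
      and b: "\<forall>V'\<in>N. b V' \<noteq> 0" "\<forall>V'\<in>N. p (s V') = a V' / b V'" by (rule fraction_onE)
    have "s -` U \<inter> N = {V' \<in> rep_space Q d. a V' \<noteq> 0} \<inter> N"
    proof (rule Set.set_eqI)
      fix V'
      have "s V' \<in> rep_space Q' d'" "V' \<in> rep_space Q d" "p (s V') \<noteq> 0 \<longleftrightarrow> a V' \<noteq> 0" if "V' \<in> N"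
        using subsetD[OF X'_sub cod[OF Rs[OF that]]] subsetD[OF X_sub dom[OF Rs[OF that]]] b that
        by simp_all
      then show "V' \<in> s -` U \<inter> N \<longleftrightarrow> V' \<in> {V' \<in> rep_space Q d. a V' \<noteq> 0} \<inter> N"
        unfolding U vimage_def Int_iff mem_Collect_eq by meson
    qed
    then show "openin (subtopology zar N) (s -` U \<inter> topspace (subtopology zar N))"
      unfolding tsN sub openin_subtopology
      by (intro exI[of _ "{V' \<in> rep_space Q d. a V' \<noteq> 0}"] conjI openin_zariski_nonzero[OF a])
  next
    have "s ` N \<subseteq> rep_space Q' d'" using Rs cod X'_sub by blast
    then show "s ` topspace (subtopology zar N)
        \<subseteq> \<Union> {{V \<in> rep_space Q' d'. p V \<noteq> 0} |p. p \<in> poly_functions Q' d'}"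
      unfolding tsN using topspace_zariski[of Q' d'] unfolding zariski_def by simp
  qed
  show ?thesis
  proof (rule that)
    show "openin zar N" by (rule N)
    show "V \<in> N" using D dom[OF assms] by (simp add: N_def)
    show "s V = W" by (rule s)
    show "\<forall>V'\<in>N. R V' (s V')" using Rs by blast
    show "\<forall>T'. openin zar' T' \<longrightarrow> openin zar {V' \<in> N. s V' \<in> T'}"
    proof (intro allI impI)
    fix T' assume "openin zar' T'"
    then obtain O' where O': "openin (zariski Q' d') O'" "T' = O' \<inter> X'" by (auto simp: openin_subtopology)
    have "openin (subtopology zar N) {V' \<in> N. s V' \<in> O'}"
      using openin_continuous_map_preimage[OF cont O'(1)] unfolding tsN .
    then have "openin zar {V' \<in> N. s V' \<in> O'}" using N openin_open_subtopology by blast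
    also have "{V' \<in> N. s V' \<in> O'} = {V' \<in> N. s V' \<in> T'}" using Rs cod O'(2) by blast
    finally show "openin zar {V' \<in> N. s V' \<in> T'}" .
    qed
  next
    show "\<forall>p\<in>poly_functions Q' d'. fraction_on Q d N (\<lambda>V'. p (s V'))" using poly by blast
  qed
qed

text \<open>A neighbourhood of \<open>W\<close> is pulled back along a section through \<open>(V, W)\<close>; the orbit of \<open>V0\<close> meets the
  result, and the section maps the intersection into the orbit of \<open>W0\<close>.\<close>

lemma closure_transfer:
  assumes R0: "R V0 W0" and R: "R V W" and V: "V \<in> zar closure_of base_change_orbit Q d V0"
  shows "W \<in> zar' closure_of base_change_orbit Q' d' W0"
  unfolding in_closure_of
proof (intro conjI allI impI)
  show "W \<in> topspace zar'" using cod[OF R] topspaces by simp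
  fix T assume T: "W \<in> T \<and> openin zar' T"
  obtain N s where N: "openin zar N" "V \<in> N" "s V = W" "\<forall>V'\<in>N. R V' (s V')"
    "\<forall>T'. openin zar' T' \<longrightarrow> openin zar {V' \<in> N. s V' \<in> T'}"
    "\<forall>p\<in>poly_functions Q' d'. fraction_on Q d N (\<lambda>V'. p (s V'))"
    by (rule continuous_section[OF R])
  have "V \<in> {V' \<in> N. s V' \<in> T}" "openin zar {V' \<in> N. s V' \<in> T}" using N(2,3) N(5)[rule_format] T by auto
  moreover have "\<forall>T. V \<in> T \<and> openin zar T \<longrightarrow> (\<exists>y. y \<in> base_change_orbit Q d V0 \<and> y \<in> T)"
    using V unfolding in_closure_of by (rule conjunct2)
  ultimately obtain V1 where V1: "V1 \<in> base_change_orbit Q d V0" "V1 \<in> {V' \<in> N. s V' \<in> T}" by meson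
  then have "R V1 (s V1)" using N(4) by simp
  then have "s V1 \<in> base_change_orbit Q' d' W0" using orbits[OF R0] V1(1) by simp
  then show "\<exists>y. y \<in> base_change_orbit Q' d' W0 \<and> y \<in> T" using V1(2) by blast
qed

lemma git_class_transfer:
  assumes R1: "R V1 W1" and R2: "R V2 W2" and V2: "V2 \<in> cl V1"
  shows "W2 \<in> cl' W1"
proof -
  from V2 obtain V where V: "V \<in> zar closure_of base_change_orbit Q d V1"
      "V \<in> zar closure_of base_change_orbit Q d V2"
    unfolding git_class_def by blast
  then have "V \<in> X" using topspaces(1) in_closure_of by metis
  then obtain W where "R V W" using total by blast
  from closure_transfer[OF R1 this V(1)] closure_transfer[OF R2 this V(2)] cod[OF R2]
  show ?thesis unfolding git_class_def by blast
qed

text \<open>Near each point \<open>F\<close> is the pullback of \<open>F'\<close> along a section.\<close>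

lemma regular_transfer:
  assumes Y: "Y \<subseteq> X" "Y' \<subseteq> X'" and YY: "\<And>V W. R V W \<Longrightarrow> V \<in> Y \<longleftrightarrow> W \<in> Y'"
    and FF: "\<And>V W. R V W \<Longrightarrow> F V = F' W" and F': "F' \<in> regular_functions Q' d' Y'"
  shows "F \<in> regular_functions Q d Y"
  unfolding regular_functions_iff
proof (intro ballI)
  fix V assume V: "V \<in> Y"
  then obtain W where R: "R V W" using total Y by blast
  then have W: "W \<in> Y'" using YY V by blast
  obtain N s where N: "openin zar N" "V \<in> N" "s V = W" "\<forall>V'\<in>N. R V' (s V')"
    "\<forall>T'. openin zar' T' \<longrightarrow> openin zar {V' \<in> N. s V' \<in> T'}"
    "\<forall>p\<in>poly_functions Q' d'. fraction_on Q d N (\<lambda>V'. p (s V'))"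
    by (rule continuous_section[OF R])
  from F' W obtain N' where N': "openin (subtopology (zariski Q' d') Y') N'" "W \<in> N'" and "fraction_on Q' d' N' F'"
    unfolding regular_functions_iff by blast
  from this(3) obtain p q where pq: "p \<in> poly_functions Q' d'" "q \<in> poly_functions Q' d'"
      "\<forall>y\<in>N'. q y \<noteq> 0" "\<forall>y\<in>N'. F' y = p y / q y" by (rule fraction_onE)
  obtain O' where O': "openin (zariski Q' d') O'" "N' = O' \<inter> Y'" using N'(1) by (auto simp: openin_subtopology)
  have "openin zar' (O' \<inter> X')" using O'(1) by (auto simp: openin_subtopology)
  then have "openin zar {V' \<in> N. s V' \<in> O' \<inter> X'}" using N(5) by blast
  then obtain O1 where O1: "openin (zariski Q d) O1" "{V' \<in> N. s V' \<in> O' \<inter> X'} = O1 \<inter> X"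
    by (auto simp: openin_subtopology)
  define N2 where "N2 = O1 \<inter> Y"
  have N2: "V' \<in> N \<and> R V' (s V') \<and> s V' \<in> N'" if "V' \<in> N2" for V'
  proof -
    have "V' \<in> {V' \<in> N. s V' \<in> O' \<inter> X'}" using that Y O1(2) by (auto simp: N2_def)
    then show ?thesis using N(4)[rule_format, of V'] YY that O'(2) by (auto simp: N2_def)
  qed
  from N(6) pq(1) have "fraction_on Q d N (\<lambda>V'. p (s V'))" by (rule bspec)
  then obtain a1 b1 where 1: "a1 \<in> poly_functions Q d" "b1 \<in> poly_functions Q d"
      "\<forall>V'\<in>N. b1 V' \<noteq> 0" "\<forall>V'\<in>N. p (s V') = a1 V' / b1 V'" by (rule fraction_onE)
  from N(6) pq(2) have "fraction_on Q d N (\<lambda>V'. q (s V'))" by (rule bspec)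
  then obtain a2 b2 where 2: "a2 \<in> poly_functions Q d" "b2 \<in> poly_functions Q d"
      "\<forall>V'\<in>N. b2 V' \<noteq> 0" "\<forall>V'\<in>N. q (s V') = a2 V' / b2 V'" by (rule fraction_onE)
  have "openin (subtopology (zariski Q d) Y) N2"
    unfolding N2_def openin_subtopology using O1(1) by blast
  moreover have "V \<in> {V' \<in> N. s V' \<in> O' \<inter> X'}" using N(2,3) N'(2) O'(2) Y by auto
  then have "V \<in> N2" unfolding O1(2) N2_def using V by blast
  moreover have "fraction_on Q d N2 F"
  proof (rule fraction_onI)
    show "(\<lambda>V. a1 V * b2 V) \<in> poly_functions Q d" using 1 2 by (intro poly_functions.mult)
    show "(\<lambda>V. b1 V * a2 V) \<in> poly_functions Q d" using 1 2 by (intro poly_functions.mult)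
    fix V' assume V': "V' \<in> N2"
    have qn: "q (s V') \<noteq> 0" using N2[OF V'] pq(3) by simp
    have q: "q (s V') = a2 V' / b2 V'" and p: "p (s V') = a1 V' / b1 V'"
      and nz: "b1 V' \<noteq> 0" "b2 V' \<noteq> 0"
      using N2[OF V'] 1(3,4) 2(3,4) by simp_all
    have "F V' = p (s V') / q (s V')" using N2[OF V'] FF pq(4) by metis
    then show "b1 V' * a2 V' \<noteq> 0 \<and> F V' = a1 V' * b2 V' / (b1 V' * a2 V')"
      using q p nz qn by auto
  qed
  ultimately show "\<exists>N. openin (subtopology (zariski Q d) Y) N \<and> V \<in> N \<and> fraction_on Q d N F" by blast
qed

lemma quotient_continuous:
  assumes \<phi>: "\<And>V W. R V W \<Longrightarrow> \<phi> (cl V) = cl' W"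
  shows "continuous_map (quotient_topology zar cl) (quotient_topology zar' cl') \<phi>"
  unfolding continuous_map_def topspace_quotient_topology topspaces
proof (intro conjI allI impI)
  show "\<phi> \<in> cl ` X \<rightarrow> cl' ` X'" using total cod \<phi> by blast
  fix U assume "openin (quotient_topology zar' cl') U"
  then have U: "openin zar' {W \<in> X'. cl' W \<in> U}" unfolding openin_quotient_topology topspaces by (rule conjunct2)
  have "openin zar {V \<in> X. \<phi> (cl V) \<in> U}"
  proof (subst openin_subopen, intro ballI)
    fix V assume V: "V \<in> {V \<in> X. \<phi> (cl V) \<in> U}"
    then obtain W where R: "R V W" using total by blast
    obtain N s where N: "openin zar N" "V \<in> N" "s V = W" "\<forall>V'\<in>N. R V' (s V')"
      "\<forall>T'. openin zar' T' \<longrightarrow> openin zar {V' \<in> N. s V' \<in> T'}"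
    "\<forall>p\<in>poly_functions Q' d'. fraction_on Q d N (\<lambda>V'. p (s V'))"
    by (rule continuous_section[OF R])
    let ?T = "{V' \<in> N. s V' \<in> {W \<in> X'. cl' W \<in> U}}"
    have "openin zar ?T" using N(5) U by blast
    moreover have "V \<in> ?T" using N(2,3) cod[OF R] \<phi>[OF R] V by auto
    moreover have "?T \<subseteq> {V \<in> X. \<phi> (cl V) \<in> U}" using N(4) \<phi> dom by fastforce
    ultimately show "\<exists>T. openin zar T \<and> V \<in> T \<and> T \<subseteq> {V \<in> X. \<phi> (cl V) \<in> U}" by blast
  qed
  moreover have "{V \<in> X. cl V \<in> {C \<in> cl ` X. \<phi> C \<in> U}} = {V \<in> X. \<phi> (cl V) \<in> U}" by blast
  ultimately show "openin (quotient_topology zar cl) {C \<in> cl ` X. \<phi> C \<in> U}"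
    unfolding openin_quotient_topology topspaces by auto
qed

end

text \<open>With sections in both directions, the relations of meeting orbit closures correspond, so
  \<open>R\<close> induces mutually inverse bijections between the classes.\<close>

theorem git_quotient_isomorphic:
  assumes "orbit_correspondence Q d X Q' d' X' R" "orbit_correspondence Q' d' X' Q d X (\<lambda>W V. R V W)"
  shows "git_quotient Q d X \<simeq>\<^sub>v git_quotient Q' d' X'"
proof -
  interpret F: orbit_correspondence Q d X Q' d' X' R by fact
  interpret B: orbit_correspondence Q' d' X' Q d X "\<lambda>W V. R V W" by fact
  define \<phi> where "\<phi> C = {W. \<exists>V\<in>C. R V W}" for C
  define \<psi> where "\<psi> C = {V. \<exists>W\<in>C. R V W}" for C
  have iff: "V2 \<in> F.cl V1 \<longleftrightarrow> W2 \<in> F.cl' W1" if "R V1 W1" "R V2 W2" for V1 W1 V2 W2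
    using F.git_class_transfer[OF that] B.git_class_transfer[OF that] by blast
  have cl_sub: "F.cl V \<subseteq> X" "F.cl' W \<subseteq> X'" for V W by (auto simp: git_class_def)
  have \<phi>: "\<phi> (F.cl V) = F.cl' W" if "R V W" for V W
    unfolding \<phi>_def using iff[OF that] B.total cl_sub(2) by blast
  have \<psi>: "\<psi> (F.cl' W) = F.cl V" if "R V W" for V W
    unfolding \<psi>_def using iff[OF that] F.total cl_sub(1) by blast
  have "homeomorphic_maps (quotient_topology F.zar F.cl) (quotient_topology F.zar' F.cl') \<phi> \<psi>"
    unfolding homeomorphic_maps_def topspace_quotient_topology F.topspaces
  proof (intro conjI ballI)
    show "continuous_map (quotient_topology F.zar F.cl) (quotient_topology F.zar' F.cl') \<phi>"
      by (rule F.quotient_continuous) (rule \<phi>)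
    show "continuous_map (quotient_topology F.zar' F.cl') (quotient_topology F.zar F.cl) \<psi>"
      by (rule B.quotient_continuous) (rule \<psi>)
    fix C assume "C \<in> F.cl ` X"
    then obtain V where "C = F.cl V" "V \<in> X" by (rule imageE)
    moreover from this(2) obtain W where "R V W" using F.total by blast
    ultimately show "\<psi> (\<phi> C) = C" by (simp add: \<phi> \<psi>)
  next
    fix C assume "C \<in> F.cl' ` X'"
    then obtain W where "C = F.cl' W" "W \<in> X'" by (rule imageE)
    moreover from this(2) obtain V where "R V W" using B.total by blast
    ultimately show "\<phi> (\<psi> C) = C" by (simp add: \<phi> \<psi>)
  qed
  then have hom: "homeomorphic_map (quotient_topology F.zar F.cl) (quotient_topology F.zar' F.cl') \<phi>"
    using homeomorphic_maps_map by blast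
  have "f \<circ> F.cl' \<in> regular_functions Q' d' {V \<in> X'. F.cl' V \<in> U} \<longleftrightarrow>
      f \<circ> \<phi> \<circ> F.cl \<in> regular_functions Q d {V \<in> X. F.cl V \<in> {C \<in> F.cl ` X. \<phi> C \<in> U}}" for U f
  proof -
    have YY: "V \<in> {V \<in> X. F.cl V \<in> {C \<in> F.cl ` X. \<phi> C \<in> U}} \<longleftrightarrow> W \<in> {V \<in> X'. F.cl' V \<in> U}" if "R V W" for V W
      using \<phi>[OF that] F.dom[OF that] F.cod[OF that] by auto
    have FF: "(f \<circ> \<phi> \<circ> F.cl) V = (f \<circ> F.cl') W" if "R V W" for V W using \<phi>[OF that] by simp
    show ?thesis
    proof
      assume "f \<circ> F.cl' \<in> regular_functions Q' d' {V \<in> X'. F.cl' V \<in> U}"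
      then show "f \<circ> \<phi> \<circ> F.cl \<in> regular_functions Q d {V \<in> X. F.cl V \<in> {C \<in> F.cl ` X. \<phi> C \<in> U}}"
        by (rule F.regular_transfer[rotated 4]) (use YY FF in auto)
    next
      assume "f \<circ> \<phi> \<circ> F.cl \<in> regular_functions Q d {V \<in> X. F.cl V \<in> {C \<in> F.cl ` X. \<phi> C \<in> U}}"
      then show "f \<circ> F.cl' \<in> regular_functions Q' d' {V \<in> X'. F.cl' V \<in> U}"
        by (rule B.regular_transfer[rotated 4]) (use YY FF in auto)
    qed
  qed
  then show ?thesis
    unfolding isomorphic_spaces_def git_quotient_def
    using hom by (intro exI[of _ \<phi>]) (simp add: F.topspaces del: topspace_subtopology)
qed


section \<open>Semistability and base change\<close>

lemma subrep_dim_eq: "subrep_dim d U i = sdim (d i) (U i)" by (simp add: subrep_dim_def)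

lemma self_stability_eq:
  "self_stability Q d e = (\<Sum>\<alpha>\<in>arcs Q. e (tail Q \<alpha>) * int (d (head Q \<alpha>)) - int (d (tail Q \<alpha>)) * e (head Q \<alpha>))"
  by (simp add: self_stability_def antisym_euler_form_def euler_form_def sum_subtractf mult.commute)

lemma self_stability_self: "self_stability Q d (\<lambda>i. int (d i)) = 0"
  by (simp add: self_stability_def antisym_euler_form_def)

lemma self_stability_zero:
  assumes "fin_digraph Q" "\<And>i. i \<in> verts Q \<Longrightarrow> e i = 0"
  shows "self_stability Q d e = 0"
proof -
  interpret fin_digraph Q by fact
  show ?thesis using assms(2) by (simp add: self_stability_def antisym_euler_form_def euler_form_def)
qed

lemma self_stability_cong:
  assumes "fin_digraph Q" "\<And>i. i \<in> verts Q \<Longrightarrow> e i = e' i"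
  shows "self_stability Q d e = self_stability Q d e'"
proof -
  interpret fin_digraph Q by fact
  show ?thesis using assms(2) by (simp add: self_stability_def antisym_euler_form_def euler_form_def)
qed

abbreviation dimvec :: "('v \<Rightarrow> nat) \<Rightarrow> ('v \<Rightarrow> complex vec set) \<Rightarrow> 'v \<Rightarrow> int" where
  "dimvec d U \<equiv> \<lambda>i. int (subrep_dim d U i)"

text \<open>For \<open>\<theta> = {d, _}\<close> the slope of \<open>d\<close> is zero, so only the sign of \<open>\<theta>\<close> on subrepresentations counts.
  The zero and the full subrepresentation have \<open>\<theta> = 0\<close> and may be included.\<close>

lemma semistable_iff:
  assumes Q: "fin_digraph Q"
  shows "semistable Q (self_stability Q d) d V \<longleftrightarrow>
    (\<forall>U. subrep Q d V U \<longrightarrow> self_stability Q d (dimvec d U) \<le> 0)"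
proof -
  interpret fin_digraph Q by fact
  let ?\<theta> = "\<lambda>U. self_stability Q d (dimvec d U)"
  have slope_d: "slope Q (self_stability Q d) d = 0" by (simp add: slope_def self_stability_self)
  have slope: "slope Q (self_stability Q d) (subrep_dim d U) \<le> 0 \<longleftrightarrow> ?\<theta> U \<le> 0" for U
  proof (cases "(\<Sum>i\<in>verts Q. subrep_dim d U i) = 0")
    case True
    then have "?\<theta> U = 0" by (intro self_stability_zero[OF Q]) auto
    then show ?thesis by (simp add: slope_def)
  next
    case False
    then have "(0 :: rat) < of_nat (\<Sum>i\<in>verts Q. subrep_dim d U i)" by (metis of_nat_0_less_iff neq0_conv)
    then show ?thesis unfolding slope_def
      by (metis divide_le_0_iff not_less of_int_le_0_iff order.asym)
  qed
  have zero: "?\<theta> U = 0" if "\<forall>i\<in>verts Q. U i = {0\<^sub>v (d i)}" for U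
    using that by (intro self_stability_zero[OF Q]) (simp add: subrep_dim_eq)
  have full: "?\<theta> U = 0" if "\<forall>i\<in>verts Q. U i = carrier_vec (d i)" for U
  proof -
    have "?\<theta> U = self_stability Q d (\<lambda>i. int (d i))"
      using that by (intro self_stability_cong[OF Q]) (simp add: subrep_dim_eq)
    then show ?thesis by (simp add: self_stability_self)
  qed
  show ?thesis unfolding semistable_def slope_d slope using zero full by (metis order.refl)
qed

lemma GL_mat_carrier:
  "g \<in> carrier (GL_mat k) \<longleftrightarrow> g \<in> carrier_mat k k \<and> (\<exists>h\<in>carrier_mat k k. g * h = 1\<^sub>m k \<and> h * g = 1\<^sub>m k)"
  by (auto simp: GL_mat_def units_of_carrier Units_def ring_mat_simps)

lemma GL_mat_inv:
  assumes "g \<in> carrier_mat k k" "h \<in> carrier_mat k k" "g * h = 1\<^sub>m k" "h * g = 1\<^sub>m k"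
  shows "inv\<^bsub>GL_mat k\<^esub> g = h"
proof -
  interpret r: ring "ring_mat TYPE(complex) k ()" by (rule ring_mat)
  interpret G: group "GL_mat k" unfolding GL_mat_def by (rule r.units_group)
  have "g \<in> carrier (GL_mat k)" "h \<in> carrier (GL_mat k)" using assms by (auto simp: GL_mat_carrier)
  then show ?thesis
    using assms by (intro G.inv_equality) (auto simp: GL_mat_def units_of_mult units_of_one ring_mat_simps)
qed

text \<open>An element of \<open>GL_mat k\<close> together with its inverse, so that equations between matrices need not
  mention the inverse in a group structure.\<close>

definition inverse_pair :: "nat \<Rightarrow> complex mat \<Rightarrow> complex mat \<Rightarrow> bool" where
  "inverse_pair k g h \<longleftrightarrow> g \<in> carrier_mat k k \<and> h \<in> carrier_mat k k \<and> g * h = 1\<^sub>m k \<and> h * g = 1\<^sub>m k"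

lemma base_change_orbit_iff:
  assumes "wf_digraph Q" and W: "W \<in> rep_space Q d"
  shows "W \<in> base_change_orbit Q d V \<longleftrightarrow>
    (\<exists>g h. (\<forall>i\<in>verts Q. inverse_pair (d i) (g i) (h i)) \<and>
       (\<forall>\<alpha>\<in>arcs Q. W \<alpha> = g (head Q \<alpha>) * V \<alpha> * h (tail Q \<alpha>)))"
    (is "?l \<longleftrightarrow> ?r")
proof -
  interpret wf_digraph Q by fact
  have inv: "inv\<^bsub>GL_mat (d i)\<^esub> (g i) = h i" if "inverse_pair (d i) (g i) (h i)" for i g h
    using that GL_mat_inv unfolding inverse_pair_def by blast
  show ?thesis
  proof
    assume ?l
    then obtain g where g: "g \<in> (\<Pi>\<^sub>E i\<in>verts Q. carrier (GL_mat (d i)))" and Wg: "W = base_change Q d g V"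
      by (auto simp: orbit_def base_change_group_def)
    have "\<forall>i\<in>verts Q. \<exists>h. inverse_pair (d i) (g i) h"
      using g unfolding inverse_pair_def GL_mat_carrier PiE_iff by metis
    then obtain h where h: "\<forall>i\<in>verts Q. inverse_pair (d i) (g i) (h i)" by metis
    then have "\<forall>\<alpha>\<in>arcs Q. W \<alpha> = g (head Q \<alpha>) * V \<alpha> * h (tail Q \<alpha>)"
      unfolding Wg base_change_def using inv[of "tail Q _" g h] by simp
    with h show ?r by blast
  next
    assume ?r
    then obtain g h where gh: "\<forall>i\<in>verts Q. inverse_pair (d i) (g i) (h i)"
      "\<forall>\<alpha>\<in>arcs Q. W \<alpha> = g (head Q \<alpha>) * V \<alpha> * h (tail Q \<alpha>)" by blast
    have "g i \<in> carrier (GL_mat (d i))" if "i \<in> verts Q" for i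
    proof -
      have p: "inverse_pair (d i) (g i) (h i)" using gh(1) that by (rule bspec)
      show ?thesis unfolding GL_mat_carrier
        by (intro conjI bexI[of _ "h i"]) (use p in \<open>simp_all add: inverse_pair_def\<close>)
    qed
    then have "restrict g (verts Q) \<in> carrier (base_change_group Q d)"
      by (simp add: base_change_group_def)
    moreover have "W = base_change Q d (restrict g (verts Q)) V"
    proof (rule ext)
      fix \<alpha>
      show "W \<alpha> = base_change Q d (restrict g (verts Q)) V \<alpha>"
      proof (cases "\<alpha> \<in> arcs Q")
        case True
        then show ?thesis using gh inv[of "tail Q \<alpha>" g h] by (simp add: base_change_def)
      next
        case False
        then show ?thesis using W by (simp add: base_change_def rep_space_def PiE_def extensional_def)
      qed
    qed
    ultimately show ?l by (auto simp: orbit_def)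
  qed
qed

lemma function_algebra_poly: "function_algebra (poly_functions Q d)"
  by unfold_locales (auto intro: poly_functions.intros)

context blocks
begin

text \<open>A base change at the tails cancels between the incoming and the outgoing blocks.\<close>

lemma row_col_blocks_gauge:
  assumes A: "\<And>a. a \<in> K \<Longrightarrow> A a \<in> carrier_mat r (n a)"
    and B: "\<And>a. a \<in> K \<Longrightarrow> B a \<in> carrier_mat (n a) k"
    and gh: "\<And>a. a \<in> K \<Longrightarrow> inverse_pair (n a) (g a) (h a)"
  shows "row_blocks r (\<lambda>a. A a * h a) * col_blocks k (\<lambda>a. g a * B a) = row_blocks r A * col_blocks k B"
proof (rule row_col_blocks_cong)
  fix a assume a: "a \<in> K"
  have g: "g a \<in> carrier_mat (n a) (n a)" and h: "h a \<in> carrier_mat (n a) (n a)" and hg: "h a * g a = 1\<^sub>m (n a)"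
    using gh[OF a] by (auto simp: inverse_pair_def)
  show "A a * h a \<in> carrier_mat r (n a)" "g a * B a \<in> carrier_mat (n a) k" using A[OF a] B[OF a] g h by auto
  have "A a * h a * (g a * B a) = A a * (h a * (g a * B a))"
    using A[OF a] B[OF a] g h by (intro assoc_mult_mat) auto
  also have "h a * (g a * B a) = h a * g a * B a"
    using B[OF a] g h by (intro assoc_mult_mat[symmetric]) auto
  finally show "A a * h a * (g a * B a) = A a * B a" using hg B[OF a] by simp
qed (use A B in auto)

end


section \<open>Reflection at a sink\<close>

definition arrow_dim_sum :: "('v, 'a) pre_digraph \<Rightarrow> 'v \<Rightarrow> ('v \<Rightarrow> nat) \<Rightarrow> nat" where
  "arrow_dim_sum Q j d = (\<Sum>\<alpha>\<in>{\<alpha> \<in> arcs Q. head Q \<alpha> = j}. d (tail Q \<alpha>))"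

definition reflect_quiver :: "('v, 'a) pre_digraph \<Rightarrow> 'v \<Rightarrow> ('v, 'a) pre_digraph" where
  "reflect_quiver Q j = \<lparr>verts = verts Q, arcs = arcs Q,
     tail = (\<lambda>\<alpha>. if head Q \<alpha> = j then j else tail Q \<alpha>),
     head = (\<lambda>\<alpha>. if head Q \<alpha> = j then tail Q \<alpha> else head Q \<alpha>)\<rparr>"

definition reflect_dim :: "('v, 'a) pre_digraph \<Rightarrow> 'v \<Rightarrow> ('v \<Rightarrow> nat) \<Rightarrow> 'v \<Rightarrow> nat" where
  "reflect_dim Q j d = d(j := arrow_dim_sum Q j d - d j)"

lemma reflect_quiver_simps [simp]:
  "verts (reflect_quiver Q j) = verts Q" "arcs (reflect_quiver Q j) = arcs Q"
  "tail (reflect_quiver Q j) \<alpha> = (if head Q \<alpha> = j then j else tail Q \<alpha>)"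
  "head (reflect_quiver Q j) \<alpha> = (if head Q \<alpha> = j then tail Q \<alpha> else head Q \<alpha>)"
  by (auto simp: reflect_quiver_def)

text \<open>The condition on \<open>d j\<close> makes the subtraction in \<open>reflect_dim\<close> exact.\<close>

locale sink_reflection = fin_digraph Q for Q :: "('v, 'a) pre_digraph" +
  fixes d :: "'v \<Rightarrow> nat" and j :: 'v
  assumes j: "j \<in> verts Q" and sink: "\<alpha> \<in> arcs Q \<Longrightarrow> tail Q \<alpha> \<noteq> j"
    and dj: "d j \<le> arrow_dim_sum Q j d"
begin

abbreviation K :: "'a set" where "K \<equiv> {\<alpha> \<in> arcs Q. head Q \<alpha> = j}"
abbreviation "Q' \<equiv> reflect_quiver Q j"
abbreviation "d' \<equiv> reflect_dim Q j d"
abbreviation "\<theta> \<equiv> self_stability Q d"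
abbreviation "\<theta>' \<equiv> self_stability Q' d'"
abbreviation e :: nat where "e \<equiv> arrow_dim_sum Q j d - d j"

sublocale blocks K "\<lambda>\<alpha>. d (tail Q \<alpha>)" by unfold_locales simp

lemma N_eq: "N = d j + e" "N = arrow_dim_sum Q j d"
  using dj by (simp_all add: N_def arrow_dim_sum_def)

lemma fin_reflect: "fin_digraph Q'"
proof
  show "finite (verts Q')" "finite (arcs Q')" by simp_all
  fix \<alpha> assume "\<alpha> \<in> arcs Q'"
  then have "\<alpha> \<in> arcs Q" by simp
  from tail_in_verts[OF this] head_in_verts[OF this] j
  show "tail Q' \<alpha> \<in> verts Q'" "head Q' \<alpha> \<in> verts Q'" by auto
qed

lemma d'_j [simp]: "d' j = e" and d'_other [simp]: "i \<noteq> j \<Longrightarrow> d' i = d i"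
  by (simp_all add: reflect_dim_def)

abbreviation "in_mat \<equiv> row_blocks (d j)"
abbreviation "out_mat \<equiv> col_blocks e"

text \<open>\<open>in_mat V\<close> and \<open>out_mat W\<close> are the maps \<open>\<Phi> : \<complex>\<^sup>N \<rightarrow> \<complex>\<^sup>d\<close> and \<open>\<Psi> : \<complex>\<^sup>e \<rightarrow> \<complex>\<^sup>N\<close> formed by all arrows at \<open>j\<close>.\<close>

definition paired :: "('a \<Rightarrow> complex mat) \<Rightarrow> ('a \<Rightarrow> complex mat) \<Rightarrow> bool" where
  "paired V W \<longleftrightarrow> V \<in> rep_space Q d \<and> W \<in> rep_space Q' d' \<and>
     (\<forall>\<alpha>\<in>arcs Q - K. W \<alpha> = V \<alpha>) \<and> in_mat V * out_mat W = 0\<^sub>m (d j) e"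

lemma rep_carrier_K:
  assumes "V \<in> rep_space Q d" "\<alpha> \<in> K"
  shows "V \<alpha> \<in> carrier_mat (d j) (d (tail Q \<alpha>))"
  using rep_carrier[OF assms(1), of \<alpha>] assms(2) by simp

lemma rep'_carrier_K:
  assumes W: "W \<in> rep_space Q' d'" and \<alpha>: "\<alpha> \<in> K"
  shows "W \<alpha> \<in> carrier_mat (d (tail Q \<alpha>)) e"
proof -
  have "W \<alpha> \<in> carrier_mat (d' (head Q' \<alpha>)) (d' (tail Q' \<alpha>))"
    using W \<alpha> unfolding rep_space_def by (intro PiE_mem[of W "arcs Q'"]) auto
  then show ?thesis using \<alpha> sink by simp
qed

lemma rep'_carrier_other:
  assumes W: "W \<in> rep_space Q' d'" and \<alpha>: "\<alpha> \<in> arcs Q - K"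
  shows "W \<alpha> \<in> carrier_mat (d (head Q \<alpha>)) (d (tail Q \<alpha>))"
proof -
  have "W \<alpha> \<in> carrier_mat (d' (head Q' \<alpha>)) (d' (tail Q' \<alpha>))"
    using W \<alpha> unfolding rep_space_def by (intro PiE_mem[of W "arcs Q'"]) auto
  then show ?thesis using \<alpha> sink by simp
qed

lemma rep'_intro:
  assumes "\<And>\<alpha>. \<alpha> \<in> K \<Longrightarrow> W \<alpha> \<in> carrier_mat (d (tail Q \<alpha>)) e"
    and "\<And>\<alpha>. \<alpha> \<in> arcs Q - K \<Longrightarrow> W \<alpha> \<in> carrier_mat (d (head Q \<alpha>)) (d (tail Q \<alpha>))"
    and "\<And>\<alpha>. \<alpha> \<notin> arcs Q \<Longrightarrow> W \<alpha> = undefined"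
  shows "W \<in> rep_space Q' d'"
  unfolding rep_space_def PiE_iff extensional_def
proof (intro conjI ballI)
  fix \<alpha> assume "\<alpha> \<in> arcs Q'"
  then show "W \<alpha> \<in> carrier_mat (d' (head Q' \<alpha>)) (d' (tail Q' \<alpha>))"
    using assms(1,2)[of \<alpha>] sink[of \<alpha>] by (cases "head Q \<alpha> = j") simp_all
qed (use assms(3) in simp)

definition off_sum :: "('v \<Rightarrow> int) \<Rightarrow> int" where
  "off_sum f = (\<Sum>\<alpha>\<in>arcs Q - K. f (tail Q \<alpha>) * int (d (head Q \<alpha>)) - int (d (tail Q \<alpha>)) * f (head Q \<alpha>))"

definition in_sum :: "('v \<Rightarrow> int) \<Rightarrow> int" where
  "in_sum f = (\<Sum>\<alpha>\<in>K. f (tail Q \<alpha>))"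

lemma stability_source:
  "\<theta> f = off_sum f + int (d j) * in_sum f - int N * f j"
proof -
  have "\<theta> f
      = off_sum f + (\<Sum>\<alpha>\<in>K. f (tail Q \<alpha>) * int (d (head Q \<alpha>)) - int (d (tail Q \<alpha>)) * f (head Q \<alpha>))"
    unfolding self_stability_eq off_sum_def
    by (rule sum.subset_diff) auto
  also have "(\<Sum>\<alpha>\<in>K. f (tail Q \<alpha>) * int (d (head Q \<alpha>)) - int (d (tail Q \<alpha>)) * f (head Q \<alpha>))
      = (\<Sum>\<alpha>\<in>K. int (d j) * f (tail Q \<alpha>) - int (d (tail Q \<alpha>)) * f j)"
    by (intro sum.cong) auto
  also have "\<dots> = int (d j) * in_sum f - int N * f j"
    by (simp add: sum_subtractf in_sum_def N_def sum_distrib_left sum_distrib_right)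
  finally show ?thesis by simp
qed

lemma stability_target:
  "\<theta>' f = off_sum f - int e * in_sum f + int N * f j"
proof -
  let ?t = "\<lambda>\<alpha>. f (tail Q' \<alpha>) * int (d' (head Q' \<alpha>)) - int (d' (tail Q' \<alpha>)) * f (head Q' \<alpha>)"
  have "\<theta>' f = (\<Sum>\<alpha>\<in>arcs Q. ?t \<alpha>)"
    using self_stability_eq[of Q' d' f] by simp
  also have "\<dots> = (\<Sum>\<alpha>\<in>arcs Q - K. ?t \<alpha>) + (\<Sum>\<alpha>\<in>K. ?t \<alpha>)"
    by (rule sum.subset_diff) auto
  also have "(\<Sum>\<alpha>\<in>arcs Q - K. ?t \<alpha>) = off_sum f"
    unfolding off_sum_def by (intro sum.cong) (use sink in auto)
  also have "(\<Sum>\<alpha>\<in>K. ?t \<alpha>) = (\<Sum>\<alpha>\<in>K. int (d (tail Q \<alpha>)) * f j - int e * f (tail Q \<alpha>))"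
    by (intro sum.cong) (use sink in auto)
  also have "\<dots> = int N * f j - int e * in_sum f"
    unfolding sum_subtractf in_sum_def N_def of_nat_sum sum_distrib_right sum_distrib_left ..
  finally show ?thesis by simp
qed

text \<open>If \<open>f\<close> and \<open>f'\<close> are exchanged by the reflection, that is \<open>f j + f' j\<close> is the sum of \<open>f\<close> over the tails,
  then \<open>\<theta> f = \<theta>' f'\<close>. In general the defect decides which of the two is larger.\<close>

lemma stability_compare:
  assumes "\<And>i. i \<noteq> j \<Longrightarrow> f' i = f i"
  shows "\<theta>' f' - \<theta> f = int N * (f' j + f j - in_sum f)"
proof -
  have "off_sum f' = off_sum f" unfolding off_sum_def by (intro sum.cong) (use assms sink in auto)
  moreover have "in_sum f' = in_sum f" unfolding in_sum_def by (intro sum.cong) (use assms sink in auto)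
  moreover have "int (d j) + int e = int N" using N_eq(1) by simp
  then have "int N * in_sum f = int (d j) * in_sum f + int e * in_sum f" by (metis distrib_right)
  ultimately show ?thesis unfolding stability_source stability_target by (simp add: algebra_simps)
qed

lemma sub_lin:
  assumes "subrep Q d V U" "i \<in> verts Q" shows "lin_sub (d i) (U i)"
  using assms by (simp add: subrep_def)

lemma sub_lin':
  assumes "subrep Q' d' W U" "i \<in> verts Q" "i \<noteq> j" shows "lin_sub (d i) (U i)"
  using assms unfolding subrep_def by (metis d'_other reflect_quiver_simps(1))

lemma sub_lin'_j:
  assumes "subrep Q' d' W U" shows "lin_sub e (U j)"
  using assms j unfolding subrep_def by (metis d'_j reflect_quiver_simps(1))

lemma subrep_arrow:
  assumes "subrep Q' d' W U" "\<alpha> \<in> arcs Q"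
  shows "\<forall>u\<in>U (tail Q' \<alpha>). W \<alpha> *\<^sub>v u \<in> U (head Q' \<alpha>)"
  using assms unfolding subrep_def reflect_quiver_simps(2) by blast

lemma tail_K: "\<alpha> \<in> K \<Longrightarrow> tail Q \<alpha> \<in> verts Q" "\<alpha> \<in> K \<Longrightarrow> tail Q \<alpha> \<noteq> j"
  using sink by (auto)

lemma out_mat_zero: "out_mat W *\<^sub>v 0\<^sub>v e = 0\<^sub>v N"
  by (auto simp: col_blocks_def)

text \<open>The image of \<open>\<Phi>\<close> at \<open>j\<close> and the full space at the other vertices form a subrepresentation. The
  coefficient of \<open>\<theta>\<close> at \<open>j\<close> is \<open>- N\<close>, so a proper image would give \<open>\<theta> > 0\<close> if \<open>N > 0\<close>; and if \<open>N = 0\<close>, then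
  \<open>d j = 0\<close>.\<close>

lemma semistable_surjective:
  assumes V: "V \<in> rep_space Q d" and ss: "semistable Q \<theta> d V"
  shows "\<exists>P\<in>carrier_mat N (d j). in_mat V * P = 1\<^sub>m (d j)"
proof -
  let ?I = "(\<lambda>x. in_mat V *\<^sub>v x) ` carrier_vec N"
  define U where "U = (\<lambda>i. carrier_vec (d i))(j := ?I)"
  have I: "lin_sub (d j) ?I" by (rule lin_sub_image[OF carriers(2) lin_sub_carrier])
  have "subrep Q d V U" unfolding subrep_def
  proof (intro conjI ballI)
    show "lin_sub (d i) (U i)" if "i \<in> verts Q" for i using I by (simp add: U_def)
    fix \<alpha> u assume \<alpha>: "\<alpha> \<in> arcs Q" and u: "u \<in> U (tail Q \<alpha>)"
    have uc: "u \<in> carrier_vec (d (tail Q \<alpha>))" using u sink[OF \<alpha>] by (simp add: U_def)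
    show "V \<alpha> *\<^sub>v u \<in> U (head Q \<alpha>)"
    proof (cases "head Q \<alpha> = j")
      case True
      then have "V \<alpha> *\<^sub>v u = in_mat V *\<^sub>v emb \<alpha> u"
        using row_blocks_emb[of V "d j" \<alpha> u] rep_carrier_K[OF V] \<alpha> uc by simp
      then show ?thesis using True by (simp add: U_def)
    next
      case False
      then show ?thesis using rep_carrier[OF V \<alpha>] uc by (simp add: U_def)
    qed
  qed
  then have "\<theta> (dimvec d U) \<le> 0"
    using ss unfolding semistable_iff[OF fin_digraph_axioms] by blast
  moreover have "\<theta> (\<lambda>i. int (d i)) = 0" by (rule self_stability_self)
  moreover have "off_sum (dimvec d U) = off_sum (\<lambda>i. int (d i))"
    unfolding off_sum_def by (intro sum.cong) (use sink in \<open>auto simp: subrep_dim_eq U_def\<close>)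
  moreover have "in_sum (dimvec d U) = in_sum (\<lambda>i. int (d i))"
    unfolding in_sum_def by (intro sum.cong) (use sink in \<open>auto simp: subrep_dim_eq U_def\<close>)
  ultimately have "int N * int (d j) \<le> int N * int (sdim (d j) ?I)"
    unfolding stability_source by (simp add: subrep_dim_eq U_def)
  moreover have "sdim (d j) ?I \<le> d j"
    using sdim_mono[OF I lin_sub_carrier] I by (simp add: lin_sub_iff)
  ultimately have "sdim (d j) ?I = d j" using N_eq by (cases "N = 0") auto
  then have "?I = carrier_vec (d j)" by (rule sdim_eq_full[OF I])
  then show ?thesis by (rule right_inverse_of_surjective[OF carriers(2)])
qed

text \<open>Dually, the kernel of \<open>\<Psi>\<close> at \<open>j\<close> and zero elsewhere form a subrepresentation, and the coefficient
  of \<open>\<theta>'\<close> at \<open>j\<close> is \<open>+ N\<close>. If \<open>N = 0\<close>, then \<open>e = 0\<close>.\<close>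

lemma semistable_injective:
  assumes W: "W \<in> rep_space Q' d'" and ss: "semistable Q' \<theta>' d' W"
  shows "\<exists>L\<in>carrier_mat e N. L * out_mat W = 1\<^sub>m e"
proof -
  let ?I = "{w \<in> carrier_vec e. out_mat W *\<^sub>v w = 0\<^sub>v N}"
  define U where "U = (\<lambda>i. {0\<^sub>v (d i)})(j := ?I)"
  have I: "lin_sub e ?I" by (rule lin_sub_kernel[OF carriers(3) lin_sub_carrier])
  have "subrep Q' d' W U" unfolding subrep_def
  proof (intro conjI ballI)
    show "lin_sub (d' i) (U i)" if "i \<in> verts Q'" for i using I by (cases "i = j") (simp_all add: U_def)
    fix \<alpha> u assume "\<alpha> \<in> arcs Q'" and u: "u \<in> U (tail Q' \<alpha>)"
    then have \<alpha>: "\<alpha> \<in> arcs Q" by simp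
    show "W \<alpha> *\<^sub>v u \<in> U (head Q' \<alpha>)"
    proof (cases "head Q \<alpha> = j")
      case True
      then have u': "u \<in> carrier_vec e" "out_mat W *\<^sub>v u = 0\<^sub>v N" using u by (simp_all add: U_def)
      have "W \<alpha> *\<^sub>v u = sel \<alpha> *\<^sub>v 0\<^sub>v N"
        using sel_col_blocks_vec[of \<alpha> W e u] rep'_carrier_K[OF W] True \<alpha> u' by simp
      also have "\<dots> = 0\<^sub>v (d (tail Q \<alpha>))" by (auto simp: sel_def)
      finally show ?thesis using True sink[OF \<alpha>] by (simp add: U_def)
    next
      case False
      then have "u = 0\<^sub>v (d (tail Q \<alpha>))" using u sink[OF \<alpha>] by (simp add: U_def)
      moreover have "W \<alpha> *\<^sub>v 0\<^sub>v (d (tail Q \<alpha>)) = 0\<^sub>v (d (head Q \<alpha>))"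
        using rep'_carrier_other[OF W, of \<alpha>] \<alpha> False by auto
      ultimately show ?thesis using False by (simp add: U_def)
    qed
  qed
  then have "\<theta>' (\<lambda>i. int (subrep_dim d' U i)) \<le> 0"
    using ss unfolding semistable_iff[OF fin_reflect] by blast
  moreover have "off_sum (\<lambda>i. int (subrep_dim d' U i)) = 0"
    unfolding off_sum_def by (intro sum.neutral) (use sink in \<open>auto simp: subrep_dim_eq U_def\<close>)
  moreover have "in_sum (\<lambda>i. int (subrep_dim d' U i)) = 0"
    unfolding in_sum_def by (intro sum.neutral) (use sink in \<open>auto simp: subrep_dim_eq U_def\<close>)
  ultimately have le: "int N * int (sdim e ?I) \<le> 0"
    unfolding stability_target by (simp add: subrep_dim_eq U_def)
  have "sdim e ?I \<le> e"
    using sdim_mono[OF I lin_sub_carrier] by auto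
  then have "sdim e ?I = 0" using le N_eq(1) by (cases "N = 0") (auto simp: mult_le_0_iff)
  then have "?I = {0\<^sub>v e}" by (rule sdim_eq_zero[OF I])
  then show ?thesis by (intro left_inverse_of_injective[OF carriers(3)]) blast
qed

text \<open>Given a subrepresentation \<open>U'\<close> of \<open>W\<close>, keep it away from \<open>j\<close> and put \<open>\<Phi>(\<Oplus> U')\<close> at \<open>j\<close>. This is a
  subrepresentation \<open>U\<close> of \<open>V\<close>, and since \<open>\<Psi>\<close> embeds \<open>U'\<^sub>j\<close> into the kernel of \<open>\<Phi>\<close> on \<open>\<Oplus> U'\<close>, the rank-nullity
  theorem gives \<open>dim U\<^sub>j + dim U'\<^sub>j \<le> \<Sum> dim U'\<close>, so \<open>\<theta>'(U') \<le> \<theta>(U)\<close>. Conversely, from a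
  subrepresentation \<open>U\<close> of \<open>V\<close> one obtains \<open>U'\<close> with \<open>\<Psi>\<^sup>-\<^sup>1(\<Oplus> U)\<close> at \<open>j\<close>; by exactness \<open>\<Psi>\<close> maps it onto the
  kernel of \<open>\<Phi>\<close> on \<open>\<Oplus> U\<close>, and the inequality is reversed.\<close>

lemma semistable_reflect:
  assumes pair: "paired V W" and P: "P \<in> carrier_mat N (d j)" "in_mat V * P = 1\<^sub>m (d j)"
    and L: "L \<in> carrier_mat e N" "L * out_mat W = 1\<^sub>m e"
  shows "semistable Q \<theta> d V \<longleftrightarrow> semistable Q' \<theta>' d' W"
proof -
  have V: "V \<in> rep_space Q d" and W: "W \<in> rep_space Q' d'" and VW: "in_mat V * out_mat W = 0\<^sub>m (d j) e"
    and other: "\<And>\<alpha>. \<alpha> \<in> arcs Q \<Longrightarrow> head Q \<alpha> \<noteq> j \<Longrightarrow> W \<alpha> = V \<alpha>"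
    using pair by (auto simp: paired_def)
  have inj: "w = 0\<^sub>v e" if "w \<in> carrier_vec e" "out_mat W *\<^sub>v w = 0\<^sub>v N" for w
    by (rule injective_of_left_inverse[OF carriers(3) L that])
  have zero: "in_mat V *\<^sub>v (out_mat W *\<^sub>v w) = 0\<^sub>v (d j)" if "w \<in> carrier_vec e" for w
  proof -
    have "0\<^sub>m (d j) e *\<^sub>v w = 0\<^sub>v (d j)" using that by (intro eq_vecI) auto
    then show ?thesis
      using assoc_mult_mat_vec[OF carriers(2)[of "d j" V] carriers(3)[of e W] that] VW by simp
  qed
  have exact: "\<exists>w\<in>carrier_vec e. x = out_mat W *\<^sub>v w" if "x \<in> carrier_vec N" "in_mat V *\<^sub>v x = 0\<^sub>v (d j)" for x
    using kernel_vector_factors[OF N_eq(1) carriers(2) P carriers(3) L VW that] L(1) that(1)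
    by (intro bexI[of _ "L *\<^sub>v x"]) auto
  show ?thesis
  proof
    assume ss: "semistable Q \<theta> d V"
    show "semistable Q' \<theta>' d' W"
      unfolding semistable_iff[OF fin_reflect]
    proof (intro allI impI)
      fix U' assume U': "subrep Q' d' W U'"
      let ?P = "prod_sub (\<lambda>\<alpha>. U' (tail Q \<alpha>))"
      define U where "U = U'(j := (\<lambda>x. in_mat V *\<^sub>v x) ` ?P)"
      have linK: "lin_sub (d (tail Q \<alpha>)) (U' (tail Q \<alpha>))" if "\<alpha> \<in> K" for \<alpha>
        using sub_lin'[OF U' tail_K[OF that]] .
      have linP: "lin_sub N ?P" by (rule lin_sub_prod_sub[OF linK])
      have linU: "lin_sub (d j) ((\<lambda>x. in_mat V *\<^sub>v x) ` ?P)" by (rule lin_sub_image[OF carriers(2) linP])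
      have "subrep Q d V U" unfolding subrep_def
      proof (intro conjI ballI)
        show "lin_sub (d i) (U i)" if "i \<in> verts Q" for i
          using linU sub_lin'[OF U' that] by (cases "i = j") (simp_all add: U_def)
        fix \<alpha> u assume \<alpha>: "\<alpha> \<in> arcs Q" and u: "u \<in> U (tail Q \<alpha>)"
        then have u': "u \<in> U' (tail Q \<alpha>)" using sink by (simp add: U_def)
        show "V \<alpha> *\<^sub>v u \<in> U (head Q \<alpha>)"
        proof (cases "head Q \<alpha> = j")
          case True
          then have \<alpha>K: "\<alpha> \<in> K" using \<alpha> by simp
          have uc: "u \<in> carrier_vec (d (tail Q \<alpha>))" using u' linK[OF \<alpha>K] by (auto simp: lin_sub_iff)
          have "V \<alpha> *\<^sub>v u = in_mat V *\<^sub>v emb \<alpha> u"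
            by (rule row_blocks_emb[symmetric, OF rep_carrier_K[OF V] \<alpha>K uc])
          moreover have "emb \<alpha> u \<in> ?P"
            unfolding prod_sub_def using sel_emb[OF \<alpha>K _ uc] u' linK by (auto simp: lin_sub_iff)
          ultimately show ?thesis using True by (simp add: U_def)
        next
          case False
          have "\<forall>u\<in>U' (tail Q' \<alpha>). W \<alpha> *\<^sub>v u \<in> U' (head Q' \<alpha>)"
            using subrep_arrow[OF U', of \<alpha>] \<alpha> by simp
          then show ?thesis using False other[OF \<alpha>] u' by (simp add: U_def)
        qed
      qed
      then have le: "\<theta> (dimvec d U) \<le> 0"
        using ss unfolding semistable_iff[OF fin_digraph_axioms] by blast
      have rn: "sdim (d j) ((\<lambda>x. in_mat V *\<^sub>v x) ` ?P) + sdim N {x \<in> ?P. in_mat V *\<^sub>v x = 0\<^sub>v (d j)} = sdim N ?P"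
        by (rule rank_nullity_mat[OF carriers(2) linP])
      have lj: "lin_sub e (U' j)" by (rule sub_lin'_j[OF U'])
      have "(\<lambda>w. out_mat W *\<^sub>v w) ` U' j \<subseteq> {x \<in> ?P. in_mat V *\<^sub>v x = 0\<^sub>v (d j)}"
      proof (rule image_subsetI)
        fix w assume w: "w \<in> U' j"
        then have wc: "w \<in> carrier_vec e" using lj by (auto simp: lin_sub_iff)
        have "sel \<alpha> *\<^sub>v (out_mat W *\<^sub>v w) \<in> U' (tail Q \<alpha>)" if \<alpha>: "\<alpha> \<in> K" for \<alpha>
        proof -
          have "\<forall>u\<in>U' (tail Q' \<alpha>). W \<alpha> *\<^sub>v u \<in> U' (head Q' \<alpha>)"
            using subrep_arrow[OF U', of \<alpha>] \<alpha> by simp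
          then show ?thesis using \<alpha> w sel_col_blocks_vec[where B=W, OF \<alpha> rep'_carrier_K[OF W \<alpha>] wc] by simp
        qed
        moreover have "out_mat W *\<^sub>v w \<in> carrier_vec N" by (rule mult_mat_vec_carrier[OF carriers(3) wc])
        ultimately show "out_mat W *\<^sub>v w \<in> {x \<in> ?P. in_mat V *\<^sub>v x = 0\<^sub>v (d j)}"
          unfolding prod_sub_def using zero[OF wc] by blast
      qed
      then have "sdim N ((\<lambda>w. out_mat W *\<^sub>v w) ` U' j) \<le> sdim N {x \<in> ?P. in_mat V *\<^sub>v x = 0\<^sub>v (d j)}"
        by (intro sdim_mono lin_sub_image[OF carriers(3) lj] lin_sub_kernel[OF carriers(2) linP])
      moreover have "sdim N ((\<lambda>w. out_mat W *\<^sub>v w) ` U' j) = sdim e (U' j)"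
        by (rule sdim_image_injective[OF carriers(3) lj]) (use inj lj in \<open>auto simp: lin_sub_iff\<close>)
      ultimately have "sdim e (U' j) + sdim (d j) (U j) \<le> (\<Sum>\<alpha>\<in>K. sdim (d (tail Q \<alpha>)) (U' (tail Q \<alpha>)))"
        using rn sdim_prod_sub[of "\<lambda>\<alpha>. U' (tail Q \<alpha>)", OF linK] by (simp add: U_def)
      then have dims: "int (subrep_dim d' U' j) + int (subrep_dim d U j) - in_sum (dimvec d U) \<le> 0"
      proof -
        have "in_sum (dimvec d U) = (\<Sum>\<alpha>\<in>K. int (sdim (d (tail Q \<alpha>)) (U' (tail Q \<alpha>))))"
          unfolding in_sum_def by (intro sum.cong) (use sink in \<open>auto simp: subrep_dim_eq U_def\<close>)
        then show ?thesis
          using \<open>sdim e (U' j) + sdim (d j) (U j) \<le> _\<close> by (simp add: subrep_dim_eq flip: of_nat_sum)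
      qed
      have "\<theta>' (dimvec d' U') - \<theta> (dimvec d U)
          = int N * (int (subrep_dim d' U' j) + int (subrep_dim d U j) - in_sum (dimvec d U))"
        by (rule stability_compare) (simp add: subrep_dim_eq U_def)
      also have "\<dots> \<le> 0" using dims by (simp add: mult_le_0_iff)
      finally show "\<theta>' (dimvec d' U') \<le> 0" using le by simp
    qed
  next
    assume ss: "semistable Q' \<theta>' d' W"
    show "semistable Q \<theta> d V"
      unfolding semistable_iff[OF fin_digraph_axioms]
    proof (intro allI impI)
      fix U assume U: "subrep Q d V U"
      let ?P = "prod_sub (\<lambda>\<alpha>. U (tail Q \<alpha>))"
      let ?J = "{w \<in> carrier_vec e. out_mat W *\<^sub>v w \<in> ?P}"
      define U' where "U' = U(j := ?J)"
      have linK: "lin_sub (d (tail Q \<alpha>)) (U (tail Q \<alpha>))" if "\<alpha> \<in> K" for \<alpha>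
        using sub_lin[OF U tail_K(1)[OF that]] .
      have linP: "lin_sub N ?P" by (rule lin_sub_prod_sub[OF linK])
      have linJ: "lin_sub e ?J"
        using linP unfolding lin_sub_iff
        by (auto simp: out_mat_zero mult_add_distrib_mat_vec[OF carriers(3)] mult_mat_vec[OF carriers(3)])
      have lj: "lin_sub (d j) (U j)" by (rule sub_lin[OF U j])
      have "subrep Q' d' W U'" unfolding subrep_def
      proof (intro conjI ballI)
        show "lin_sub (d' i) (U' i)" if "i \<in> verts Q'" for i
          using linJ sub_lin[OF U] that by (cases "i = j") (simp_all add: U'_def)
        fix \<alpha> u assume "\<alpha> \<in> arcs Q'" and u: "u \<in> U' (tail Q' \<alpha>)"
        then have \<alpha>: "\<alpha> \<in> arcs Q" by simp
        show "W \<alpha> *\<^sub>v u \<in> U' (head Q' \<alpha>)"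
        proof (cases "head Q \<alpha> = j")
          case True
          then have \<alpha>K: "\<alpha> \<in> K" using \<alpha> by simp
          have u': "u \<in> carrier_vec e" "out_mat W *\<^sub>v u \<in> ?P" using u True by (simp_all add: U'_def)
          then have "sel \<alpha> *\<^sub>v (out_mat W *\<^sub>v u) \<in> U (tail Q \<alpha>)" using \<alpha>K unfolding prod_sub_def by blast
          then have "W \<alpha> *\<^sub>v u \<in> U (tail Q \<alpha>)"
            unfolding sel_col_blocks_vec[where B=W, OF \<alpha>K rep'_carrier_K[OF W \<alpha>K] u'(1)] .
          then show ?thesis using True sink[OF \<alpha>] by (simp add: U'_def)
        next
          case False
          then show ?thesis using U \<alpha> u other[OF \<alpha> False] sink[OF \<alpha>] by (simp add: U'_def subrep_def)
        qed
      qed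
      then have le: "\<theta>' (dimvec d' U') \<le> 0"
        using ss unfolding semistable_iff[OF fin_reflect] by blast
      have rn: "sdim (d j) ((\<lambda>x. in_mat V *\<^sub>v x) ` ?P) + sdim N {x \<in> ?P. in_mat V *\<^sub>v x = 0\<^sub>v (d j)} = sdim N ?P"
        by (rule rank_nullity_mat[OF carriers(2) linP])
      have "in_mat V *\<^sub>v x \<in> U j" if "x \<in> ?P" for x
      proof (rule row_blocks_prod_sub[OF rep_carrier_K[OF V] linK lj _ that])
        fix \<alpha> u assume "\<alpha> \<in> K" "u \<in> U (tail Q \<alpha>)"
        then show "V \<alpha> *\<^sub>v u \<in> U j" using U by (auto simp: subrep_def)
      qed
      then have 1: "sdim (d j) ((\<lambda>x. in_mat V *\<^sub>v x) ` ?P) \<le> sdim (d j) (U j)"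
        by (intro sdim_mono lin_sub_image[OF carriers(2) linP] lj) auto
      have "{x \<in> ?P. in_mat V *\<^sub>v x = 0\<^sub>v (d j)} = (\<lambda>w. out_mat W *\<^sub>v w) ` ?J"
      proof (rule subset_antisym)
        show "(\<lambda>w. out_mat W *\<^sub>v w) ` ?J \<subseteq> {x \<in> ?P. in_mat V *\<^sub>v x = 0\<^sub>v (d j)}" using zero by auto
        show "{x \<in> ?P. in_mat V *\<^sub>v x = 0\<^sub>v (d j)} \<subseteq> (\<lambda>w. out_mat W *\<^sub>v w) ` ?J"
        proof
          fix x assume x: "x \<in> {x \<in> ?P. in_mat V *\<^sub>v x = 0\<^sub>v (d j)}"
          then have "x \<in> carrier_vec N" by (simp add: prod_sub_def)
          with exact x obtain w where "w \<in> carrier_vec e" "x = out_mat W *\<^sub>v w" by blast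
          with x show "x \<in> (\<lambda>w. out_mat W *\<^sub>v w) ` ?J" by blast
        qed
      qed
      moreover have "sdim N ((\<lambda>w. out_mat W *\<^sub>v w) ` ?J) = sdim e ?J"
        by (rule sdim_image_injective[OF carriers(3) linJ]) (use inj in auto)
      ultimately have "(\<Sum>\<alpha>\<in>K. sdim (d (tail Q \<alpha>)) (U (tail Q \<alpha>))) \<le> sdim e (U' j) + sdim (d j) (U j)"
        using 1 rn sdim_prod_sub[of "\<lambda>\<alpha>. U (tail Q \<alpha>)", OF linK] by (simp add: U'_def)
      then have dims: "0 \<le> int (subrep_dim d' U' j) + int (subrep_dim d U j) - in_sum (dimvec d U)"
        unfolding in_sum_def subrep_dim_eq by (simp flip: of_nat_sum)
      have "\<theta>' (dimvec d' U') - \<theta> (dimvec d U)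
          = int N * (int (subrep_dim d' U' j) + int (subrep_dim d U j) - in_sum (dimvec d U))"
        by (rule stability_compare) (simp add: subrep_dim_eq U'_def)
      also have "\<dots> \<ge> 0" using dims by simp
      finally show "\<theta> (dimvec d U) \<le> 0" using le by simp
    qed
  qed
qed

abbreviation "X \<equiv> semistable_locus Q \<theta> d"
abbreviation "X' \<equiv> semistable_locus Q' \<theta>' d'"

definition related :: "('a \<Rightarrow> complex mat) \<Rightarrow> ('a \<Rightarrow> complex mat) \<Rightarrow> bool" where
  "related V W \<longleftrightarrow> V \<in> X \<and> W \<in> X' \<and> paired V W"

lemma X_right_inverse: "V \<in> X \<Longrightarrow> \<exists>P\<in>carrier_mat N (d j). in_mat V * P = 1\<^sub>m (d j)"
  using semistable_surjective by (simp add: semistable_locus_def)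

lemma X'_left_inverse: "W \<in> X' \<Longrightarrow> \<exists>L\<in>carrier_mat e N. L * out_mat W = 1\<^sub>m e"
  using semistable_injective by (simp add: semistable_locus_def)

text \<open>The candidates for the reflection of \<open>V\<close>: the arrows away from \<open>j\<close> are those of \<open>V\<close>, and those at \<open>j\<close>
  are the blocks of \<open>M\<close>.\<close>

definition with_out_mat :: "('a \<Rightarrow> complex mat) \<Rightarrow> complex mat \<Rightarrow> 'a \<Rightarrow> complex mat" where
  "with_out_mat V M = (\<lambda>\<alpha>\<in>arcs Q. if head Q \<alpha> = j then sel \<alpha> * M else V \<alpha>)"

definition with_in_mat :: "('a \<Rightarrow> complex mat) \<Rightarrow> complex mat \<Rightarrow> 'a \<Rightarrow> complex mat" where
  "with_in_mat W M = (\<lambda>\<alpha>\<in>arcs Q. if head Q \<alpha> = j then M * transpose_mat (sel \<alpha>) else W \<alpha>)"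

lemma related_with_out_mat:
  assumes V: "V \<in> X" and M: "M \<in> carrier_mat N e" and VM: "in_mat V * M = 0\<^sub>m (d j) e"
    and L: "L \<in> carrier_mat e N" "L * M = 1\<^sub>m e"
  shows "related V (with_out_mat V M)"
proof -
  let ?W = "with_out_mat V M"
  have Vr: "V \<in> rep_space Q d" and ss: "semistable Q \<theta> d V"
    using V by (auto simp: semistable_locus_def)
  have out: "out_mat ?W = M" by (rule col_blocks_sel[OF M]) (simp add: with_out_mat_def)
  have W: "?W \<in> rep_space Q' d'"
  proof (rule rep'_intro)
    show "?W \<alpha> \<in> carrier_mat (d (tail Q \<alpha>)) e" if "\<alpha> \<in> K" for \<alpha>
      using that mult_carrier_mat[OF carriers(1)[of \<alpha>] M] by (simp add: with_out_mat_def)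
    show "?W \<alpha> \<in> carrier_mat (d (head Q \<alpha>)) (d (tail Q \<alpha>))" if "\<alpha> \<in> arcs Q - K" for \<alpha>
      using that rep_carrier[OF Vr, of \<alpha>] by (simp add: with_out_mat_def)
  qed (simp add: with_out_mat_def)
  have pair: "paired V ?W"
    unfolding paired_def out using Vr W VM by (simp add: with_out_mat_def)
  obtain P where "P \<in> carrier_mat N (d j)" "in_mat V * P = 1\<^sub>m (d j)" using X_right_inverse[OF V] by blast
  then have "semistable Q' \<theta>' d' ?W"
    using semistable_reflect[OF pair _ _ L(1)] L(2) ss unfolding out by blast
  then show ?thesis using V W pair by (simp add: related_def semistable_locus_def)
qed

lemma related_with_in_mat:
  assumes W: "W \<in> X'" and M: "M \<in> carrier_mat (d j) N" and MW: "M * out_mat W = 0\<^sub>m (d j) e"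
    and P: "P \<in> carrier_mat N (d j)" "M * P = 1\<^sub>m (d j)"
  shows "related (with_in_mat W M) W"
proof -
  let ?V = "with_in_mat W M"
  have Wr: "W \<in> rep_space Q' d'" and ss: "semistable Q' \<theta>' d' W"
    using W by (auto simp: semistable_locus_def)
  have inm: "in_mat ?V = M" by (rule row_blocks_sel[OF M]) (simp add: with_in_mat_def)
  have V: "?V \<in> rep_space Q d"
    unfolding rep_space_def PiE_iff extensional_def
  proof (intro conjI ballI)
    fix \<alpha> assume \<alpha>: "\<alpha> \<in> arcs Q"
    show "?V \<alpha> \<in> carrier_mat (d (head Q \<alpha>)) (d (tail Q \<alpha>))"
    proof (cases "head Q \<alpha> = j")
      case True
      then show ?thesis using \<alpha> mult_carrier_mat[OF M, of "transpose_mat (sel \<alpha>)"] by (simp add: with_in_mat_def)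
    next
      case False
      then show ?thesis using \<alpha> rep'_carrier_other[OF Wr, of \<alpha>] by (simp add: with_in_mat_def)
    qed
  qed (simp add: with_in_mat_def)
  have pair: "paired ?V W"
    unfolding paired_def inm using Wr V MW by (simp add: with_in_mat_def)
  obtain L where "L \<in> carrier_mat e N" "L * out_mat W = 1\<^sub>m e" using X'_left_inverse[OF W] by blast
  then have "semistable Q \<theta> d ?V"
    using semistable_reflect[OF pair P(1)] P(2) ss unfolding inm by blast
  then show ?thesis using W V pair by (simp add: related_def semistable_locus_def)
qed

lemma with_out_mat_related:
  assumes "related V W" shows "with_out_mat V (out_mat W) = W"
proof (rule ext)
  fix \<alpha>
  have W: "W \<in> rep_space Q' d'" and other: "\<forall>\<alpha>\<in>arcs Q - K. W \<alpha> = V \<alpha>"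
    using assms by (auto simp: related_def paired_def)
  have "sel \<alpha> * out_mat W = W \<alpha>" if "\<alpha> \<in> K"
    using that rep'_carrier_K[OF W that] by (rule sel_col_blocks)
  moreover have "W \<alpha> = undefined" if "\<alpha> \<notin> arcs Q"
    using W that unfolding rep_space_def PiE_iff extensional_def by simp
  ultimately show "with_out_mat V (out_mat W) \<alpha> = W \<alpha>" using other by (simp add: with_out_mat_def)
qed

lemma with_in_mat_related:
  assumes "related V W" shows "with_in_mat W (in_mat V) = V"
proof (rule ext)
  fix \<alpha>
  have V: "V \<in> rep_space Q d" and other: "\<forall>\<alpha>\<in>arcs Q - K. W \<alpha> = V \<alpha>"
    using assms by (auto simp: related_def paired_def)
  have "in_mat V * transpose_mat (sel \<alpha>) = V \<alpha>" if "\<alpha> \<in> K"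
    using that rep_carrier_K[OF V that] by (rule row_blocks_sel_transpose)
  moreover have "V \<alpha> = undefined" if "\<alpha> \<notin> arcs Q"
    using V that unfolding rep_space_def PiE_iff extensional_def by simp
  ultimately show "with_in_mat W (in_mat V) \<alpha> = V \<alpha>" using other by (simp add: with_in_mat_def)
qed

lemma related_split:
  assumes "related V W"
  obtains P L where "P \<in> carrier_mat N (d j)" "in_mat V * P = 1\<^sub>m (d j)"
    "L \<in> carrier_mat e N" "L * out_mat W = 1\<^sub>m e" "in_mat V * out_mat W = 0\<^sub>m (d j) e"
  using assms X_right_inverse[of V] X'_left_inverse[of W] that by (auto simp: related_def paired_def)

lemma related_carriers:
  assumes "related V W"
  shows "\<alpha> \<in> K \<Longrightarrow> V \<alpha> \<in> carrier_mat (d j) (d (tail Q \<alpha>))" "\<alpha> \<in> K \<Longrightarrow> W \<alpha> \<in> carrier_mat (d (tail Q \<alpha>)) e"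
    "V \<in> rep_space Q d" "W \<in> rep_space Q' d'"
  using assms rep_carrier_K rep'_carrier_K by (auto simp: related_def paired_def)

text \<open>Apply the base change of \<open>V1\<close> to the blocks of \<open>W1\<close>. The result is a kernel basis for \<open>V2\<close>, as \<open>W2\<close> is,
  and the two differ by a base change at \<open>j\<close>.\<close>

lemma related_orbits:
  assumes R1: "related V1 W1" and R2: "related V2 W2" and orb: "V2 \<in> base_change_orbit Q d V1"
  shows "W2 \<in> base_change_orbit Q' d' W1"
proof -
  note c1 = related_carriers[OF R1] and c2 = related_carriers[OF R2]
  have wf': "wf_digraph Q'" using fin_reflect by (simp add: fin_digraph_def)
  obtain g h where gh: "\<forall>i\<in>verts Q. inverse_pair (d i) (g i) (h i)"
    and V2: "\<forall>\<alpha>\<in>arcs Q. V2 \<alpha> = g (head Q \<alpha>) * V1 \<alpha> * h (tail Q \<alpha>)"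
    using orb unfolding base_change_orbit_iff[OF wf_digraph_axioms c2(3)] by blast
  have ghK: "inverse_pair (d (tail Q \<alpha>)) (g (tail Q \<alpha>)) (h (tail Q \<alpha>))" if "\<alpha> \<in> K" for \<alpha>
    using gh tail_K(1)[OF that] by blast
  have gj: "g j \<in> carrier_mat (d j) (d j)" using gh j by (auto simp: inverse_pair_def)
  obtain P1 L1 where 1: "P1 \<in> carrier_mat N (d j)" "in_mat V1 * P1 = 1\<^sub>m (d j)"
    "L1 \<in> carrier_mat e N" "L1 * out_mat W1 = 1\<^sub>m e" "in_mat V1 * out_mat W1 = 0\<^sub>m (d j) e"
    by (rule related_split[OF R1])
  obtain P2 L2 where 2: "P2 \<in> carrier_mat N (d j)" "in_mat V2 * P2 = 1\<^sub>m (d j)"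
    "L2 \<in> carrier_mat e N" "L2 * out_mat W2 = 1\<^sub>m e" "in_mat V2 * out_mat W2 = 0\<^sub>m (d j) e"
    by (rule related_split[OF R2])
  define W where "W \<alpha> = g (tail Q \<alpha>) * W1 \<alpha>" for \<alpha>
  have Wc: "W \<alpha> \<in> carrier_mat (d (tail Q \<alpha>)) e" if "\<alpha> \<in> K" for \<alpha>
    using ghK[OF that] c1(2)[OF that] by (auto simp: W_def inverse_pair_def)
  have gV: "g j * V1 \<alpha> \<in> carrier_mat (d j) (d (tail Q \<alpha>))" if "\<alpha> \<in> K" for \<alpha>
    using gj c1(1)[OF that] by simp
  have "in_mat V2 = in_mat (\<lambda>\<alpha>. g j * V1 \<alpha> * h (tail Q \<alpha>))"
    unfolding row_blocks_def using V2 idx_mem(1) by (intro cong_mat) auto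
  then have "in_mat V2 * out_mat W = in_mat (\<lambda>\<alpha>. g j * V1 \<alpha>) * out_mat W1"
    unfolding W_def using row_col_blocks_gauge[OF gV c1(2) ghK] by simp
  also have "\<dots> = g j * in_mat V1 * out_mat W1" using mult_row_blocks[OF c1(1) gj] by simp
  also have "\<dots> = g j * (in_mat V1 * out_mat W1)" by (rule assoc_mult_mat[OF gj carriers(2,3)])
  also have "\<dots> = 0\<^sub>m (d j) e" using 1(5) gj by simp
  finally have V2W: "in_mat V2 * out_mat W = 0\<^sub>m (d j) e" .
  define L where "L = row_blocks e (\<lambda>\<alpha>. L1 * transpose_mat (sel \<alpha>) * h (tail Q \<alpha>))"
  have L1c: "L1 * transpose_mat (sel \<alpha>) \<in> carrier_mat e (d (tail Q \<alpha>))" for \<alpha>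
    using 1(3) by (intro mult_carrier_mat) auto
  have "L * out_mat W = row_blocks e (\<lambda>\<alpha>. L1 * transpose_mat (sel \<alpha>)) * out_mat W1"
    unfolding L_def W_def by (rule row_col_blocks_gauge[OF L1c c1(2) ghK])
  also have "row_blocks e (\<lambda>\<alpha>. L1 * transpose_mat (sel \<alpha>)) = L1" by (rule row_blocks_sel[OF 1(3)]) simp
  finally have LW: "L * out_mat W = 1\<^sub>m e" using 1(4) by simp
  have Lc: "L \<in> carrier_mat e N" by (simp add: L_def)
  obtain k k' where k: "k \<in> carrier_mat e e" "k' \<in> carrier_mat e e" "k * k' = 1\<^sub>m e" "k' * k = 1\<^sub>m e"
    and W2: "out_mat W2 = out_mat W * k"
    using kernel_matrix_unique[OF N_eq(1) carriers(2) 2(1,2) carriers(3) Lc LW V2W carriers(3) 2(3,4,5)] by blast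
  have W2K: "W2 \<alpha> = g (tail Q \<alpha>) * W1 \<alpha> * k" if \<alpha>: "\<alpha> \<in> K" for \<alpha>
  proof -
    have "W2 \<alpha> = sel \<alpha> * (out_mat W * k)" using sel_col_blocks[where B=W2, OF \<alpha> c2(2)[OF \<alpha>]] W2 by simp
    also have "\<dots> = sel \<alpha> * out_mat W * k" by (rule assoc_mult_mat[symmetric, OF carriers(1,3) k(1)])
    also have "sel \<alpha> * out_mat W = W \<alpha>" by (rule sel_col_blocks[where B=W, OF \<alpha> Wc[OF \<alpha>]])
    finally show ?thesis by (simp add: W_def)
  qed
  show ?thesis
    unfolding base_change_orbit_iff[OF wf' c2(4)]
  proof (intro exI conjI ballI)
    fix i assume "i \<in> verts Q'"
    then show "inverse_pair (d' i) ((g(j := k')) i) ((h(j := k)) i)"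
      using gh k by (cases "i = j") (simp_all add: inverse_pair_def)
  next
    fix \<alpha> assume "\<alpha> \<in> arcs Q'"
    then have \<alpha>: "\<alpha> \<in> arcs Q" by simp
    show "W2 \<alpha> = (g(j := k')) (head Q' \<alpha>) * W1 \<alpha> * (h(j := k)) (tail Q' \<alpha>)"
    proof (cases "head Q \<alpha> = j")
      case True
      then show ?thesis using W2K[of \<alpha>] \<alpha> sink[OF \<alpha>] by simp
    next
      case False
      then have "W2 \<alpha> = V2 \<alpha>" "W1 \<alpha> = V1 \<alpha>" using R1 R2 \<alpha> by (auto simp: related_def paired_def)
      then show ?thesis using V2 \<alpha> False sink[OF \<alpha>] by simp
    qed
  qed
qed

lemma related_orbits_converse:
  assumes R1: "related V1 W1" and R2: "related V2 W2" and orb: "W2 \<in> base_change_orbit Q' d' W1"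
  shows "V2 \<in> base_change_orbit Q d V1"
proof -
  note c1 = related_carriers[OF R1] and c2 = related_carriers[OF R2]
  have wf': "wf_digraph Q'" using fin_reflect by (simp add: fin_digraph_def)
  obtain g h where gh: "\<forall>i\<in>verts Q'. inverse_pair (d' i) (g i) (h i)"
    and W2: "\<forall>\<alpha>\<in>arcs Q'. W2 \<alpha> = g (head Q' \<alpha>) * W1 \<alpha> * h (tail Q' \<alpha>)"
    using orb unfolding base_change_orbit_iff[OF wf' c2(4)] by blast
  have ghK: "inverse_pair (d (tail Q \<alpha>)) (g (tail Q \<alpha>)) (h (tail Q \<alpha>))" if "\<alpha> \<in> K" for \<alpha>
  proof -
    have "tail Q \<alpha> \<in> verts Q'" using tail_K(1)[OF that] by simp
    from bspec[OF gh this]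
    have "inverse_pair (d' (tail Q \<alpha>)) (g (tail Q \<alpha>)) (h (tail Q \<alpha>))" .
    then show ?thesis using tail_K(2)[OF that] by simp
  qed
  have "j \<in> verts Q'" using j by simp
  from bspec[OF gh this] have "inverse_pair (d' j) (g j) (h j)" .
  then have hj: "h j \<in> carrier_mat e e" by (simp add: inverse_pair_def)
  obtain P1 L1 where 1: "P1 \<in> carrier_mat N (d j)" "in_mat V1 * P1 = 1\<^sub>m (d j)"
    "L1 \<in> carrier_mat e N" "L1 * out_mat W1 = 1\<^sub>m e" "in_mat V1 * out_mat W1 = 0\<^sub>m (d j) e"
    by (rule related_split[OF R1])
  obtain P2 L2 where 2: "P2 \<in> carrier_mat N (d j)" "in_mat V2 * P2 = 1\<^sub>m (d j)"
    "L2 \<in> carrier_mat e N" "L2 * out_mat W2 = 1\<^sub>m e" "in_mat V2 * out_mat W2 = 0\<^sub>m (d j) e"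
    by (rule related_split[OF R2])
  define V where "V \<alpha> = V1 \<alpha> * h (tail Q \<alpha>)" for \<alpha>
  have Vc: "V \<alpha> \<in> carrier_mat (d j) (d (tail Q \<alpha>))" if "\<alpha> \<in> K" for \<alpha>
    using ghK[OF that] c1(1)[OF that] by (auto simp: V_def inverse_pair_def)
  have Wh: "W1 \<alpha> * h j \<in> carrier_mat (d (tail Q \<alpha>)) e" if "\<alpha> \<in> K" for \<alpha>
    using hj c1(2)[OF that] by simp
  have W2K: "W2 \<alpha> = g (tail Q \<alpha>) * (W1 \<alpha> * h j)" if \<alpha>: "\<alpha> \<in> K" for \<alpha>
  proof -
    have "W2 \<alpha> = g (tail Q \<alpha>) * W1 \<alpha> * h j" using W2 \<alpha> by simp
    also have "\<dots> = g (tail Q \<alpha>) * (W1 \<alpha> * h j)"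
      using ghK[OF \<alpha>] c1(2)[OF \<alpha>] hj unfolding inverse_pair_def by (intro assoc_mult_mat) auto
    finally show ?thesis .
  qed
  have "out_mat W2 = out_mat (\<lambda>\<alpha>. g (tail Q \<alpha>) * (W1 \<alpha> * h j))"
    unfolding col_blocks_def using W2K idx_mem(1) by (intro cong_mat) auto
  then have "in_mat V * out_mat W2 = in_mat V1 * out_mat (\<lambda>\<alpha>. W1 \<alpha> * h j)"
    unfolding V_def using row_col_blocks_gauge[OF c1(1) Wh ghK] by simp
  also have "\<dots> = in_mat V1 * (out_mat W1 * h j)" using col_blocks_mult[OF c1(2) hj] by simp
  also have "\<dots> = in_mat V1 * out_mat W1 * h j" by (rule assoc_mult_mat[symmetric, OF carriers(2,3) hj])
  also have "\<dots> = 0\<^sub>m (d j) e" using 1(5) hj by simp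
  finally have VW2: "in_mat V * out_mat W2 = 0\<^sub>m (d j) e" .
  define P where "P = col_blocks (d j) (\<lambda>\<alpha>. g (tail Q \<alpha>) * (sel \<alpha> * P1))"
  have P1c: "sel \<alpha> * P1 \<in> carrier_mat (d (tail Q \<alpha>)) (d j)" for \<alpha>
    using 1(1) by (intro mult_carrier_mat) auto
  have "in_mat V * P = in_mat V1 * col_blocks (d j) (\<lambda>\<alpha>. sel \<alpha> * P1)"
    unfolding P_def V_def by (rule row_col_blocks_gauge[OF c1(1) P1c ghK])
  also have "col_blocks (d j) (\<lambda>\<alpha>. sel \<alpha> * P1) = P1" by (rule col_blocks_sel[OF 1(1)]) simp
  finally have VP: "in_mat V * P = 1\<^sub>m (d j)" using 1(2) by simp
  have Pc: "P \<in> carrier_mat N (d j)" by (simp add: P_def)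
  obtain k k' where k: "k \<in> carrier_mat (d j) (d j)" "k' \<in> carrier_mat (d j) (d j)"
      "k * k' = 1\<^sub>m (d j)" "k' * k = 1\<^sub>m (d j)"
    and V2: "in_mat V2 = k * in_mat V"
    using cokernel_matrix_unique[OF N_eq(1) carriers(3) 2(3,4) carriers(2) Pc VP VW2 carriers(2) 2(1,2,5)] by blast
  have V2K: "V2 \<alpha> = k * V1 \<alpha> * h (tail Q \<alpha>)" if \<alpha>: "\<alpha> \<in> K" for \<alpha>
  proof -
    have "V2 \<alpha> = k * in_mat V * transpose_mat (sel \<alpha>)"
      using row_blocks_sel_transpose[where A=V2, OF \<alpha> c2(1)[OF \<alpha>]] V2 by simp
    also have "\<dots> = k * (in_mat V * transpose_mat (sel \<alpha>))"
      using carriers(1)[of \<alpha>] by (intro assoc_mult_mat[OF k(1) carriers(2), of _ "d (tail Q \<alpha>)"]) simp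
    also have "in_mat V * transpose_mat (sel \<alpha>) = V \<alpha>" by (rule row_blocks_sel_transpose[where A=V, OF \<alpha> Vc[OF \<alpha>]])
    also have "k * V \<alpha> = k * V1 \<alpha> * h (tail Q \<alpha>)"
      unfolding V_def using ghK[OF \<alpha>] c1(1)[OF \<alpha>] k(1) unfolding inverse_pair_def
      by (intro assoc_mult_mat[symmetric]) auto
    finally show ?thesis .
  qed
  show ?thesis
    unfolding base_change_orbit_iff[OF wf_digraph_axioms c2(3)]
  proof (intro exI conjI ballI)
    fix i assume i: "i \<in> verts Q"
    have "i \<in> verts Q'" using i by simp
    from bspec[OF gh this] have "inverse_pair (d' i) (g i) (h i)" .
    then show "inverse_pair (d i) ((g(j := k)) i) ((h(j := k')) i)"
      using k by (cases "i = j") (simp_all add: inverse_pair_def)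
  next
    fix \<alpha> assume \<alpha>: "\<alpha> \<in> arcs Q"
    show "V2 \<alpha> = (g(j := k)) (head Q \<alpha>) * V1 \<alpha> * (h(j := k')) (tail Q \<alpha>)"
    proof (cases "head Q \<alpha> = j")
      case True
      then show ?thesis using V2K[of \<alpha>] \<alpha> sink[OF \<alpha>] by simp
    next
      case False
      then have "W2 \<alpha> = V2 \<alpha>" "W1 \<alpha> = V1 \<alpha>" using R1 R2 \<alpha> by (auto simp: related_def paired_def)
      moreover have "W2 \<alpha> = g (head Q' \<alpha>) * W1 \<alpha> * h (tail Q' \<alpha>)" using W2 \<alpha> by simp
      ultimately show ?thesis using False sink[OF \<alpha>] by simp
    qed
  qed
qed

lemma in_mat_poly: "i < d j \<Longrightarrow> c < N \<Longrightarrow> (\<lambda>V. in_mat V $$ (i, c)) \<in> poly_functions Q d"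
  unfolding row_blocks_def using idx_mem[of c] by (simp add: poly_functions.coord)

lemma out_mat_poly:
  assumes "c < N" "i < e"
  shows "(\<lambda>W. out_mat W $$ (c, i)) \<in> poly_functions Q' d'"
proof -
  have "(\<lambda>W. W (fst (idx c)) $$ (snd (idx c), i)) \<in> poly_functions Q' d'"
    by (rule poly_functions.coord) (use idx_mem[OF assms(1)] sink assms(2) in simp_all)
  then show ?thesis unfolding col_blocks_def using assms by simp
qed

lemma correspondence: "orbit_correspondence Q d X Q' d' X' related"
proof
  show "X \<subseteq> rep_space Q d" "X' \<subseteq> rep_space Q' d'" by (auto simp: semistable_locus_def)
  show "V \<in> X" "W \<in> X'" if "related V W" for V W using that by (simp_all add: related_def)
  show "\<exists>W. related V W" if V: "V \<in> X" for V
  proof -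
    obtain P where P: "P \<in> carrier_mat N (d j)" "in_mat V * P = 1\<^sub>m (d j)" using X_right_inverse[OF V] by blast
    obtain M L where "M \<in> carrier_mat N e" "L \<in> carrier_mat e N" "L * M = 1\<^sub>m e" "in_mat V * M = 0\<^sub>m (d j) e"
      by (rule kernel_matrix_exists[OF N_eq(1) carriers(2) P])
    then show ?thesis using related_with_out_mat[OF V] by blast
  qed
  show "W2 \<in> base_change_orbit Q' d' W1"
    if "related V1 W1" "related V2 W2" "V2 \<in> base_change_orbit Q d V1" for V1 W1 V2 W2
    using that by (rule related_orbits)
  fix V W assume R: "related V W"
  interpret A: function_algebra "poly_functions Q d" by (rule function_algebra_poly)
  obtain P L where PL: "P \<in> carrier_mat N (d j)" "in_mat V * P = 1\<^sub>m (d j)"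
    "L \<in> carrier_mat e N" "L * out_mat W = 1\<^sub>m e" "in_mat V * out_mat W = 0\<^sub>m (d j) e"
    by (rule related_split[OF R])
  obtain D S where D: "D \<in> poly_functions Q d" "D V \<noteq> 0" and S0: "S V = out_mat W"
    and S: "\<And>V. S V \<in> carrier_mat N e" "\<And>V. D V \<noteq> 0 \<Longrightarrow> in_mat V * S V = 0\<^sub>m (d j) e"
      "\<And>V. D V \<noteq> 0 \<Longrightarrow> L * S V = 1\<^sub>m e"
    and Sp: "\<And>i k. i < N \<Longrightarrow> k < e \<Longrightarrow> \<exists>a\<in>poly_functions Q d. \<forall>V. S V $$ (i, k) = a V / D V"
    by (rule A.kernel_section[OF N_eq(1) carriers(2) in_mat_poly PL(1,2) carriers(3) PL(3,4,5)])
      (assumption+, rule that)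
  define s where "s V = with_out_mat V (S V)" for V
  have "s V = W" using with_out_mat_related[OF R] by (simp add: s_def S0)
  moreover have "\<forall>V'\<in>{V' \<in> X. D V' \<noteq> 0}. related V' (s V')"
    unfolding s_def using related_with_out_mat[OF _ S(1,2) PL(3) S(3)] by blast
  moreover have "fraction_on Q d {V' \<in> X. D V' \<noteq> 0} (\<lambda>V'. p (s V'))" if "p \<in> poly_functions Q' d'" for p
    using _ that
  proof (rule fraction_on_pullback)
    fix \<alpha> r k assume "\<alpha> \<in> arcs Q'" and rk: "r < d' (head Q' \<alpha>)" "k < d' (tail Q' \<alpha>)"
    then have \<alpha>: "\<alpha> \<in> arcs Q" by simp
    show "fraction_on Q d {V' \<in> X. D V' \<noteq> 0} (\<lambda>V'. s V' \<alpha> $$ (r, k))"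
    proof (cases "head Q \<alpha> = j")
      case True
      then have \<alpha>K: "\<alpha> \<in> K" and rk': "r < d (tail Q \<alpha>)" "k < e" using \<alpha> rk sink[OF \<alpha>] by simp_all
      from Sp[OF pos_less[OF \<alpha>K rk'(1)] rk'(2)] obtain a where a: "a \<in> poly_functions Q d"
        and eq: "\<forall>V. S V $$ (pos \<alpha> r, k) = a V / D V" by (rule bexE)
      show ?thesis
      proof (rule fraction_on_divide[OF a D(1)])
        fix V' assume "V' \<in> {V' \<in> X. D V' \<noteq> 0}"
        then show "D V' \<noteq> 0" by simp
        show "s V' \<alpha> $$ (r, k) = a V' / D V'"
          using True \<alpha> sel_mat[OF \<alpha>K S(1) rk'] eq by (simp add: s_def with_out_mat_def)
      qed
    next
      case False
      have "(\<lambda>V. V \<alpha> $$ (r, k)) \<in> poly_functions Q d"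
        using poly_functions.coord[OF \<alpha>, of r d k] rk False sink[OF \<alpha>] by simp
      then show ?thesis
        by (rule fraction_on_poly) (use False \<alpha> in \<open>simp add: s_def with_out_mat_def\<close>)
    qed
  qed
  ultimately show "\<exists>D\<in>poly_functions Q d. \<exists>s. D V \<noteq> 0 \<and> s V = W \<and>
       (\<forall>V'\<in>{V' \<in> X. D V' \<noteq> 0}. related V' (s V')) \<and>
       (\<forall>p\<in>poly_functions Q' d'. fraction_on Q d {V' \<in> X. D V' \<noteq> 0} (\<lambda>V'. p (s V')))"
    by (intro bexI[of _ D] exI[of _ s] conjI ballI D) simp_all
qed

lemma correspondence_converse: "orbit_correspondence Q' d' X' Q d X (\<lambda>W V. related V W)"
proof
  show "X \<subseteq> rep_space Q d" "X' \<subseteq> rep_space Q' d'" by (auto simp: semistable_locus_def)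
  show "W \<in> X'" "V \<in> X" if "related V W" for V W using that by (simp_all add: related_def)
  show "\<exists>V. related V W" if W: "W \<in> X'" for W
  proof -
    obtain L where L: "L \<in> carrier_mat e N" "L * out_mat W = 1\<^sub>m e" using X'_left_inverse[OF W] by blast
    obtain M P where "M \<in> carrier_mat (d j) N" "P \<in> carrier_mat N (d j)" "M * P = 1\<^sub>m (d j)" "M * out_mat W = 0\<^sub>m (d j) e"
      by (rule cokernel_matrix_exists[OF N_eq(1) carriers(3) L])
    then show ?thesis using related_with_in_mat[OF W] by blast
  qed
  show "V2 \<in> base_change_orbit Q d V1"
    if "related V1 W1" "related V2 W2" "W2 \<in> base_change_orbit Q' d' W1" for V1 W1 V2 W2
    using that by (rule related_orbits_converse)
  fix V W assume R: "related V W"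
  interpret A: function_algebra "poly_functions Q' d'" by (rule function_algebra_poly)
  obtain P L where PL: "P \<in> carrier_mat N (d j)" "in_mat V * P = 1\<^sub>m (d j)"
    "L \<in> carrier_mat e N" "L * out_mat W = 1\<^sub>m e" "in_mat V * out_mat W = 0\<^sub>m (d j) e"
    by (rule related_split[OF R])
  obtain D S where D: "D \<in> poly_functions Q' d'" "D W \<noteq> 0" and S0: "S W = in_mat V"
    and S: "\<And>W. S W \<in> carrier_mat (d j) N" "\<And>W. D W \<noteq> 0 \<Longrightarrow> S W * out_mat W = 0\<^sub>m (d j) e"
      "\<And>W. D W \<noteq> 0 \<Longrightarrow> S W * P = 1\<^sub>m (d j)"
    and Sp: "\<And>i k. i < d j \<Longrightarrow> k < N \<Longrightarrow> \<exists>a\<in>poly_functions Q' d'. \<forall>W. S W $$ (i, k) = a W / D W"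
    by (rule A.cokernel_section[OF N_eq(1) carriers(3) out_mat_poly PL(3,4) carriers(2) PL(1,2,5)])
      (assumption+, rule that)
  define s where "s W = with_in_mat W (S W)" for W
  have "s W = V" using with_in_mat_related[OF R] by (simp add: s_def S0)
  moreover have "\<forall>W'\<in>{W' \<in> X'. D W' \<noteq> 0}. related (s W') W'"
    unfolding s_def using related_with_in_mat[OF _ S(1,2) PL(1) S(3)] by blast
  moreover have "fraction_on Q' d' {W' \<in> X'. D W' \<noteq> 0} (\<lambda>W'. p (s W'))" if "p \<in> poly_functions Q d" for p
    using _ that
  proof (rule fraction_on_pullback)
    fix \<alpha> r k assume \<alpha>: "\<alpha> \<in> arcs Q" and rk: "r < d (head Q \<alpha>)" "k < d (tail Q \<alpha>)"
    show "fraction_on Q' d' {W' \<in> X'. D W' \<noteq> 0} (\<lambda>W'. s W' \<alpha> $$ (r, k))"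
    proof (cases "head Q \<alpha> = j")
      case True
      then have \<alpha>K: "\<alpha> \<in> K" and rj: "r < d j" using \<alpha> rk by simp_all
      from Sp[OF rj pos_less[OF \<alpha>K rk(2)]] obtain a where a: "a \<in> poly_functions Q' d'"
        and eq: "\<forall>W. S W $$ (r, pos \<alpha> k) = a W / D W" by (rule bexE)
      show ?thesis
      proof (rule fraction_on_divide[OF a D(1)])
        fix W' assume "W' \<in> {W' \<in> X'. D W' \<noteq> 0}"
        then show "D W' \<noteq> 0" by simp
        show "s W' \<alpha> $$ (r, k) = a W' / D W'"
          using True \<alpha> mat_sel[OF \<alpha>K S(1) rj rk(2)] eq by (simp add: s_def with_in_mat_def)
      qed
    next
      case False
      have "(\<lambda>W. W \<alpha> $$ (r, k)) \<in> poly_functions Q' d'"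
        by (rule poly_functions.coord) (use \<alpha> rk False sink[OF \<alpha>] in simp_all)
      then show ?thesis
        by (rule fraction_on_poly) (use False \<alpha> in \<open>simp add: s_def with_in_mat_def\<close>)
    qed
  qed
  ultimately show "\<exists>D\<in>poly_functions Q' d'. \<exists>s. D W \<noteq> 0 \<and> s W = V \<and>
       (\<forall>V'\<in>{W' \<in> X'. D W' \<noteq> 0}. related (s V') V') \<and>
       (\<forall>p\<in>poly_functions Q d. fraction_on Q' d' {W' \<in> X'. D W' \<noteq> 0} (\<lambda>V'. p (s V')))"
    by (intro bexI[of _ D] exI[of _ s] conjI ballI D) simp_all
qed

theorem moduli_space_reflection:
  "moduli_space Q (self_stability Q d) d \<simeq>\<^sub>v moduli_space Q' (self_stability Q' d') d'"
  unfolding moduli_space_def by (rule git_quotient_isomorphic[OF correspondence correspondence_converse])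

end


section \<open>The opposite quiver\<close>

text \<open>The isomorphism \<open>(\<sigma>, \<tau>)\<close> from the opposite of \<open>Q\<close> to \<open>Q'\<close> is part of the data because the opposite
  of the twice reflected \<open>F\<^sub>n\<close> is again \<open>F\<^sub>n\<close> only up to exchanging \<open>j\<^sub>1\<close> and \<open>j\<^sub>2\<close>.\<close>

locale opposite_quiver = fin_digraph Q for Q :: "('v, 'a) pre_digraph" +
  fixes d :: "'v \<Rightarrow> nat" and Q' :: "('w, 'b) pre_digraph" and d' :: "'w \<Rightarrow> nat"
    and \<sigma> :: "'v \<Rightarrow> 'w" and \<tau> :: "'a \<Rightarrow> 'b"
  assumes \<sigma>: "bij_betw \<sigma> (verts Q) (verts Q')" and \<tau>: "bij_betw \<tau> (arcs Q) (arcs Q')"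
    and tail': "\<alpha> \<in> arcs Q \<Longrightarrow> tail Q' (\<tau> \<alpha>) = \<sigma> (head Q \<alpha>)"
    and head': "\<alpha> \<in> arcs Q \<Longrightarrow> head Q' (\<tau> \<alpha>) = \<sigma> (tail Q \<alpha>)"
    and dims: "i \<in> verts Q \<Longrightarrow> d' (\<sigma> i) = d i"
begin

abbreviation "\<theta> \<equiv> self_stability Q d"
abbreviation "\<theta>' \<equiv> self_stability Q' d'"
abbreviation "\<rho> \<equiv> inv_into (verts Q) \<sigma>"
abbreviation "\<kappa> \<equiv> inv_into (arcs Q) \<tau>"
abbreviation "X \<equiv> semistable_locus Q \<theta> d"
abbreviation "X' \<equiv> semistable_locus Q' \<theta>' d'"

lemma \<rho>: "i \<in> verts Q \<Longrightarrow> \<rho> (\<sigma> i) = i" "i' \<in> verts Q' \<Longrightarrow> \<rho> i' \<in> verts Q" "i' \<in> verts Q' \<Longrightarrow> \<sigma> (\<rho> i') = i'"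
  using \<sigma> by (auto simp: bij_betw_def inv_into_into f_inv_into_f)

lemma \<kappa>: "\<alpha> \<in> arcs Q \<Longrightarrow> \<kappa> (\<tau> \<alpha>) = \<alpha>" "\<beta> \<in> arcs Q' \<Longrightarrow> \<kappa> \<beta> \<in> arcs Q" "\<beta> \<in> arcs Q' \<Longrightarrow> \<tau> (\<kappa> \<beta>) = \<beta>"
    "\<alpha> \<in> arcs Q \<Longrightarrow> \<tau> \<alpha> \<in> arcs Q'"
  using \<tau> by (auto simp: bij_betw_def inv_into_into f_inv_into_f)

lemma \<sigma>_mem: "i \<in> verts Q \<Longrightarrow> \<sigma> i \<in> verts Q'" using \<sigma> by (rule bij_betw_apply)

lemma ends: "\<beta> \<in> arcs Q' \<Longrightarrow> tail Q' \<beta> = \<sigma> (head Q (\<kappa> \<beta>))" "\<beta> \<in> arcs Q' \<Longrightarrow> head Q' \<beta> = \<sigma> (tail Q (\<kappa> \<beta>))"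
  using tail'[OF \<kappa>(2)] head'[OF \<kappa>(2)] \<kappa>(3) by simp_all

lemma fin_opposite: "fin_digraph Q'"
proof
  show "finite (verts Q')" using bij_betw_finite[OF \<sigma>] by simp
  show "finite (arcs Q')" using bij_betw_finite[OF \<tau>] by simp
  fix \<beta> assume "\<beta> \<in> arcs Q'"
  then show "tail Q' \<beta> \<in> verts Q'" "head Q' \<beta> \<in> verts Q'"
    unfolding ends[OF \<open>\<beta> \<in> arcs Q'\<close>] using \<kappa>(2)[of \<beta>] by (auto intro!: \<sigma>_mem)
qed

lemma converse: "opposite_quiver Q' d' Q d \<rho> \<kappa>"
proof -
  interpret Q': fin_digraph Q' by (rule fin_opposite)
  show ?thesis
  proof
    show "bij_betw \<rho> (verts Q') (verts Q)" by (rule bij_betw_inv_into[OF \<sigma>])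
    show "bij_betw \<kappa> (arcs Q') (arcs Q)" by (rule bij_betw_inv_into[OF \<tau>])
    show "tail Q (\<kappa> \<beta>) = \<rho> (head Q' \<beta>)" "head Q (\<kappa> \<beta>) = \<rho> (tail Q' \<beta>)" if "\<beta> \<in> arcs Q'" for \<beta>
      using ends[OF that] \<rho>(1) \<kappa>(2)[OF that] by simp_all
    show "d (\<rho> i') = d' i'" if "i' \<in> verts Q'" for i'
      using dims[OF \<rho>(2)[OF that]] \<rho>(3)[OF that] by simp
  qed
qed

definition dual :: "('a \<Rightarrow> complex mat) \<Rightarrow> 'b \<Rightarrow> complex mat" where
  "dual V = (\<lambda>\<beta>\<in>arcs Q'. transpose_mat (V (\<kappa> \<beta>)))"

lemma dual_\<tau>: "\<alpha> \<in> arcs Q \<Longrightarrow> dual V (\<tau> \<alpha>) = transpose_mat (V \<alpha>)"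
  by (simp add: dual_def \<kappa>)

lemma dual_rep:
  assumes V: "V \<in> rep_space Q d" shows "dual V \<in> rep_space Q' d'"
  unfolding rep_space_def
proof (rule PiE_I)
  fix \<beta> assume \<beta>: "\<beta> \<in> arcs Q'"
  have k: "\<kappa> \<beta> \<in> arcs Q" by (rule \<kappa>(2)[OF \<beta>])
  show "dual V \<beta> \<in> carrier_mat (d' (head Q' \<beta>)) (d' (tail Q' \<beta>))"
    unfolding ends[OF \<beta>] dims[OF head_in_verts[OF k]] dims[OF tail_in_verts[OF k]]
    using rep_carrier[OF V k] \<beta> by (simp add: dual_def)
qed (simp add: dual_def)

lemma stability_opposite:
  "\<theta>' f = - \<theta> (\<lambda>i. f (\<sigma> i))"
proof -
  interpret Q': fin_digraph Q' by (rule fin_opposite)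
  let ?t = "\<lambda>\<beta>. f (tail Q' \<beta>) * int (d' (head Q' \<beta>)) - int (d' (tail Q' \<beta>)) * f (head Q' \<beta>)"
  have "\<theta>' f = (\<Sum>\<beta>\<in>arcs Q'. ?t \<beta>)"
    by (rule self_stability_eq)
  also have "\<dots> = (\<Sum>\<alpha>\<in>arcs Q. ?t (\<tau> \<alpha>))" by (rule sum.reindex_bij_betw[OF \<tau>, symmetric])
  also have "\<dots> = (\<Sum>\<alpha>\<in>arcs Q. - (f (\<sigma> (tail Q \<alpha>)) * int (d (head Q \<alpha>)) - int (d (tail Q \<alpha>)) * f (\<sigma> (head Q \<alpha>))))"
    by (intro sum.cong refl) (simp add: tail' head' dims)
  also have "\<dots> = - \<theta> (\<lambda>i. f (\<sigma> i))"
    unfolding self_stability_eq sum_negf ..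
  finally show ?thesis .
qed

lemma stability_complement:
  assumes "\<And>i. i \<in> verts Q \<Longrightarrow> f i + f' i = int (d i)"
  shows "\<theta> f = - \<theta> f'"
proof -
  have "\<theta> f + \<theta> f' = \<theta> (\<lambda>i. int (d i))"
    unfolding self_stability_eq sum.distrib[symmetric]
  proof (intro sum.cong refl)
    fix \<alpha> assume "\<alpha> \<in> arcs Q"
    then have complement: "f' (tail Q \<alpha>) = int (d (tail Q \<alpha>)) - f (tail Q \<alpha>)" "f' (head Q \<alpha>) = int (d (head Q \<alpha>)) - f (head Q \<alpha>)"
      using assms[of "tail Q \<alpha>"] assms[of "head Q \<alpha>"] by auto
    then show "f (tail Q \<alpha>) * int (d (head Q \<alpha>)) - int (d (tail Q \<alpha>)) * f (head Q \<alpha>) +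
        (f' (tail Q \<alpha>) * int (d (head Q \<alpha>)) - int (d (tail Q \<alpha>)) * f' (head Q \<alpha>)) =
        int (d (tail Q \<alpha>)) * int (d (head Q \<alpha>)) - int (d (tail Q \<alpha>)) * int (d (head Q \<alpha>))"
      unfolding complement by (simp add: algebra_simps)
  qed
  then show ?thesis by (simp add: self_stability_self)
qed

text \<open>The annihilators of a subrepresentation of the dual form a subrepresentation of \<open>V\<close> with the
  complementary dimension vector. Here \<open>\<theta>(d - f) = - \<theta>(f)\<close>, and \<open>\<theta>'\<close> is \<open>- \<theta>\<close>, so the signs cancel.\<close>

lemma semistable_dual:
  assumes V: "V \<in> rep_space Q d" and ss: "semistable Q \<theta> d V"
  shows "semistable Q' \<theta>' d' (dual V)"
  unfolding semistable_iff[OF fin_opposite]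
proof (intro allI impI)
  fix U' assume U': "subrep Q' d' (dual V) U'"
  define U where "U i = annihilator (d i) (U' (\<sigma> i))" for i
  have lin: "lin_sub (d i) (U' (\<sigma> i))" if "i \<in> verts Q" for i
    using U' \<sigma>_mem[OF that] dims[OF that] unfolding subrep_def by metis
  have "subrep Q d V U" unfolding subrep_def
  proof (intro conjI ballI)
    show "lin_sub (d i) (U i)" if "i \<in> verts Q" for i
      unfolding U_def by (rule annihilator(1)[OF lin[OF that]])
    fix \<alpha> u assume \<alpha>: "\<alpha> \<in> arcs Q" and u: "u \<in> U (tail Q \<alpha>)"
    note Vc = rep_carrier[OF V \<alpha>]
    have uc: "u \<in> carrier_vec (d (tail Q \<alpha>))" and u0: "\<forall>y\<in>U' (\<sigma> (tail Q \<alpha>)). y \<bullet> u = 0"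
      using u by (auto simp: U_def annihilator_def)
    have "x \<bullet> (V \<alpha> *\<^sub>v u) = 0" if x: "x \<in> U' (\<sigma> (head Q \<alpha>))" for x
    proof -
      have xc: "x \<in> carrier_vec (d (head Q \<alpha>))" using x lin[OF head_in_verts[OF \<alpha>]] by (auto simp: lin_sub_iff)
      have "\<forall>x\<in>U' (tail Q' (\<tau> \<alpha>)). dual V (\<tau> \<alpha>) *\<^sub>v x \<in> U' (head Q' (\<tau> \<alpha>))"
        using U' \<kappa>(4)[OF \<alpha>] unfolding subrep_def by blast
      then have "transpose_mat (V \<alpha>) *\<^sub>v x \<in> U' (\<sigma> (tail Q \<alpha>))"
        using x unfolding tail'[OF \<alpha>] head'[OF \<alpha>] dual_\<tau>[OF \<alpha>] by (rule bspec)
      then have "(transpose_mat (V \<alpha>) *\<^sub>v x) \<bullet> u = 0" by (rule bspec[OF u0])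
      then show ?thesis using transpose_vec_mult_scalar[OF Vc uc xc] by simp
    qed
    then show "V \<alpha> *\<^sub>v u \<in> U (head Q \<alpha>)"
      unfolding U_def annihilator_def using Vc uc by simp
  qed
  then have le: "\<theta> (dimvec d U) \<le> 0"
    using ss unfolding semistable_iff[OF fin_digraph_axioms] by blast
  have "int (subrep_dim d U i) + int (subrep_dim d' U' (\<sigma> i)) = int (d i)" if "i \<in> verts Q" for i
  proof -
    have "sdim (d i) (U i) + sdim (d i) (U' (\<sigma> i)) = d i"
      unfolding U_def by (rule annihilator(2)[OF lin[OF that]])
    then show ?thesis unfolding subrep_dim_eq dims[OF that] by (metis of_nat_add)
  qed
  then have "\<theta> (dimvec d U) = - \<theta> (\<lambda>i. int (subrep_dim d' U' (\<sigma> i)))"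
    by (rule stability_complement)
  then show "\<theta>' (dimvec d' U') \<le> 0"
    using le unfolding stability_opposite by simp
qed

lemma dual_semistable_locus: "V \<in> X \<Longrightarrow> dual V \<in> X'"
  using dual_rep semistable_dual by (simp add: semistable_locus_def)

lemma dual_orbit:
  assumes V1: "V1 \<in> rep_space Q d" and V2: "V2 \<in> rep_space Q d" and orb: "V2 \<in> base_change_orbit Q d V1"
  shows "dual V2 \<in> base_change_orbit Q' d' (dual V1)"
proof -
  interpret Q': fin_digraph Q' by (rule fin_opposite)
  obtain g h where gh: "\<forall>i\<in>verts Q. inverse_pair (d i) (g i) (h i)"
    and eq: "\<forall>\<alpha>\<in>arcs Q. V2 \<alpha> = g (head Q \<alpha>) * V1 \<alpha> * h (tail Q \<alpha>)"
    using orb unfolding base_change_orbit_iff[OF wf_digraph_axioms V2] by blast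
  show ?thesis
    unfolding base_change_orbit_iff[OF Q'.wf_digraph_axioms dual_rep[OF V2]]
  proof (intro exI conjI ballI)
    fix i' assume i': "i' \<in> verts Q'"
    have p: "inverse_pair (d (\<rho> i')) (g (\<rho> i')) (h (\<rho> i'))" by (rule bspec[OF gh \<rho>(2)[OF i']])
    have "d' i' = d (\<rho> i')" using dims[OF \<rho>(2)[OF i']] \<rho>(3)[OF i'] by simp
    then show "inverse_pair (d' i') ((\<lambda>i'. transpose_mat (h (\<rho> i'))) i') ((\<lambda>i'. transpose_mat (g (\<rho> i'))) i')"
      using p unfolding inverse_pair_def by (auto intro: transpose_eq_one)
  next
    fix \<beta> assume \<beta>: "\<beta> \<in> arcs Q'"
    define \<alpha> where "\<alpha> = \<kappa> \<beta>"
    have \<alpha>: "\<alpha> \<in> arcs Q" unfolding \<alpha>_def by (rule \<kappa>(2)[OF \<beta>])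
    have c: "V1 \<alpha> \<in> carrier_mat (d (head Q \<alpha>)) (d (tail Q \<alpha>))" "g (head Q \<alpha>) \<in> carrier_mat (d (head Q \<alpha>)) (d (head Q \<alpha>))"
      "h (tail Q \<alpha>) \<in> carrier_mat (d (tail Q \<alpha>)) (d (tail Q \<alpha>))"
      using rep_carrier[OF V1 \<alpha>] gh \<alpha> by (auto simp: inverse_pair_def)
    have "dual V2 \<beta> = transpose_mat (g (head Q \<alpha>) * V1 \<alpha> * h (tail Q \<alpha>))"
      using \<beta> eq \<alpha> by (simp add: dual_def \<alpha>_def)
    also have "\<dots> = transpose_mat (h (tail Q \<alpha>)) * transpose_mat (g (head Q \<alpha>) * V1 \<alpha>)"
      using c by (intro transpose_mult) auto
    also have "transpose_mat (g (head Q \<alpha>) * V1 \<alpha>) = transpose_mat (V1 \<alpha>) * transpose_mat (g (head Q \<alpha>))"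
      using c by (intro transpose_mult) auto
    also have "transpose_mat (h (tail Q \<alpha>)) * (transpose_mat (V1 \<alpha>) * transpose_mat (g (head Q \<alpha>)))
        = transpose_mat (h (tail Q \<alpha>)) * transpose_mat (V1 \<alpha>) * transpose_mat (g (head Q \<alpha>))"
      using c by (intro assoc_mult_mat[symmetric]) auto
    finally show "dual V2 \<beta> = (\<lambda>i'. transpose_mat (h (\<rho> i'))) (head Q' \<beta>) * dual V1 \<beta> *
        (\<lambda>i'. transpose_mat (g (\<rho> i'))) (tail Q' \<beta>)"
      unfolding ends[OF \<beta>] using \<beta> \<alpha> \<rho>(1) by (simp add: dual_def \<alpha>_def)
  qed
qed

lemma correspondence: "orbit_correspondence Q d X Q' d' X' (\<lambda>V W. V \<in> X \<and> W = dual V)"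
proof
  show "X \<subseteq> rep_space Q d" "X' \<subseteq> rep_space Q' d'" by (auto simp: semistable_locus_def)
  show "W \<in> X'" if "V \<in> X \<and> W = dual V" for V W using that dual_semistable_locus by simp
  show "W2 \<in> base_change_orbit Q' d' W1"
    if "V1 \<in> X \<and> W1 = dual V1" "V2 \<in> X \<and> W2 = dual V2" "V2 \<in> base_change_orbit Q d V1" for V1 W1 V2 W2
    using that dual_orbit[of V1 V2] by (simp add: semistable_locus_def)
  fix V W assume VW: "V \<in> X \<and> W = dual V"
  have "fraction_on Q d Y (\<lambda>V. p (dual V))" if "p \<in> poly_functions Q' d'" and Y: "Y \<subseteq> X" for p Y
    using _ that(1)
  proof (rule fraction_on_pullback)
    fix \<beta> r s assume \<beta>: "\<beta> \<in> arcs Q'" and rs: "r < d' (head Q' \<beta>)" "s < d' (tail Q' \<beta>)"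
    have k: "\<kappa> \<beta> \<in> arcs Q" by (rule \<kappa>(2)[OF \<beta>])
    have rs': "r < d (tail Q (\<kappa> \<beta>))" "s < d (head Q (\<kappa> \<beta>))"
      using rs unfolding ends[OF \<beta>] dims[OF head_in_verts[OF k]] dims[OF tail_in_verts[OF k]] .
    show "fraction_on Q d Y (\<lambda>V. dual V \<beta> $$ (r, s))"
    proof (rule fraction_on_poly)
      show "(\<lambda>V. V (\<kappa> \<beta>) $$ (s, r)) \<in> poly_functions Q d" by (rule poly_functions.coord[OF k rs'(2,1)])
      fix V assume "V \<in> Y"
      then have "V \<in> rep_space Q d" using Y by (auto simp: semistable_locus_def)
      from rep_carrier[OF this k] show "dual V \<beta> $$ (r, s) = V (\<kappa> \<beta>) $$ (s, r)"
        using \<beta> rs' by (simp add: dual_def)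
    qed
  qed
  then show "\<exists>D\<in>poly_functions Q d. \<exists>s. D V \<noteq> 0 \<and> s V = W \<and>
       (\<forall>V'\<in>{V' \<in> X. D V' \<noteq> 0}. V' \<in> X \<and> s V' = dual V') \<and>
       (\<forall>p\<in>poly_functions Q' d'. fraction_on Q d {V' \<in> X. D V' \<noteq> 0} (\<lambda>V'. p (s V')))"
    using VW by (intro bexI[of _ "\<lambda>_. 1"] exI[of _ dual] poly_functions.const) auto
qed auto

end

theorem (in opposite_quiver) moduli_space_opposite:
  "moduli_space Q (self_stability Q d) d \<simeq>\<^sub>v moduli_space Q' (self_stability Q' d') d'"
proof -
  interpret C: opposite_quiver Q' d' Q d \<rho> \<kappa> by (rule converse)
  have inv1: "C.dual (dual V) = V" if "V \<in> rep_space Q d" for V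
  proof (rule ext)
    fix \<alpha>
    show "C.dual (dual V) \<alpha> = V \<alpha>"
    proof (cases "\<alpha> \<in> arcs Q")
      case True
      have "C.dual (dual V) (\<kappa> (\<tau> \<alpha>)) = transpose_mat (dual V (\<tau> \<alpha>))"
        by (rule C.dual_\<tau>[OF \<kappa>(4)[OF True]])
      then show ?thesis unfolding dual_\<tau>[OF True] \<kappa>(1)[OF True] by simp
    next
      case False
      then show ?thesis using that by (simp add: C.dual_def rep_space_def PiE_def extensional_def)
    qed
  qed
  have inv2: "dual (C.dual W) = W" if "W \<in> rep_space Q' d'" for W
  proof (rule ext)
    fix \<beta>
    show "dual (C.dual W) \<beta> = W \<beta>"
    proof (cases "\<beta> \<in> arcs Q'")
      case True
      have "dual (C.dual W) (\<tau> (\<kappa> \<beta>)) = transpose_mat (C.dual W (\<kappa> \<beta>))"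
        by (rule dual_\<tau>[OF \<kappa>(2)[OF True]])
      then show ?thesis unfolding C.dual_\<tau>[OF True] \<kappa>(3)[OF True] by simp
    next
      case False
      then show ?thesis using that by (simp add: dual_def rep_space_def PiE_def extensional_def)
    qed
  qed
  have "(\<lambda>W V. W \<in> X' \<and> V = C.dual W) = (\<lambda>W V. V \<in> X \<and> W = dual V)"
    using inv1 inv2 dual_semistable_locus C.dual_semistable_locus
    by (intro ext) (auto simp: semistable_locus_def)
  then have "orbit_correspondence Q' d' X' Q d X (\<lambda>W V. V \<in> X \<and> W = dual V)"
    using C.correspondence by simp
  then show ?thesis
    unfolding moduli_space_def by (rule git_quotient_isomorphic[OF correspondence])
qed


section \<open>Quivers of type L, C and F\<close>

abbreviation self_moduli :: "('v, 'a) pre_digraph \<Rightarrow> ('v \<Rightarrow> nat) \<Rightarrow> ('a \<Rightarrow> complex mat) set space_with_functions" where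
  "self_moduli Q d \<equiv> moduli_space Q (self_stability Q d) d"

definition quiver_LC :: "nat \<Rightarrow> nat \<Rightarrow> (vertex_LC, vertex_LC \<times> vertex_LC \<times> nat) pre_digraph" where
  "quiver_LC r m = quiver_of (I ` {1..m} \<union> {J}) (arrows_LC r)"

lemma arrows_LC_less: "k < arrows_LC r x y \<longleftrightarrow> (\<exists>i. x = I i) \<and> y = J \<and> k < r"
  by (cases "(r, x, y)" rule: arrows_LC.cases) auto

lemma arcs_LC: "arcs (quiver_LC r m) = (\<lambda>(i, k). (I i, J, k)) ` ({1..m} \<times> {..<r})"
  by (auto simp: quiver_LC_def quiver_of_def arrows_LC_less)

lemma quiver_of_simps [simp]:
  "verts (quiver_of N a) = N" "tail (quiver_of N a) (x, y, k) = x" "head (quiver_of N a) (x, y, k) = y"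
  by (simp_all add: quiver_of_def)

lemma quiver_LC_simps [simp]:
  "verts (quiver_LC r m) = I ` {1..m} \<union> {J}" "tail (quiver_LC r m) (x, y, k) = x" "head (quiver_LC r m) (x, y, k) = y"
  by (simp_all add: quiver_LC_def)

lemma dim_LC_upd: "(dim_LC d)(J := e) = dim_LC e"
proof (rule ext)
  show "((dim_LC d)(J := e)) i = dim_LC e i" for i by (cases i) auto
qed

lemma moduli_LC_dual:
  assumes "d \<le> r * m"
  shows "self_moduli (quiver_LC r m) (dim_LC d) \<simeq>\<^sub>v self_moduli (quiver_LC r m) (dim_LC (r * m - d))"
proof -
  let ?Q = "quiver_LC r m"
  have "{\<alpha> \<in> arcs ?Q. head ?Q \<alpha> = J} = (\<lambda>(i, k). (I i, J, k)) ` ({1..m} \<times> {..<r})"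
    unfolding arcs_LC by auto
  moreover have "inj_on (\<lambda>(i, k). (I i, J, k)) ({1..m} \<times> {..<r})" by (auto simp: inj_on_def)
  ultimately have sum: "arrow_dim_sum ?Q J (dim_LC d) = r * m"
    unfolding arrow_dim_sum_def by (simp add: sum.reindex case_prod_unfold)
  interpret fin_digraph ?Q unfolding quiver_LC_def by (rule fin_digraph_quiver_of) simp
  interpret R: sink_reflection ?Q "dim_LC d" J
    by unfold_locales (use assms sum in \<open>auto simp: arcs_LC\<close>)
  have dim: "reflect_dim ?Q J (dim_LC d) = dim_LC (r * m - d)"
    unfolding reflect_dim_def sum dim_LC_upd by simp
  interpret Q1: fin_digraph "reflect_quiver ?Q J" by (rule R.fin_reflect)
  interpret O: opposite_quiver "reflect_quiver ?Q J" "dim_LC (r * m - d)" ?Q "dim_LC (r * m - d)" id id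
    by unfold_locales (auto simp: arcs_LC)
  show ?thesis
    using isomorphic_spaces_trans[OF R.moduli_space_reflection[unfolded dim] O.moduli_space_opposite] .
qed

lemma arrows_F_less: "k < arrows_F n x y \<longleftrightarrow>
    (\<exists>i. x = IF i) \<and> (y = J1 \<or> y = J2) \<and> k = 0 \<or> x = J1 \<and> y = J2 \<and> k < n"
  by (cases "(n, x, y)" rule: arrows_F.cases) auto

lemma arcs_F: "arcs (quiver_F n m) = (\<lambda>i. (IF i, J1, 0)) ` {1..m} \<union> (\<lambda>i. (IF i, J2, 0)) ` {1..m} \<union>
    (\<lambda>k. (J1, J2, k)) ` {..<n}"
  by (auto simp: quiver_F_def quiver_of_def arrows_F_less)

lemma quiver_F_simps [simp]:
  "verts (quiver_F n m) = IF ` {1..m} \<union> {J1, J2}" "tail (quiver_F n m) (x, y, k) = x" "head (quiver_F n m) (x, y, k) = y"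
  by (simp_all add: quiver_F_def)

lemma fin_digraph_F: "fin_digraph (quiver_F n m)"
  unfolding quiver_F_def by (rule fin_digraph_quiver_of) simp

lemma dim_F_upd: "(dim_F d1 d2)(J1 := e) = dim_F e d2" "(dim_F d1 d2)(J2 := e) = dim_F d1 e"
proof -
  show "(dim_F d1 d2)(J1 := e) = dim_F e d2"
  proof (rule ext)
    show "((dim_F d1 d2)(J1 := e)) i = dim_F e d2 i" for i by (cases i) auto
  qed
  show "(dim_F d1 d2)(J2 := e) = dim_F d1 e"
  proof (rule ext)
    show "((dim_F d1 d2)(J2 := e)) i = dim_F d1 e i" for i by (cases i) auto
  qed
qed

lemma moduli_F0_dual:
  assumes "d1 \<le> m" "d2 \<le> m"
  shows "self_moduli (quiver_F 0 m) (dim_F d1 d2) \<simeq>\<^sub>v self_moduli (quiver_F 0 m) (dim_F (m - d1) (m - d2))"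
proof -
  let ?Q = "quiver_F 0 m"
  let ?Q1 = "reflect_quiver ?Q J1"
  let ?Q2 = "reflect_quiver ?Q1 J2"
  interpret fin_digraph ?Q by (rule fin_digraph_F)
  have "{\<alpha> \<in> arcs ?Q. head ?Q \<alpha> = J1} = (\<lambda>i. (IF i, J1, 0)) ` {1..m}"
    unfolding arcs_F by auto
  then have sum1: "arrow_dim_sum ?Q J1 (dim_F d1 d2) = m"
    unfolding arrow_dim_sum_def by (simp add: sum.reindex inj_on_def)
  interpret R1: sink_reflection ?Q "dim_F d1 d2" J1
    by unfold_locales (use assms sum1 in \<open>auto simp: arcs_F\<close>)
  have dim1: "reflect_dim ?Q J1 (dim_F d1 d2) = dim_F (m - d1) d2"
    unfolding reflect_dim_def sum1 dim_F_upd by simp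
  interpret Q1: fin_digraph ?Q1 by (rule R1.fin_reflect)
  have "{\<alpha> \<in> arcs ?Q1. head ?Q1 \<alpha> = J2} = (\<lambda>i. (IF i, J2, 0)) ` {1..m}"
    by (auto simp: arcs_F)
  then have sum2: "arrow_dim_sum ?Q1 J2 (dim_F (m - d1) d2) = m"
    unfolding arrow_dim_sum_def by (simp add: sum.reindex inj_on_def)
  interpret R2: sink_reflection ?Q1 "dim_F (m - d1) d2" J2
    by unfold_locales (use assms sum2 in \<open>auto simp: arcs_F\<close>)
  have dim2: "reflect_dim ?Q1 J2 (dim_F (m - d1) d2) = dim_F (m - d1) (m - d2)"
    unfolding reflect_dim_def sum2 dim_F_upd by simp
  interpret Q2: fin_digraph ?Q2 by (rule R2.fin_reflect)
  interpret O: opposite_quiver ?Q2 "dim_F (m - d1) (m - d2)" ?Q "dim_F (m - d1) (m - d2)" id id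
    by unfold_locales (auto simp: arcs_F)
  show ?thesis
    using isomorphic_spaces_trans[OF R1.moduli_space_reflection[unfolded dim1]
        isomorphic_spaces_trans[OF R2.moduli_space_reflection[unfolded dim2] O.moduli_space_opposite]] .
qed

fun swap_vertex :: "vertex_F \<Rightarrow> vertex_F" where
  "swap_vertex (IF i) = IF i"
| "swap_vertex J1 = J2"
| "swap_vertex J2 = J1"

fun swap_arrow :: "vertex_F \<times> vertex_F \<times> nat \<Rightarrow> vertex_F \<times> vertex_F \<times> nat" where
  "swap_arrow (IF i, y, k) = (IF i, swap_vertex y, k)"
| "swap_arrow (x, y, k) = (x, y, k)"

text \<open>The equations say \<open>e1 = m + n * d1 - d2\<close> and \<open>e2 = m + n * e1 - d1\<close> with exact subtraction: the
  dimensions at \<open>J2\<close> and \<open>J1\<close> after the first and the second reflection.\<close>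

lemma moduli_F_dual:
  assumes d2: "d2 + e1 = m + n * d1" and d1: "d1 + e2 = m + n * e1"
  shows "self_moduli (quiver_F n m) (dim_F d1 d2) \<simeq>\<^sub>v self_moduli (quiver_F n m) (dim_F e1 e2)"
proof -
  let ?Q = "quiver_F n m"
  let ?Q1 = "reflect_quiver ?Q J2"
  let ?Q2 = "reflect_quiver ?Q1 J1"
  let ?A2 = "(\<lambda>i. (IF i, J2, 0 :: nat)) ` {1..m}"
  let ?A1 = "(\<lambda>i. (IF i, J1, 0 :: nat)) ` {1..m}"
  let ?B = "(\<lambda>k. (J1, J2, k)) ` {..<n}"
  interpret fin_digraph ?Q by (rule fin_digraph_F)
  have "{\<alpha> \<in> arcs ?Q. head ?Q \<alpha> = J2} = ?A2 \<union> ?B"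
    unfolding arcs_F by auto
  moreover have "?A2 \<inter> ?B = {}" by auto
  ultimately have sum1: "arrow_dim_sum ?Q J2 (dim_F d1 d2) = m + n * d1"
    unfolding arrow_dim_sum_def by (simp add: sum.union_disjoint sum.reindex inj_on_def)
  interpret R1: sink_reflection ?Q "dim_F d1 d2" J2
    by unfold_locales (use d2 sum1 in \<open>auto simp: arcs_F\<close>)
  have dim1: "reflect_dim ?Q J2 (dim_F d1 d2) = dim_F d1 e1"
    unfolding reflect_dim_def sum1 dim_F_upd by (simp flip: d2)
  interpret Q1: fin_digraph ?Q1 by (rule R1.fin_reflect)
  have "{\<alpha> \<in> arcs ?Q1. head ?Q1 \<alpha> = J1} = ?A1 \<union> ?B"
    by (auto simp: arcs_F)
  moreover have "?A1 \<inter> ?B = {}" by auto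
  ultimately have sum2: "arrow_dim_sum ?Q1 J1 (dim_F d1 e1) = m + n * e1"
    unfolding arrow_dim_sum_def by (simp add: sum.union_disjoint sum.reindex inj_on_def)
  interpret R2: sink_reflection ?Q1 "dim_F d1 e1" J1
    by unfold_locales (use d1 sum2 in \<open>auto simp: arcs_F\<close>)
  have dim2: "reflect_dim ?Q1 J1 (dim_F d1 e1) = dim_F e2 e1"
    unfolding reflect_dim_def sum2 dim_F_upd by (simp flip: d1)
  interpret Q2: fin_digraph ?Q2 by (rule R2.fin_reflect)
  have "bij_betw swap_vertex (IF ` {1..m} \<union> {J1, J2}) (IF ` {1..m} \<union> {J1, J2})"
    by (rule bij_betw_byWitness[where f'=swap_vertex]) auto
  moreover have "bij_betw swap_arrow (arcs ?Q) (arcs ?Q)"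
    unfolding arcs_F by (rule bij_betw_byWitness[where f'=swap_arrow]) auto
  ultimately interpret O: opposite_quiver ?Q2 "dim_F e2 e1" ?Q "dim_F e1 e2" swap_vertex swap_arrow
    by unfold_locales (auto simp: arcs_F)
  show ?thesis
    using isomorphic_spaces_trans[OF R1.moduli_space_reflection[unfolded dim1]
        isomorphic_spaces_trans[OF R2.moduli_space_reflection[unfolded dim2] O.moduli_space_opposite]] .
qed

theorem theorem1p9:
  fixes m d d1 d2 n :: nat
  shows "(coprime m d \<and> int m - int d > 0 \<longrightarrow> M_L m d \<simeq>\<^sub>v M_L m (m - d)) \<and>
    (coprime m d \<and> 2 * int m - int d > 0 \<longrightarrow> M_C m d \<simeq>\<^sub>v M_C m (2 * m - d)) \<and>
    (m > max d1 d2 \<and> coprime m (d1 + d2) \<longrightarrow>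
       M_F 0 m d1 d2 \<simeq>\<^sub>v M_F 0 m (m - d1) (m - d2)) \<and>
    (n > 0 \<and> (1 - int n) * int d1 + int d2 \<ge> 0 \<longrightarrow>
       M_F n (nat ((1 - int n) * int d1 + int d2 + 1)) d1 d2 \<simeq>\<^sub>v
       M_F n (nat ((1 - int n) * int d1 + int d2 + 1)) (d1 + 1) (d2 + n + 1))"
proof (intro conjI impI)
  assume "coprime m d \<and> int m - int d > 0"
  then show "M_L m d \<simeq>\<^sub>v M_L m (m - d)"
    using moduli_LC_dual[of d 1 m] by (simp add: M_L_def quiver_L_def quiver_LC_def)
next
  assume "coprime m d \<and> 2 * int m - int d > 0"
  then show "M_C m d \<simeq>\<^sub>v M_C m (2 * m - d)"
    using moduli_LC_dual[of d 2 m] by (simp add: M_C_def quiver_C_def quiver_LC_def)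
next
  assume "m > max d1 d2 \<and> coprime m (d1 + d2)"
  then show "M_F 0 m d1 d2 \<simeq>\<^sub>v M_F 0 m (m - d1) (m - d2)"
    using moduli_F0_dual[of d1 m d2] by (simp add: M_F_def)
next
  assume "n > 0 \<and> (1 - int n) * int d1 + int d2 \<ge> 0"
  moreover define m' where "m' = nat ((1 - int n) * int d1 + int d2 + 1)"
  ultimately have "int m' = (1 - int n) * int d1 + int d2 + 1" by simp
  then have "int (m' + n * d1) = int (d1 + d2 + 1)" by (simp add: algebra_simps)
  then have m': "m' + n * d1 = d1 + d2 + 1" by (simp only: of_nat_eq_iff)
  then have "d2 + (d1 + 1) = m' + n * d1" "d1 + (d2 + n + 1) = m' + n * (d1 + 1)" by simp_all
  from moduli_F_dual[OF this]
  show "M_F n (nat ((1 - int n) * int d1 + int d2 + 1)) d1 d2 \<simeq>\<^sub>v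
       M_F n (nat ((1 - int n) * int d1 + int d2 + 1)) (d1 + 1) (d2 + n + 1)"
    unfolding M_F_def m'_def .
qed

end
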